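(* For a given initial datum $u_0\in L^2(\Omega;\nu)$, there exists at most one weak solution $u$ of the Neumann problem (N) which satisfies the following additional hypothesis: $$u\in L^{m+1}\left((0,T);L^{m+1}(\Omega;\nu)\right)\qquad\forall T>0 .$$
   Context: $m>1$ is fixed, and for $q>0$, $x\in\mathbb{R}$ one sets $x^q:=|x|^q\operatorname{sign}(x)$. $\Omega\subseteq\mathbb{R}^N$ is a domain ($\Omega=\mathbb{R}^N$ allowed). $\rho_\nu,\rho_\mu$ are measurable weights, positive a.e. in $\Omega$, with $\rho_\mu^{-1}\in L^1_{loc}(\Omega)$; $\mathrm{d}\nu=\rho_\nu\,\mathrm{d}\mathbf{x}$, $\mathrm{d}\mu=\rho_\mu\,\mathrm{d}\mathbf{x}$; $L^p(\Omega;\nu)$, $L^p(\Omega;\mu)$ are the corresponding Lebesgue spaces. Neumann problem (N): $\rho_\nu u_t=\operatorname{div}(\rho_\mu\nabla(u^m))$ in $\Omega\times(0,\infty)$, $\rho_\mu\,\partial(u^m)/\partial\mathbf{n}=0$ on $\partial\Omega\times(0,\infty)$, $u(\cdot,0)=u_0$ in $\Omega$. Weak solution of (N) with initial datum $u_0\in L^2(\Omega;\nu)$: a function $u$ with $u\in L^2((0,T);L^2(\Omega;\nu))$ and $\nabla(u^m)\in L^2((0,T);[L^2(\Omega;\mu)]^N)$ for all $T>0$, such that (for every $T>0$) $$\int_0^T\!\!\int_\Omega u\,\eta_t\,\mathrm{d}\nu\,\mathrm{d}t=-\int_\Omega u_0(\mathbf{x})\eta(\mathbf{x},0)\,\mathrm{d}\nu+\int_0^T\!\!\int_\Omega\nabla(u^m)\cdot\nabla\eta\,\mathrm{d}\mu\,\mathrm{d}t$$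 for all $\eta\in W^{1,2}((0,T);L^2(\Omega;\nu))$ with $\nabla\eta\in L^2((0,T);[L^2(\Omega;\mu)]^N)$ and $\eta(T)=0$. *)

theory Defs
  imports "HOL-Analysis.Analysis"
begin

definition spow :: "real \<Rightarrow> real \<Rightarrow> real" where
  "spow x q = \<bar>x\<bar> powr q * sgn x"

definition weighted :: "'a::euclidean_space set \<Rightarrow> ('a \<Rightarrow> real) \<Rightarrow> 'a measure" where
  "weighted \<Omega> \<rho> = density (lebesgue_on \<Omega>) (\<lambda>x. ennreal (\<rho> x))"

definition in_Lp :: "real \<Rightarrow> 'b measure \<Rightarrow> ('b \<Rightarrow> 'c::euclidean_space) \<Rightarrow> bool" where
  "in_Lp p M f \<longleftrightarrow> f \<in> borel_measurable M \<and> integrable M (\<lambda>x. norm (f x) powr p)"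

text \<open>
  A function of time with values in function space is represented as a curried function
  of \<open>t\<close> and \<open>x\<close>. The space \<open>L\<^sup>p((0,T); L\<^sup>p(M))\<close> is identified, as usual, with
  \<open>L\<^sup>p((0,T) \<times> M)\<close>.
\<close>

definition in_LpLp ::
    "real \<Rightarrow> real \<Rightarrow> 'a measure \<Rightarrow> (real \<Rightarrow> 'a \<Rightarrow> 'c::euclidean_space) \<Rightarrow> bool" where
  "in_LpLp p T M f \<longleftrightarrow> in_Lp p (lebesgue_on {0<..<T} \<Otimes>\<^sub>M M) (\<lambda>(t, x). f t x)"

definition loc_integrable :: "'a::euclidean_space set \<Rightarrow> ('a \<Rightarrow> 'c::euclidean_space) \<Rightarrow> bool" where
  "loc_integrable \<Omega> f \<longleftrightarrow> (\<forall>K. compact K \<and> K \<subseteq> \<Omega> \<longrightarrow> integrable (lebesgue_on K) f)"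

primrec Ck :: "nat \<Rightarrow> ('a::euclidean_space \<Rightarrow> real) \<Rightarrow> bool" where
  "Ck 0 f \<longleftrightarrow> continuous_on UNIV f"
| "Ck (Suc k) f \<longleftrightarrow> (\<forall>x. f differentiable (at x)) \<and>
     (\<forall>i\<in>Basis. Ck k (\<lambda>x. frechet_derivative f (at x) i))"

definition Cc_infty :: "'a::euclidean_space set \<Rightarrow> ('a \<Rightarrow> real) set" where
  "Cc_infty \<Omega> = {\<phi>. (\<forall>k. Ck k \<phi>) \<and>
     compact (closure {x. \<phi> x \<noteq> 0}) \<and> closure {x. \<phi> x \<noteq> 0} \<subseteq> \<Omega>}"

definition weak_gradient ::
    "'a::euclidean_space set \<Rightarrow> ('a \<Rightarrow> real) \<Rightarrow> ('a \<Rightarrow> 'a) \<Rightarrow> bool" where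
  "weak_gradient \<Omega> f g \<longleftrightarrow> loc_integrable \<Omega> f \<and> loc_integrable \<Omega> g \<and>
     (\<forall>\<phi>\<in>Cc_infty \<Omega>. \<forall>i\<in>Basis.
        (LINT x|lebesgue_on \<Omega>. f x * frechet_derivative \<phi> (at x) i) =
        - (LINT x|lebesgue_on \<Omega>. (g x \<bullet> i) * \<phi> x))"

text \<open>
  \<open>\<eta> \<in> W\<^sup>1\<^sup>,\<^sup>2((0,T); L\<^sup>2(M))\<close> with weak time derivative \<open>\<eta>'\<close>. The integrals in \<open>t\<close> are the
  pointwise representatives of the corresponding \<open>L\<^sup>2(M)\<close>-valued Bochner integrals.
\<close>

definition W12_time ::
    "real \<Rightarrow> 'a measure \<Rightarrow> (real \<Rightarrow> 'a \<Rightarrow> real) \<Rightarrow> (real \<Rightarrow> 'a \<Rightarrow> real) \<Rightarrow> bool" where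
  "W12_time T M \<eta> \<eta>' \<longleftrightarrow> in_LpLp 2 T M \<eta> \<and> in_LpLp 2 T M \<eta>' \<and>
     (\<forall>\<psi>\<in>Cc_infty {0<..<T}. AE x in M.
        (LINT t|lebesgue_on {0<..<T}. \<eta> t x * deriv \<psi> t) =
        - (LINT t|lebesgue_on {0<..<T}. \<eta>' t x * \<psi> t))"

definition L2_continuous :: "real \<Rightarrow> 'a measure \<Rightarrow> (real \<Rightarrow> 'a \<Rightarrow> real) \<Rightarrow> bool" where
  "L2_continuous T M \<eta> \<longleftrightarrow> (\<forall>t\<in>{0..T}. in_Lp 2 M (\<eta> t) \<and>
     ((\<lambda>s. LINT x|M. (\<eta> s x - \<eta> t x)\<^sup>2) \<longlongrightarrow> 0) (at t within {0..T}))"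

text \<open>
  Admissible test functions with their weak time derivative \<open>\<eta>'\<close> and weak spatial gradient
  \<open>h\<close> (both determined up to null sets). Every element of \<open>W\<^sup>1\<^sup>,\<^sup>2((0,T); L\<^sup>2(M))\<close> has a
  representative in \<open>C([0,T]; L\<^sup>2(M))\<close>; \<open>\<eta>\<close> is taken to be that representative, which gives
  the meaning of the values \<open>\<eta> 0\<close> and \<open>\<eta> T\<close>.
\<close>

definition test_function ::
    "'a::euclidean_space set \<Rightarrow> ('a \<Rightarrow> real) \<Rightarrow> ('a \<Rightarrow> real) \<Rightarrow> real \<Rightarrow>
     (real \<Rightarrow> 'a \<Rightarrow> real) \<Rightarrow> (real \<Rightarrow> 'a \<Rightarrow> real) \<Rightarrow> (real \<Rightarrow> 'a \<Rightarrow> 'a) \<Rightarrow> bool" where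
  "test_function \<Omega> \<rho>\<nu> \<rho>\<mu> T \<eta> \<eta>' h \<longleftrightarrow>
     W12_time T (weighted \<Omega> \<rho>\<nu>) \<eta> \<eta>' \<and>
     L2_continuous T (weighted \<Omega> \<rho>\<nu>) \<eta> \<and>
     (AE t in lebesgue_on {0<..<T}. weak_gradient \<Omega> (\<eta> t) (h t)) \<and>
     in_LpLp 2 T (weighted \<Omega> \<rho>\<mu>) h \<and>
     (AE x in weighted \<Omega> \<rho>\<nu>. \<eta> T x = 0)"

text \<open>Here \<open>g\<close> is the weak spatial gradient of \<open>u\<^sup>m\<close>.\<close>

definition weak_solution_N ::
    "'a::euclidean_space set \<Rightarrow> ('a \<Rightarrow> real) \<Rightarrow> ('a \<Rightarrow> real) \<Rightarrow> real \<Rightarrow> ('a \<Rightarrow> real) \<Rightarrow>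
     (real \<Rightarrow> 'a \<Rightarrow> real) \<Rightarrow> bool" where
  "weak_solution_N \<Omega> \<rho>\<nu> \<rho>\<mu> m u0 u \<longleftrightarrow>
     (\<forall>T>0. in_LpLp 2 T (weighted \<Omega> \<rho>\<nu>) u) \<and>
     (\<exists>g.
        (AE t in lebesgue_on {0<..}. weak_gradient \<Omega> (\<lambda>x. spow (u t x) m) (g t)) \<and>
        (\<forall>T>0. in_LpLp 2 T (weighted \<Omega> \<rho>\<mu>) g) \<and>
        (\<forall>T>0. \<forall>\<eta> \<eta>' h. test_function \<Omega> \<rho>\<nu> \<rho>\<mu> T \<eta> \<eta>' h \<longrightarrow>
           (LINT t|lebesgue_on {0<..<T}. LINT x|weighted \<Omega> \<rho>\<nu>. u t x * \<eta>' t x) =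
           - (LINT x|weighted \<Omega> \<rho>\<nu>. u0 x * \<eta> 0 x) +
           (LINT t|lebesgue_on {0<..<T}. LINT x|weighted \<Omega> \<rho>\<mu>. g t x \<bullet> h t x)))"

end

theory Submission
  imports Defs
begin

text \<open>
  Let \<open>u\<close> and \<open>v\<close> be two solutions, \<open>w = u\<^sup>m - v\<^sup>m\<close>, and let \<open>g\<close> be the gradient of \<open>w\<close>. The idea, due to
  Oleinik, is to test the difference of the two weak formulations with \<open>\<eta>(t) = \<integral>\<^sub>t\<^sup>T w(s) ds\<close>, for which
  \<open>\<eta>\<^sub>t = -w\<close>, \<open>\<nabla>\<eta>(t) = \<integral>\<^sub>t\<^sup>T g(s) ds\<close> and \<open>\<eta>(T) = 0\<close>. The initial data cancel, and
  \<open>\<integral>\<integral> (u - v) w d\<nu> dt = - \<integral>\<integral> g(t) \<bullet> (\<integral>\<^sub>t\<^sup>T g(s) ds) d\<mu> dt = - 1/2 \<integral> \<bar>\<integral>\<^sub>0\<^sup>T g(t) dt\<bar>\<^sup>2 d\<mu> \<le> 0\<close>.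
  The signed power is strictly increasing, so \<open>(u - v) w \<ge> 0\<close>, with equality only where \<open>u = v\<close>.

  This \<open>\<eta>\<close> need not be admissible: test functions are square integrable with respect to \<open>\<nu>\<close>, while
  \<open>u, v \<in> L\<^sup>m\<^sup>+\<^sup>1\<close> only gives \<open>w \<in> L\<^sup>p\<close> with \<open>p = (m + 1)/m < 2\<close>. So \<open>w\<close> is replaced by \<open>F\<^sub>n(w)\<close> with
  \<open>F\<^sub>n(s) = s / sqrt (1 + s\<^sup>2/n)\<close>. As \<open>F\<^sub>n(s)\<^sup>2 \<le> n \<bar>s\<bar>\<^sup>p\<close>, the function \<open>F\<^sub>n(w)\<close> is square integrable,
  and its tail integral is admissible (\<open>test_function_tail\<close>). Its gradient is the tail integral of
  \<open>F\<^sub>n'(w) g\<close>, hence \<open>\<integral>\<integral> (u - v) F\<^sub>n(w) d\<nu> dt = - \<integral>\<integral> g(t) \<bullet> (\<integral>\<^sub>t\<^sup>T F\<^sub>n'(w) g ds) d\<mu> dt\<close>. Since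
  \<open>0 < F\<^sub>n' \<le> 1\<close> and \<open>F\<^sub>n' \<rightarrow> 1\<close>, the right-hand side tends to the nonpositive expression above
  (\<open>tendsto_integral_inner_tail\<close>, \<open>integral_pair_inner_tail_nonneg\<close>). The left-hand side is nonnegative and
  increases with \<open>n\<close>, so it vanishes for \<open>n = 1\<close>, which is enough for \<open>u = v\<close>.

  The analytic core is the chain rule \<open>\<nabla>F(w) = F'(w) \<nabla>w\<close> for weak gradients (\<open>weak_gradient_compose\<close>),
  where \<open>F\<close> has a bounded continuous derivative. It is proved by mollification: for smooth functions
  it is integration by parts, and mollifications converge in \<open>L\<^sup>1\<close> because translation is continuous
  in \<open>L\<^sup>1\<close>.
\<close>

section \<open>Test functions\<close>

lemma Ck_const: "Ck k (\<lambda>x. c)"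
  by (induction k arbitrary: c) (auto simp: frechet_derivative_const)

lemma Ck_Suc_imp: "Ck (Suc k) f \<Longrightarrow> Ck k f"
proof (induction k arbitrary: f)
  case 0
  then show ?case
    by (auto intro!: differentiable_imp_continuous_on simp: differentiable_on_def differentiable_at_withinI)
qed simp

lemma Ck_add: "Ck k f \<Longrightarrow> Ck k g \<Longrightarrow> Ck k (\<lambda>x. f x + g x)"
proof (induction k arbitrary: f g)
  case 0
  then show ?case by (auto intro!: continuous_intros)
next
  case (Suc k)
  have d: "f differentiable (at x)" "g differentiable (at x)" for x
    using Suc.prems by auto
  have D: "frechet_derivative (\<lambda>x. f x + g x) (at x) =
        (\<lambda>i. frechet_derivative f (at x) i + frechet_derivative g (at x) i)" for x
    by (intro frechet_derivative_at[symmetric] has_derivative_add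
        frechet_derivative_works[THEN iffD1] d)
  with Suc show ?case by simp
qed

lemma Ck_mult: "Ck k f \<Longrightarrow> Ck k g \<Longrightarrow> Ck k (\<lambda>x. f x * g x)"
proof (induction k arbitrary: f g)
  case 0
  then show ?case by (auto intro!: continuous_intros)
next
  case (Suc k)
  have d: "f differentiable (at x)" "g differentiable (at x)" for x
    using Suc.prems by auto
  have D: "frechet_derivative (\<lambda>x. f x * g x) (at x) =
        (\<lambda>i. f x * frechet_derivative g (at x) i + frechet_derivative f (at x) i * g x)" for x
    by (intro frechet_derivative_at[symmetric] has_derivative_mult)
       (rule frechet_derivative_works[THEN iffD1, OF d(1)],
        rule frechet_derivative_works[THEN iffD1, OF d(2)])
  have low: "Ck k f" "Ck k g"
    using Suc.prems by (auto simp del: Ck.simps intro: Ck_Suc_imp[of k f] Ck_Suc_imp[of k g])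
  have "Ck k (\<lambda>x. f x * frechet_derivative g (at x) i + frechet_derivative f (at x) i * g x)"
    if "i \<in> Basis" for i
    using that Suc.prems low by (intro Ck_add Suc.IH) simp_all
  then show ?case by (simp add: D d)
qed

text \<open>
  The maps \<open>y \<mapsto> k (r (x - y))\<close> are the kernels of a convolution, regarded as functions of the
  integration variable; they have to be test functions for the weak gradient to be applied to them.
\<close>

lemma has_derivative_scaled_reflection:
  fixes f :: "'a::euclidean_space \<Rightarrow> real"
  assumes "\<And>x. f differentiable (at x)"
  shows "((\<lambda>y. f (r *\<^sub>R (x - y))) has_derivative
      (\<lambda>i. - r * frechet_derivative f (at (r *\<^sub>R (x - y))) i)) (at y)"
proof -
  have lin: "linear (frechet_derivative f (at z))" for z
    using assms by (rule linear_frechet_derivative)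
  have "((\<lambda>y. r *\<^sub>R (x - y)) has_derivative (\<lambda>i. - r *\<^sub>R i)) (at y)"
    by (auto intro!: derivative_eq_intros simp: algebra_simps)
  from has_derivative_compose[OF this frechet_derivative_works[THEN iffD1, OF assms]]
  show ?thesis
    by (simp add: linear_scale[OF lin] linear_neg[OF lin])
qed

lemma Ck_scaled_reflection: "Ck k f \<Longrightarrow> Ck k (\<lambda>y. f (r *\<^sub>R (x - y)))"
proof (induction k arbitrary: f)
  case 0
  have c: "continuous_on UNIV f" using 0 by simp
  have "continuous_on UNIV (\<lambda>y. f (r *\<^sub>R (x - y)))"
    by (rule continuous_on_compose2[OF c]) (intro continuous_intros, simp)
  then show ?case by simp
next
  case (Suc k)
  have diff: "f differentiable (at z)" for z
    using Suc.prems by simp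
  note d = has_derivative_scaled_reflection[of f r x, OF diff]
  have D: "frechet_derivative (\<lambda>y. f (r *\<^sub>R (x - y))) (at y) =
      (\<lambda>i. - r * frechet_derivative f (at (r *\<^sub>R (x - y))) i)" for y
    by (rule frechet_derivative_at[symmetric, OF d])
  have "(\<lambda>y. f (r *\<^sub>R (x - y))) differentiable (at y)" for y
    by (rule differentiableI[OF d])
  moreover have "Ck k (\<lambda>y. - r * frechet_derivative f (at (r *\<^sub>R (x - y))) i)" if "i \<in> Basis" for i
    using Suc.prems that
    by (intro Ck_mult Ck_const Suc.IH[where f = "\<lambda>z. frechet_derivative f (at z) i"]) simp
  ultimately show ?case by (simp only: Ck.simps D) simp
qed

lemma Cc_infty_props:
  assumes "\<phi> \<in> Cc_infty \<Omega>"
  shows Cc_infty_differentiable: "\<phi> differentiable (at x)"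
    and Cc_infty_continuous: "continuous_on UNIV \<phi>"
    and Cc_infty_continuous_deriv: "i \<in> Basis \<Longrightarrow> continuous_on UNIV (\<lambda>x. frechet_derivative \<phi> (at x) i)"
    and Cc_infty_compact: "compact (closure {x. \<phi> x \<noteq> 0})"
    and Cc_infty_subset: "closure {x. \<phi> x \<noteq> 0} \<subseteq> \<Omega>"
    and Cc_infty_outside: "x \<notin> closure {x. \<phi> x \<noteq> 0} \<Longrightarrow> \<phi> x = 0"
    and Cc_infty_deriv_outside: "x \<notin> closure {x. \<phi> x \<noteq> 0} \<Longrightarrow> frechet_derivative \<phi> (at x) i = 0"
proof -
  have C: "Ck k \<phi>" for k using assms by (auto simp: Cc_infty_def)
  show d: "\<phi> differentiable (at x)" for x using C[of "Suc 0"] by simp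
  show "continuous_on UNIV \<phi>" using C[of 0] by simp
  show "i \<in> Basis \<Longrightarrow> continuous_on UNIV (\<lambda>x. frechet_derivative \<phi> (at x) i)"
    using C[of "Suc 0"] by simp
  show "compact (closure {x. \<phi> x \<noteq> 0})" "closure {x. \<phi> x \<noteq> 0} \<subseteq> \<Omega>"
    using assms by (auto simp: Cc_infty_def)
  show "x \<notin> closure {x. \<phi> x \<noteq> 0} \<Longrightarrow> \<phi> x = 0"
    using closure_subset[of "{x. \<phi> x \<noteq> 0}"] by auto
  show "frechet_derivative \<phi> (at x) i = 0" if x: "x \<notin> closure {x. \<phi> x \<noteq> 0}"
  proof -
    have "((\<lambda>_. 0) has_derivative (\<lambda>_. 0)) (at x)"
      by simp
    then have "(\<phi> has_derivative (\<lambda>_. 0)) (at x)"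
      by (rule has_derivative_transform_within_open[of _ _ _ _ "- closure {x. \<phi> x \<noteq> 0}"])
         (use x closure_subset[of "{x. \<phi> x \<noteq> 0}"] in \<open>auto simp: open_Compl\<close>)
    from frechet_derivative_at[OF this] show ?thesis by metis
  qed
qed

text \<open>
  Partial derivatives are handled as derivatives along lines, which reduces the differentiation of
  convolutions and of compositions to calculus in one real variable.
\<close>

lemma Cc_infty_directional:
  assumes "\<phi> \<in> Cc_infty \<Omega>"
  shows "((\<lambda>s. \<phi> (x + s *\<^sub>R i)) has_real_derivative frechet_derivative \<phi> (at (x + s *\<^sub>R i)) i) (at s)"
proof -
  have lin: "linear (frechet_derivative \<phi> (at z))" for z
    using Cc_infty_differentiable[OF assms] by (rule linear_frechet_derivative)
  have eq: "(\<lambda>s. s * d) = (*) d" for d :: real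
    by (simp add: fun_eq_iff mult.commute)
  have "((\<lambda>s. x + s *\<^sub>R i) has_derivative (\<lambda>s. s *\<^sub>R i)) (at s)"
    by (auto intro!: derivative_eq_intros)
  from has_derivative_compose[OF this
      frechet_derivative_works[THEN iffD1, OF Cc_infty_differentiable[OF assms]]]
  show ?thesis
    by (simp add: has_field_derivative_def linear_scale[OF lin] eq)
qed

lemma compact_support_bounded:
  fixes f :: "'a::euclidean_space \<Rightarrow> real"
  assumes "continuous_on UNIV f" "compact K" "\<And>x. x \<notin> K \<Longrightarrow> f x = 0"
  obtains B where "B > 0" "\<And>x. \<bar>f x\<bar> \<le> B"
proof -
  have "bounded (f ` K)"
    using assms by (intro compact_imp_bounded compact_continuous_image) (auto elim: continuous_on_subset)
  then obtain B where B: "B > 0" "\<And>x. x \<in> K \<Longrightarrow> \<bar>f x\<bar> \<le> B" by (auto simp: bounded_pos)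
  then have "\<bar>f x\<bar> \<le> B" for x using assms(3)[of x] by (cases "x \<in> K") auto
  with B(1) show ?thesis by (rule that)
qed

lemma compact_support_integrable:
  fixes f :: "'a::euclidean_space \<Rightarrow> real"
  assumes "continuous_on UNIV f" "compact K" "\<And>x. x \<notin> K \<Longrightarrow> f x = 0"
  shows "integrable lborel f"
proof -
  have "integrable lborel (\<lambda>x. indicator K x *\<^sub>R f x)"
    using assms by (intro borel_integrable_compact) (auto elim: continuous_on_subset)
  also have "(\<lambda>x. indicator K x *\<^sub>R f x) = f"
    using assms(3) by (auto simp: indicator_def fun_eq_iff)
  finally show ?thesis .
qed

text \<open>
  The square of a nonzero test function has a positive integral, so it can be normalised. This spares
  the construction of an explicit bump function: integration by parts against a test function \<open>\<phi>\<close>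
  is trivial when \<open>\<phi> = 0\<close>, and otherwise \<open>\<phi>\<close> itself provides the mollifier.
\<close>

lemma ex_mollifier:
  fixes \<phi> :: "'a::euclidean_space \<Rightarrow> real"
  assumes \<phi>: "\<phi> \<in> Cc_infty \<Omega>" and "\<phi> x0 \<noteq> 0"
  obtains k :: "'a \<Rightarrow> real" where "k \<in> Cc_infty UNIV" "(LINT z|lborel. k z) = 1"
proof -
  let ?q = "\<lambda>z. \<phi> z * \<phi> z"
  define c where "c = (LINT z|lborel. ?q z)"
  have cont: "continuous_on UNIV ?q"
    using Cc_infty_continuous[OF \<phi>] by (auto intro!: continuous_intros)
  have int: "integrable lborel ?q"
    by (rule compact_support_integrable[OF cont Cc_infty_compact[OF \<phi>]])
       (use Cc_infty_outside[OF \<phi>] in \<open>metis mult_zero_left\<close>)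
  have "c \<noteq> 0"
  proof
    assume "c = 0"
    have op: "open {x. ?q x \<noteq> 0}"
      by (rule open_Collect_neq[OF cont continuous_on_const])
    from \<open>c = 0\<close> have "AE x in lborel. ?q x = 0"
      using integral_nonneg_eq_0_iff_AE[OF int] by (auto simp: c_def)
    then have "AE x in lborel. x \<notin> {x. ?q x \<noteq> 0}" by simp
    then have "{x. ?q x \<noteq> 0} \<in> null_sets lborel"
      by (subst AE_iff_null_sets) (use op in auto)
    then have "{x. ?q x \<noteq> 0} \<in> null_sets lebesgue"
      by (rule null_sets_completionI)
    with op show False
      using \<open>\<phi> x0 \<noteq> 0\<close> open_not_negligible[of "{x. ?q x \<noteq> 0}"]
      by (auto simp: negligible_iff_null_sets)
  qed
  have 1: "{x. ?q x * inverse c \<noteq> 0} = {x. \<phi> x \<noteq> 0}"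
    using \<open>c \<noteq> 0\<close> by auto
  show ?thesis
  proof (rule that)
    show "(\<lambda>z. ?q z * inverse c) \<in> Cc_infty UNIV"
      using \<phi> unfolding Cc_infty_def mem_Collect_eq 1 by (auto intro!: Ck_mult Ck_const)
    show "(LINT z|lborel. ?q z * inverse c) = 1"
      using \<open>c \<noteq> 0\<close> by (simp add: c_def)
  qed
qed

section \<open>Mollification\<close>

lemma integrable_const_indicator_cball:
  "integrable lborel (\<lambda>x::'a::euclidean_space. b * indicator (cball 0 R) x :: real)"
  using emeasure_bounded_finite[OF bounded_cball, of "0::'a" R]
  by (intro integrable_mult_right integrable_real_indicator) simp_all

lemma lborel_shift:
  fixes f :: "'a::euclidean_space \<Rightarrow> real"
  shows integral_lborel_shift: "f \<in> borel_measurable borel \<Longrightarrow> (LINT x|lborel. f (x - h)) = (LINT x|lborel. f x)"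
    and integrable_lborel_shift: "integrable lborel f \<Longrightarrow> integrable lborel (\<lambda>x. f (x - h))"
proof -
  note d = lborel_distr_plus[of "- h"]
  show "(LINT x|lborel. f (x - h)) = (LINT x|lborel. f x)" if [measurable]: "f \<in> borel_measurable borel"
    by (subst (2) d[symmetric], subst integral_distr) (auto simp: algebra_simps)
  show "integrable lborel (\<lambda>x. f (x - h))" if f: "integrable lborel f"
  proof -
    have [measurable]: "f \<in> borel_measurable borel" using borel_measurable_integrable[OF f] by simp
    have "integrable (distr lborel borel ((+) (- h))) f" using f d by simp
    then show ?thesis by (subst (asm) integrable_distr_eq) (auto simp: algebra_simps)
  qed
qed

lemma lborel_affine_substitution:
  fixes F :: "'a::euclidean_space \<Rightarrow> real"
  assumes [measurable]: "F \<in> borel_measurable borel" and "c \<noteq> 0"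
  shows integral_lborel_affine: "(LINT y|lborel. F y) = (LINT z|lborel. \<bar>c\<bar> ^ DIM('a) * F (t + c *\<^sub>R z))"
    and integrable_lborel_affine: "integrable lborel F \<longleftrightarrow> integrable lborel (\<lambda>z. F (t + c *\<^sub>R z))"
proof -
  note a = lborel_affine[OF \<open>c \<noteq> 0\<close>, of t]
  show "(LINT y|lborel. F y) = (LINT z|lborel. \<bar>c\<bar> ^ DIM('a) * F (t + c *\<^sub>R z))"
    by (subst a, subst integral_density, simp_all, subst integral_distr, simp_all)
  show "integrable lborel F \<longleftrightarrow> integrable lborel (\<lambda>z. F (t + c *\<^sub>R z))"
    using \<open>c \<noteq> 0\<close>
    by (subst a, subst integrable_density, simp_all, subst integrable_distr_eq, simp_all)
qed

text \<open>
  Measurability in the sense of almost everywhere limits of continuous functions yields the density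
  of \<open>C\<^sub>c\<close> in \<open>L\<^sup>1\<close>: clip the approximants in height and cut them off in space, so that dominated
  convergence applies.
\<close>

lemma L1_dense_compact_support:
  fixes f :: "'a::euclidean_space \<Rightarrow> real"
  assumes f: "integrable lborel f" and "e > 0"
  obtains c R where "continuous_on UNIV c" "\<And>x. norm x > R \<Longrightarrow> c x = 0"
    "(LINT x|lborel. \<bar>f x - c x\<bar>) < e"
proof -
  have [measurable]: "f \<in> borel_measurable borel" using borel_measurable_integrable[OF f] by simp
  define cut where "cut n x = max 0 (min 1 (real n + 1 - norm x))" for n and x :: 'a
  define clip where "clip n t = max (- real n) (min (real n) t)" for n t
  have cut01: "0 \<le> cut n x" "cut n x \<le> 1" for n x by (auto simp: cut_def)
  have clipb: "\<bar>clip n t\<bar> \<le> real n" for n t by (auto simp: clip_def)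
  have clip_cont: "continuous_on UNIV (clip n)" for n unfolding clip_def by (intro continuous_intros)
  have cut_cont: "continuous_on UNIV (cut n)" for n unfolding cut_def by (intro continuous_intros)
  have [measurable]: "clip n \<in> borel_measurable borel" "cut n \<in> borel_measurable borel" for n
    using clip_cont cut_cont by (auto intro: borel_measurable_continuous_onI)
  \<comment> \<open>clipping multiplies the value by a factor in \<open>[0, 1]\<close>, and so does the cut-off\<close>
  have ab: "\<bar>f x - clip n (f x) * cut n x\<bar> \<le> \<bar>f x\<bar>" for n x
  proof -
    have "clip n (f x) = f x * min 1 (real n / \<bar>f x\<bar>)" if "f x \<noteq> 0"
      using that by (auto simp: clip_def min_def max_def field_simps abs_if split: if_splits)
    moreover have "clip n 0 = 0" by (simp add: clip_def)
    ultimately obtain q where q: "clip n (f x) = f x * q" "0 \<le> q" "q \<le> 1"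
      by (cases "f x = 0") (auto intro: that[of 0] that[of "min 1 (real n / \<bar>f x\<bar>)"])
    have "0 \<le> q * cut n x" "q * cut n x \<le> 1"
      using q cut01[of n x] by (auto intro: mult_nonneg_nonneg mult_le_one)
    then have "\<bar>f x\<bar> * \<bar>1 - q * cut n x\<bar> \<le> \<bar>f x\<bar> * 1" by (intro mult_left_mono) auto
    then show ?thesis unfolding q(1) by (simp add: abs_mult[symmetric] algebra_simps)
  qed
  have "(\<lambda>n. LINT x|lborel. \<bar>f x - clip n (f x) * cut n x\<bar>) \<longlonglongrightarrow> (LINT x|(lborel::'a measure). 0)"
  proof (rule integral_dominated_convergence[where w = "\<lambda>x. \<bar>f x\<bar>"])
    have "(\<lambda>n. \<bar>f x - clip n (f x) * cut n x\<bar>) \<longlonglongrightarrow> 0" for x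
    proof (rule tendsto_eventually, rule eventually_sequentiallyI)
      fix n assume n: "nat \<lceil>max \<bar>f x\<bar> (norm x)\<rceil> \<le> n"
      then have "\<bar>f x\<bar> \<le> real n" "norm x \<le> real n" by linarith+
      then show "\<bar>f x - clip n (f x) * cut n x\<bar> = 0" by (auto simp: clip_def cut_def)
    qed
    then show "AE x in lborel. (\<lambda>n. \<bar>f x - clip n (f x) * cut n x\<bar>) \<longlonglongrightarrow> 0" by simp
  qed (use f ab in auto)
  then have "eventually (\<lambda>n. (LINT x|lborel. \<bar>f x - clip n (f x) * cut n x\<bar>) < e / 2) sequentially"
    using \<open>e > 0\<close> by (intro order_tendstoD) auto
  then obtain n where n: "(LINT x|lborel. \<bar>f x - clip n (f x) * cut n x\<bar>) < e / 2"
    by (auto simp: eventually_sequentially)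
  have "f \<in> borel_measurable lebesgue"
    by (simp add: measurable_completion)
  then have "f measurable_on UNIV"
    by (subst measurable_on_iff_borel_measurable) auto
  then obtain N g where N: "negligible N" and g: "\<And>k. continuous_on UNIV (g k)"
    and lim: "\<And>x. x \<notin> N \<Longrightarrow> (\<lambda>k. g k x) \<longlonglongrightarrow> f x"
    unfolding measurable_on_def by auto
  have [measurable]: "g k \<in> borel_measurable borel" for k
    using g by (rule borel_measurable_continuous_onI)
  have bd: "\<bar>clip n s * cut n x\<bar> \<le> real n * indicator (cball 0 (real n + 1)) x" for s x
  proof (cases "norm x \<le> real n + 1")
    case True
    then show ?thesis
      using mult_mono[OF clipb[of n s], of "cut n x" 1] cut01[of n x] by (simp add: abs_mult)
  next
    case False
    then show ?thesis by (simp add: cut_def)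
  qed
  have int_ball: "integrable lborel (\<lambda>x. real n * indicator (cball 0 (real n + 1)) x :: real)"
    by (rule integrable_const_indicator_cball)
  have int_c: "integrable lborel (\<lambda>x. clip n (s x) * cut n x)" if [measurable]: "s \<in> borel_measurable borel" for s
    by (rule Bochner_Integration.integrable_bound[OF int_ball]) (use bd in auto)
  have aeN: "AE x in lborel. x \<notin> N"
    using AE_not_in[OF N[unfolded negligible_iff_null_sets]] by (simp add: AE_completion_iff)
  have "(\<lambda>k. LINT x|lborel. \<bar>clip n (f x) * cut n x - clip n (g k x) * cut n x\<bar>)
      \<longlonglongrightarrow> (LINT x|(lborel::'a measure). 0)"
  proof (rule integral_dominated_convergence[where w = "\<lambda>x. 2 * (real n * indicator (cball 0 (real n + 1)) x)"])
    show "AE x in lborel. (\<lambda>k. \<bar>clip n (f x) * cut n x - clip n (g k x) * cut n x\<bar>) \<longlonglongrightarrow> 0"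
      using aeN
    proof eventually_elim
      case (elim x)
      have "(\<lambda>k. clip n (g k x)) \<longlonglongrightarrow> clip n (f x)"
        by (rule continuous_on_tendsto_compose[OF clip_cont lim[OF elim]]) auto
      then have "(\<lambda>k. clip n (f x) * cut n x - clip n (g k x) * cut n x) \<longlonglongrightarrow>
          clip n (f x) * cut n x - clip n (f x) * cut n x" by (intro tendsto_intros)
      then show ?case by (simp add: tendsto_rabs_zero_iff)
    qed
    show "AE x in lborel. norm \<bar>clip n (f x) * cut n x - clip n (g k x) * cut n x\<bar>
        \<le> 2 * (real n * indicator (cball 0 (real n + 1)) x)" for k
    proof (rule AE_I2)
      fix x
      show "norm \<bar>clip n (f x) * cut n x - clip n (g k x) * cut n x\<bar>
        \<le> 2 * (real n * indicator (cball 0 (real n + 1)) x)"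
        using bd[of "f x" x] bd[of "g k x" x]
          abs_triangle_ineq4[of "clip n (f x) * cut n x" "clip n (g k x) * cut n x"]
        unfolding real_norm_def abs_abs by linarith
    qed
  qed (use int_ball in auto)
  then have "eventually (\<lambda>k. (LINT x|lborel. \<bar>clip n (f x) * cut n x - clip n (g k x) * cut n x\<bar>) < e / 2) sequentially"
    using \<open>e > 0\<close> by (intro order_tendstoD) auto
  then obtain k where k: "(LINT x|lborel. \<bar>clip n (f x) * cut n x - clip n (g k x) * cut n x\<bar>) < e / 2"
    by (auto simp: eventually_sequentially)
  have "(LINT x|lborel. \<bar>f x - clip n (g k x) * cut n x\<bar>) \<le>
      (LINT x|lborel. \<bar>f x - clip n (f x) * cut n x\<bar> + \<bar>clip n (f x) * cut n x - clip n (g k x) * cut n x\<bar>)"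
    using f int_c[of f] int_c[of "g k"] by (intro integral_mono) auto
  also have "\<dots> = (LINT x|lborel. \<bar>f x - clip n (f x) * cut n x\<bar>) +
      (LINT x|lborel. \<bar>clip n (f x) * cut n x - clip n (g k x) * cut n x\<bar>)"
    using f int_c[of f] int_c[of "g k"] by (intro Bochner_Integration.integral_add) auto
  also have "\<dots> < e" using n k by simp
  finally have small: "(LINT x|lborel. \<bar>f x - clip n (g k x) * cut n x\<bar>) < e" .
  have clip_g: "continuous_on UNIV (\<lambda>x. clip n (g k x))"
    by (rule continuous_on_compose2[OF clip_cont g]) auto
  show ?thesis
  proof (rule that[of "\<lambda>x. clip n (g k x) * cut n x" "real n + 1"])
    show "continuous_on UNIV (\<lambda>x. clip n (g k x) * cut n x)"
      by (intro continuous_on_mult clip_g cut_cont)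
    show "clip n (g k x) * cut n x = 0" if "norm x > real n + 1" for x
      using that by (simp add: cut_def)
  qed (fact small)
qed

text \<open>
  For a continuous function of compact support this is uniform continuity. It carries over to
  \<open>L\<^sup>1\<close> by density, since translation preserves the \<open>L\<^sup>1\<close> norm.
\<close>

lemma L1_translation_tendsto:
  fixes f :: "'a::euclidean_space \<Rightarrow> real"
  assumes f: "integrable lborel f" and X: "X \<longlonglongrightarrow> 0"
  shows "(\<lambda>n. LINT x|lborel. \<bar>f (x - X n) - f x\<bar>) \<longlonglongrightarrow> 0"
proof (rule LIMSEQ_I)
  fix e :: real assume "e > 0"
  then have "e / 3 > 0" by simp
  from L1_dense_compact_support[OF f this] obtain c R
    where c: "continuous_on UNIV c" and R: "\<And>x. norm x > R \<Longrightarrow> c x = 0"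
      and small: "(LINT x|lborel. \<bar>f x - c x\<bar>) < e / 3" by blast
  have fm[measurable]: "f \<in> borel_measurable borel" using borel_measurable_integrable[OF f] by simp
  have cm[measurable]: "c \<in> borel_measurable borel" using c by (rule borel_measurable_continuous_onI)
  have ci: "integrable lborel c"
    by (rule compact_support_integrable[OF c compact_cball[of 0 R]]) (use R in auto)
  obtain B where B: "B > 0" "\<And>x. \<bar>c x\<bar> \<le> B"
    using compact_support_bounded[OF c compact_cball[of 0 R]] R
    by (metis dist_0_norm linorder_not_less mem_cball)
  from X have "eventually (\<lambda>n. norm (X n) < 1) sequentially"
    using tendsto_norm_zero[OF X] by (intro order_tendstoD) auto
  then obtain N where N: "\<And>n. n \<ge> N \<Longrightarrow> norm (X n) < 1" by (auto simp: eventually_sequentially)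
  have "(\<lambda>n. LINT x|lborel. \<bar>c (x - X (n + N)) - c x\<bar>) \<longlonglongrightarrow> (LINT x|(lborel :: 'a measure). 0)"
  proof (rule integral_dominated_convergence[where w = "\<lambda>x. 2 * B * indicator (cball 0 (R + 1)) x"])
    show "integrable lborel (\<lambda>x::'a. 2 * B * indicator (cball 0 (R + 1)) x :: real)"
      by (rule integrable_const_indicator_cball)
    show "AE x in lborel. norm \<bar>c (x - X (n + N)) - c x\<bar> \<le> 2 * B * indicator (cball 0 (R + 1)) x" for n
    proof (rule AE_I2)
      fix x
      show "norm \<bar>c (x - X (n + N)) - c x\<bar> \<le> 2 * B * indicator (cball 0 (R + 1)) x"
      proof (cases "norm x \<le> R + 1")
        case True
        then show ?thesis using B(2)[of x] B(2)[of "x - X (n + N)"]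
            abs_triangle_ineq4[of "c (x - X (n + N))" "c x"] by simp
      next
        case False
        have "norm x \<le> norm (x - X (n + N)) + norm (X (n + N))"
          by (metis diff_add_cancel norm_triangle_ineq)
        with False N[of "n + N"] have "norm (x - X (n + N)) > R" "norm x > R" by auto
        then show ?thesis using B(1) by (simp add: R)
      qed
    qed
    show "AE x in lborel. (\<lambda>n. \<bar>c (x - X (n + N)) - c x\<bar>) \<longlonglongrightarrow> 0"
    proof (rule AE_I2)
      fix x
      have "(\<lambda>n. x - X (n + N)) \<longlonglongrightarrow> x - 0"
        using X by (intro tendsto_diff tendsto_const LIMSEQ_ignore_initial_segment)
      then have "(\<lambda>n. c (x - X (n + N))) \<longlonglongrightarrow> c x"
        by (intro continuous_on_tendsto_compose[OF c]) auto
      then have "(\<lambda>n. c (x - X (n + N)) - c x) \<longlonglongrightarrow> c x - c x" by (intro tendsto_intros)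
      then show "(\<lambda>n. \<bar>c (x - X (n + N)) - c x\<bar>) \<longlonglongrightarrow> 0" by (simp add: tendsto_rabs_zero_iff)
    qed
  qed auto
  then have "(\<lambda>n. LINT x|lborel. \<bar>c (x - X n) - c x\<bar>) \<longlonglongrightarrow> 0"
    by (simp add: LIMSEQ_offset)
  then have "eventually (\<lambda>n. (LINT x|lborel. \<bar>c (x - X n) - c x\<bar>) < e / 3) sequentially"
    using \<open>e > 0\<close> by (intro order_tendstoD) auto
  then obtain M where M: "\<And>n. n \<ge> M \<Longrightarrow> (LINT x|lborel. \<bar>c (x - X n) - c x\<bar>) < e / 3"
    by (auto simp: eventually_sequentially)
  show "\<exists>no. \<forall>n\<ge>no. norm ((LINT x|lborel. \<bar>f (x - X n) - f x\<bar>) - 0) < e"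
  proof (intro exI allI impI)
    fix n assume "n \<ge> M"
    have i1: "integrable lborel (\<lambda>x. \<bar>f (x - X n) - c (x - X n)\<bar>)"
      and i2: "integrable lborel (\<lambda>x. \<bar>c (x - X n) - c x\<bar>)"
      and i3: "integrable lborel (\<lambda>x. \<bar>f x - c x\<bar>)"
      and i4: "integrable lborel (\<lambda>x. \<bar>f (x - X n) - f x\<bar>)"
      using f ci integrable_lborel_shift[OF f] integrable_lborel_shift[OF ci] by auto
    have "(LINT x|lborel. \<bar>f (x - X n) - f x\<bar>) \<le>
       (LINT x|lborel. \<bar>f (x - X n) - c (x - X n)\<bar> + \<bar>c (x - X n) - c x\<bar> + \<bar>f x - c x\<bar>)"
      using i1 i2 i3 i4 by (intro integral_mono) auto
    also have "\<dots> = (LINT x|lborel. \<bar>f (x - X n) - c (x - X n)\<bar>) + (LINT x|lborel. \<bar>c (x - X n) - c x\<bar>) +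
       (LINT x|lborel. \<bar>f x - c x\<bar>)"
      using i1 i2 i3 by simp
    also have "(LINT x|lborel. \<bar>f (x - X n) - c (x - X n)\<bar>) = (LINT x|lborel. \<bar>f x - c x\<bar>)"
      by (rule integral_lborel_shift[of "\<lambda>x. \<bar>f x - c x\<bar>"]) simp
    finally have "(LINT x|lborel. \<bar>f (x - X n) - f x\<bar>) < e"
      using small M[OF \<open>n \<ge> M\<close>] by linarith
    moreover have "(LINT x|lborel. \<bar>f (x - X n) - f x\<bar>) \<ge> 0" by simp
    ultimately show "norm ((LINT x|lborel. \<bar>f (x - X n) - f x\<bar>) - 0) < e" by simp
  qed
qed

text \<open>
  This is the convolution of \<open>f\<close> with the kernel \<open>r\<^sup>N k(r \<cdot>)\<close>, which is supported at scale \<open>1/r\<close>.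
\<close>

definition mollify :: "('a::euclidean_space \<Rightarrow> real) \<Rightarrow> real \<Rightarrow> ('a \<Rightarrow> real) \<Rightarrow> 'a \<Rightarrow> real" where
  "mollify k r f x = (LINT y|lborel. f y * (r ^ DIM('a) * k (r *\<^sub>R (x - y))))"

lemma mollify_alt:
  fixes f :: "'a::euclidean_space \<Rightarrow> real"
  assumes [measurable]: "f \<in> borel_measurable borel" "k \<in> borel_measurable borel" and "r > 0"
  shows "mollify k r f x = (LINT z|lborel. f (x - (1 / r) *\<^sub>R z) * k z)"
proof -
  have "mollify k r f x = (LINT z|lborel. \<bar>- (1 / r)\<bar> ^ DIM('a) *
      (f (x + (- (1 / r)) *\<^sub>R z) * (r ^ DIM('a) * k (r *\<^sub>R (x - (x + (- (1 / r)) *\<^sub>R z))))))"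
    unfolding mollify_def using \<open>r > 0\<close>
    by (subst integral_lborel_affine[where c = "- (1 / r)" and t = x]) simp_all
  also have "\<dots> = (LINT z|lborel. f (x - (1 / r) *\<^sub>R z) * k z)"
    using \<open>r > 0\<close> by (intro Bochner_Integration.integral_cong) (auto simp: field_simps)
  finally show ?thesis .
qed

text \<open>
  The \<open>L\<^sup>1\<close> distance between \<open>f\<close> and its mollification is at most the average, weighted with the
  kernel, of the \<open>L\<^sup>1\<close> distances between \<open>f\<close> and its small translates.
\<close>

lemma mollify_tendsto_L1:
  fixes f :: "'a::euclidean_space \<Rightarrow> real"
  assumes f: "integrable lborel f"
    and k: "continuous_on UNIV k" "compact K" "\<And>x. x \<notin> K \<Longrightarrow> k x = 0" "(LINT z|lborel. k z) = 1"
  shows integrable_mollify: "r > 0 \<Longrightarrow> integrable lborel (mollify k r f)"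
    and "(\<lambda>n. LINT x|lborel. \<bar>mollify k (real (Suc n)) f x - f x\<bar>) \<longlonglongrightarrow> 0"
proof -
  have fm[measurable]: "f \<in> borel_measurable borel" using borel_measurable_integrable[OF f] by simp
  have km[measurable]: "k \<in> borel_measurable borel" using k(1) by (rule borel_measurable_continuous_onI)
  have ki: "integrable lborel k" by (rule compact_support_integrable[OF k(1-3)])
  obtain B where B: "B > 0" "\<And>x. \<bar>k x\<bar> \<le> B" using compact_support_bounded[OF k(1-3)] by blast
  define \<omega> where "\<omega> h = (LINT x|lborel. \<bar>f (x - h) - f x\<bar>)" for h
  have \<omega>_bound: "0 \<le> \<omega> h" "\<omega> h \<le> 2 * (LINT x|lborel. \<bar>f x\<bar>)" for h
  proof -
    show "0 \<le> \<omega> h" by (simp add: \<omega>_def)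
    have "\<omega> h \<le> (LINT x|lborel. \<bar>f (x - h)\<bar> + \<bar>f x\<bar>)"
      unfolding \<omega>_def using f integrable_lborel_shift[OF f, of h] by (intro integral_mono) auto
    also have "\<dots> = (LINT x|lborel. \<bar>f (x - h)\<bar>) + (LINT x|lborel. \<bar>f x\<bar>)"
      using f integrable_lborel_shift[OF f, of h] by simp
    also have "(LINT x|lborel. \<bar>f (x - h)\<bar>) = (LINT x|lborel. \<bar>f x\<bar>)"
      by (rule integral_lborel_shift[of "\<lambda>x. \<bar>f x\<bar>"]) simp
    finally show "\<omega> h \<le> 2 * (LINT x|lborel. \<bar>f x\<bar>)" by simp
  qed
  have \<omega>m[measurable]: "\<omega> \<in> borel_measurable borel"
    unfolding \<omega>_def by measurable
  have core: "integrable lborel (mollify k r f) \<and>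
      (LINT x|lborel. \<bar>mollify k r f x - f x\<bar>) \<le> (LINT z|lborel. \<omega> ((1 / r) *\<^sub>R z) * \<bar>k z\<bar>)"
    if r: "r > 0" for r
  proof -
    let ?Q = "\<lambda>z x. (f (x - (1 / r) *\<^sub>R z) - f x) * k z"
    have Q1: "integrable lborel (\<lambda>x. ?Q z x)" for z
      using f integrable_lborel_shift[OF f] by auto
    have QQ: "(LINT x|lborel. \<bar>?Q z x\<bar>) = \<omega> ((1 / r) *\<^sub>R z) * \<bar>k z\<bar>" for z
      by (simp add: \<omega>_def abs_mult)
    have Qint: "integrable lborel (\<lambda>z. \<omega> ((1 / r) *\<^sub>R z) * \<bar>k z\<bar>)"
    proof (rule Bochner_Integration.integrable_bound[where f = "\<lambda>z. 2 * (LINT x|lborel. \<bar>f x\<bar>) * \<bar>k z\<bar>"])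
      show "AE z in lborel. norm (\<omega> ((1 / r) *\<^sub>R z) * \<bar>k z\<bar>) \<le> norm (2 * (LINT x|lborel. \<bar>f x\<bar>) * \<bar>k z\<bar>)"
        using \<omega>_bound by (auto simp: abs_mult intro!: mult_right_mono)
    qed (use ki in auto)
    have Q: "integrable (lborel \<Otimes>\<^sub>M lborel) (\<lambda>(z, x). ?Q z x)"
    proof (rule lborel_pair.Fubini_integrable)
      show "integrable lborel (\<lambda>z. LINT x|lborel. norm (case (z, x) of (z, x) \<Rightarrow> ?Q z x))"
        using Qint by (simp add: QQ del: abs_mult)
      show "AE z in lborel. integrable lborel (\<lambda>x. case (z, x) of (z, x) \<Rightarrow> ?Q z x)"
        using Q1 by simp
    qed simp
    have aux: "integrable lborel (\<lambda>z. f (x - (1 / r) *\<^sub>R z) * k z)" for x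
    proof (rule Bochner_Integration.integrable_bound[where f = "\<lambda>z. B * f (x - (1 / r) *\<^sub>R z)"])
      have "integrable lborel (\<lambda>z. f (x + (- (1 / r)) *\<^sub>R z))"
        using r f by (subst integrable_lborel_affine[symmetric]) auto
      then show "integrable lborel (\<lambda>z. B * f (x - (1 / r) *\<^sub>R z))" by simp
      show "AE z in lborel. norm (f (x - (1 / r) *\<^sub>R z) * k z) \<le> norm (B * f (x - (1 / r) *\<^sub>R z))"
        using B by (auto simp: abs_mult mult.commute[of B] intro!: mult_left_mono)
    qed simp
    have diff: "mollify k r f x - f x = (LINT z|lborel. ?Q z x)" for x
    proof -
      have "(LINT z|lborel. ?Q z x) = (LINT z|lborel. f (x - (1 / r) *\<^sub>R z) * k z) - (LINT z|lborel. f x * k z)"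
        unfolding left_diff_distrib using aux ki by (intro Bochner_Integration.integral_diff) auto
      then show ?thesis using k(4) by (simp add: mollify_alt[OF fm km r])
    qed
    have i: "integrable lborel (\<lambda>x. LINT z|lborel. ?Q z x)"
      by (rule lborel_pair.integrable_snd[OF Q])
    have "integrable lborel (\<lambda>x. (mollify k r f x - f x) + f x)"
      unfolding diff using i f by (rule Bochner_Integration.integrable_add)
    then have "integrable lborel (mollify k r f)" by simp
    moreover have "(LINT x|lborel. \<bar>mollify k r f x - f x\<bar>) \<le> (LINT x|lborel. LINT z|lborel. \<bar>?Q z x\<bar>)"
    proof (rule integral_mono)
      have Q': "integrable (lborel \<Otimes>\<^sub>M lborel) (\<lambda>(z, x). \<bar>?Q z x\<bar>)"
        using integrable_abs[OF Q] by (simp add: case_prod_unfold)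
      show "integrable lborel (\<lambda>x. LINT z|lborel. \<bar>?Q z x\<bar>)"
        by (rule lborel_pair.integrable_snd[OF Q'])
      show "integrable lborel (\<lambda>x. \<bar>mollify k r f x - f x\<bar>)" unfolding diff using i by simp
      show "\<bar>mollify k r f x - f x\<bar> \<le> (LINT z|lborel. \<bar>?Q z x\<bar>)" for x
        unfolding diff using integral_norm_bound[of lborel "\<lambda>z. ?Q z x"] by simp
    qed
    moreover have "(LINT x|lborel. LINT z|lborel. \<bar>?Q z x\<bar>) = (LINT z|lborel. LINT x|lborel. \<bar>?Q z x\<bar>)"
      using integrable_abs[OF Q]
      by (intro lborel_pair.Fubini_integral) (simp add: case_prod_unfold)
    ultimately show ?thesis by (simp add: QQ del: abs_mult)
  qed
  show "integrable lborel (mollify k r f)" if "r > 0" using core[OF that] by simp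
  have "(\<lambda>n. LINT z|lborel. \<omega> ((1 / real (Suc n)) *\<^sub>R z) * \<bar>k z\<bar>) \<longlonglongrightarrow> (LINT z|(lborel::'a measure). 0)"
  proof (rule integral_dominated_convergence[where w = "\<lambda>z. 2 * (LINT x|lborel. \<bar>f x\<bar>) * \<bar>k z\<bar>"])
    show "AE z in lborel. norm (\<omega> ((1 / real (Suc n)) *\<^sub>R z) * \<bar>k z\<bar>) \<le> 2 * (LINT x|lborel. \<bar>f x\<bar>) * \<bar>k z\<bar>" for n
      using \<omega>_bound by (auto simp: abs_mult intro!: mult_right_mono)
    show "AE z in lborel. (\<lambda>n. \<omega> ((1 / real (Suc n)) *\<^sub>R z) * \<bar>k z\<bar>) \<longlonglongrightarrow> 0"
    proof (rule AE_I2)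
      fix z :: 'a
      have "(\<lambda>n. (1 / real (Suc n)) *\<^sub>R z) \<longlonglongrightarrow> 0 *\<^sub>R z"
        by (intro tendsto_intros LIMSEQ_inverse_real_of_nat[unfolded inverse_eq_divide])
      then have "(\<lambda>n. \<omega> ((1 / real (Suc n)) *\<^sub>R z)) \<longlonglongrightarrow> 0"
        unfolding \<omega>_def by (intro L1_translation_tendsto[OF f]) simp
      then show "(\<lambda>n. \<omega> ((1 / real (Suc n)) *\<^sub>R z) * \<bar>k z\<bar>) \<longlonglongrightarrow> 0"
        by (rule tendsto_mult_left_zero)
    qed
  qed (use ki in auto)
  then have lim: "(\<lambda>n. LINT z|lborel. \<omega> ((1 / real (Suc n)) *\<^sub>R z) * \<bar>k z\<bar>) \<longlonglongrightarrow> 0" by simp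
  show "(\<lambda>n. LINT x|lborel. \<bar>mollify k (real (Suc n)) f x - f x\<bar>) \<longlonglongrightarrow> 0"
    by (rule tendsto_sandwich[OF _ _ tendsto_const lim]) (use core in \<open>auto simp del: of_nat_Suc\<close>)
qed

text \<open>
  Difference quotients are values of the derivative by the mean value theorem, so a bound on the
  derivative near \<open>0\<close> dominates them.
\<close>

lemma has_real_derivative_LINT:
  fixes \<phi> :: "real \<Rightarrow> 'b \<Rightarrow> real"
  assumes int: "\<And>s. integrable M (\<phi> s)"
    and d: "\<And>s y. ((\<lambda>s. \<phi> s y) has_real_derivative \<phi>' s y) (at s)"
    and bound: "\<And>s y. \<bar>s\<bar> \<le> 1 \<Longrightarrow> \<bar>\<phi>' s y\<bar> \<le> H y" and H: "integrable M H"
  shows "((\<lambda>s. LINT y|M. \<phi> s y) has_real_derivative (LINT y|M. \<phi>' 0 y)) (at 0)"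
  unfolding DERIV_def tendsto_at_iff_sequentially
proof (intro allI impI)
  fix X :: "nat \<Rightarrow> real" assume X0: "\<forall>i. X i \<in> UNIV - {0}" and X: "X \<longlonglongrightarrow> 0"
  have "eventually (\<lambda>n. \<bar>X n\<bar> < 1) sequentially"
    using tendsto_rabs_zero[OF X] by (intro order_tendstoD) auto
  then obtain N where N: "\<And>n. n \<ge> N \<Longrightarrow> \<bar>X n\<bar> < 1" by (auto simp: eventually_sequentially)
  let ?q = "\<lambda>n y. (\<phi> (X (n + N)) y - \<phi> 0 y) / X (n + N)"
  have lim: "(\<lambda>n. ?q n y) \<longlonglongrightarrow> \<phi>' 0 y" for y
  proof -
    have "((\<lambda>h. (\<phi> (0 + h) y - \<phi> 0 y) / h) \<longlongrightarrow> \<phi>' 0 y) (at 0)"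
      using d[of y 0] by (simp add: DERIV_def)
    then have "((\<lambda>h. (\<phi> (0 + h) y - \<phi> 0 y) / h) \<circ> (\<lambda>n. X (n + N))) \<longlonglongrightarrow> \<phi>' 0 y"
      unfolding tendsto_at_iff_sequentially
      by (elim allE[of _ "\<lambda>n. X (n + N)"] impE)
         (use X0 LIMSEQ_ignore_initial_segment[OF X, of N] in auto)
    then show ?thesis by (simp add: o_def)
  qed
  have [measurable]: "\<phi> s \<in> borel_measurable M" for s using int by (rule borel_measurable_integrable)
  have "(\<lambda>n. LINT y|M. ?q n y) \<longlonglongrightarrow> (LINT y|M. \<phi>' 0 y)"
  proof (rule integral_dominated_convergence[OF _ _ H])
    show "\<phi>' 0 \<in> borel_measurable M"
      by (rule borel_measurable_LIMSEQ_real[OF lim]) simp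
    show "AE y in M. norm (?q n y) \<le> H y" for n
    proof (rule AE_I2)
      fix y
      have nz: "X (n + N) \<noteq> 0" using X0 by auto
      have "\<exists>z. \<bar>z\<bar> \<le> 1 \<and> \<phi> (X (n + N)) y - \<phi> 0 y = X (n + N) * \<phi>' z y"
      proof (cases "X (n + N) > 0")
        case True
        from MVT2[OF this, of "\<lambda>s. \<phi> s y" "\<lambda>s. \<phi>' s y"] d obtain z
          where "0 < z" "z < X (n + N)" "\<phi> (X (n + N)) y - \<phi> 0 y = (X (n + N) - 0) * \<phi>' z y" by blast
        with N[of "n + N"] show ?thesis by (intro exI[of _ z]) auto
      next
        case False
        with nz have "X (n + N) < 0" by simp
        from MVT2[OF this, of "\<lambda>s. \<phi> s y" "\<lambda>s. \<phi>' s y"] d obtain z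
          where "X (n + N) < z" "z < 0" "\<phi> 0 y - \<phi> (X (n + N)) y = (0 - X (n + N)) * \<phi>' z y" by blast
        with N[of "n + N"] show ?thesis by (intro exI[of _ z]) auto
      qed
      with bound nz show "norm (?q n y) \<le> H y" by (auto simp: abs_mult)
    qed
  qed (use lim in auto)
  then have "(\<lambda>n. ((LINT y|M. \<phi> (X (n + N)) y) - (LINT y|M. \<phi> 0 y)) / X (n + N)) \<longlonglongrightarrow> (LINT y|M. \<phi>' 0 y)"
    using int by simp
  from LIMSEQ_offset[where f = "\<lambda>n. ((LINT y|M. \<phi> (X n) y) - (LINT y|M. \<phi> 0 y)) / X n", OF this]
  show "((\<lambda>h. ((LINT y|M. \<phi> (0 + h) y) - (LINT y|M. \<phi> 0 y)) / h) \<circ> X) \<longlonglongrightarrow> (LINT y|M. \<phi>' 0 y)"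
    by (simp add: o_def)
qed

text \<open>
  By translation invariance \<open>s \<mapsto> \<integral>G(x + s i)dx\<close> is constant, and
  differentiating it at \<open>0\<close> under the integral sign gives the claim.
\<close>

lemma integral_directional_derivative_zero:
  fixes G D :: "'a::euclidean_space \<Rightarrow> real"
  assumes int: "integrable lborel G" and supp: "\<And>x. norm x > R \<Longrightarrow> D x = 0" and i: "norm i = 1"
    and d: "\<And>x s. ((\<lambda>s. G (x + s *\<^sub>R i)) has_real_derivative D (x + s *\<^sub>R i)) (at s)"
    and bound: "\<And>x. \<bar>D x\<bar> \<le> B"
  shows "(LINT x|lborel. D x) = 0"
proof -
  have "((\<lambda>s. LINT x|lborel. G (x + s *\<^sub>R i)) has_real_derivative (LINT x|lborel. D (x + 0 *\<^sub>R i))) (at 0)"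
  proof (rule has_real_derivative_LINT[OF _ d, where H = "\<lambda>x. B * indicator (cball 0 (R + 1)) x"])
    show "integrable lborel (\<lambda>x. G (x + s *\<^sub>R i))" for s
      using integrable_lborel_shift[OF int, of "- s *\<^sub>R i"] by simp
    show "integrable lborel (\<lambda>x::'a. B * indicator (cball 0 (R + 1)) x :: real)"
      by (rule integrable_const_indicator_cball)
    show "\<bar>D (x + s *\<^sub>R i)\<bar> \<le> B * indicator (cball 0 (R + 1)) x" if s: "\<bar>s\<bar> \<le> 1" for s x
    proof (cases "norm x \<le> R + 1")
      case True
      then show ?thesis using bound by simp
    next
      case False
      have "norm x \<le> norm (x + s *\<^sub>R i) + norm (s *\<^sub>R i)"
        by (metis add_diff_cancel_right' norm_triangle_ineq4)
      with False s have "norm (x + s *\<^sub>R i) > R" by (simp add: i)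
      then show ?thesis using False by (simp add: supp)
    qed
  qed
  moreover have "(LINT x|lborel. G (x + s *\<^sub>R i)) = (LINT x|lborel. G x)" for s
    using integral_lborel_shift[of G "- s *\<^sub>R i"] borel_measurable_integrable[OF int] by simp
  ultimately have "((\<lambda>s. LINT x|lborel. G x) has_real_derivative (LINT x|lborel. D x)) (at 0)" by simp
  moreover have "((\<lambda>s. LINT x|lborel. G x) has_real_derivative 0) (at 0)" by simp
  ultimately show ?thesis by (rule DERIV_unique)
qed

section \<open>The chain rule for weak gradients\<close>

lemma bounded_derivative_Lipschitz:
  fixes F :: "real \<Rightarrow> real"
  assumes "\<And>s. (F has_real_derivative F' s) (at s)" "\<And>s. \<bar>F' s\<bar> \<le> B"
  shows "\<bar>F a - F b\<bar> \<le> B * \<bar>a - b\<bar>"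
  using field_differentiable_bound[of UNIV F F' B a b] assms by auto

text \<open>
  The derivative of a mollification falls on the kernel, which is smooth.
\<close>

lemma mollify_directional_derivative:
  fixes f :: "'a::euclidean_space \<Rightarrow> real"
  assumes f: "integrable lborel f" and k: "k \<in> Cc_infty \<Omega>" and i: "i \<in> Basis" and r: "r > 0"
  defines "V \<equiv> \<lambda>x. LINT y|lborel. f y * (r ^ DIM('a) * (r * frechet_derivative k (at (r *\<^sub>R (x - y))) i))"
  shows "((\<lambda>s. mollify k r f (x + s *\<^sub>R i)) has_real_derivative V (x + s *\<^sub>R i)) (at s)"
    and "\<exists>C. \<forall>x. \<bar>mollify k r f x\<bar> \<le> C" and "\<exists>C. \<forall>x. \<bar>V x\<bar> \<le> C"
proof -
  let ?\<delta> = "\<lambda>z. frechet_derivative k (at z) i"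
  have fm[measurable]: "f \<in> borel_measurable borel" using borel_measurable_integrable[OF f] by simp
  have km[measurable]: "k \<in> borel_measurable borel" "?\<delta> \<in> borel_measurable borel"
    using Cc_infty_continuous[OF k] Cc_infty_continuous_deriv[OF k i]
    by (auto intro: borel_measurable_continuous_onI)
  obtain B where B: "B > 0" "\<And>x. \<bar>k x\<bar> \<le> B"
    using compact_support_bounded[OF Cc_infty_continuous[OF k] Cc_infty_compact[OF k] Cc_infty_outside[OF k]]
    by blast
  obtain B' where B': "B' > 0" "\<And>x. \<bar>?\<delta> x\<bar> \<le> B'"
    using compact_support_bounded[OF Cc_infty_continuous_deriv[OF k i] Cc_infty_compact[OF k]
        Cc_infty_deriv_outside[OF k]]
    by blast
  have b1: "\<bar>f y * (r ^ DIM('a) * k z)\<bar> \<le> r ^ DIM('a) * B * \<bar>f y\<bar>" for y z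
    using B(2)[of z] r mult_left_mono[OF B(2)[of z], of "r ^ DIM('a) * \<bar>f y\<bar>"]
    by (simp add: abs_mult ac_simps)
  have b2: "\<bar>f y * (r ^ DIM('a) * (r * ?\<delta> z))\<bar> \<le> r ^ DIM('a) * r * B' * \<bar>f y\<bar>" for y z
    using B'(2)[of z] r mult_left_mono[OF B'(2)[of z], of "r ^ DIM('a) * r * \<bar>f y\<bar>"]
    by (simp add: abs_mult ac_simps)
  have int1: "integrable lborel (\<lambda>y. f y * (r ^ DIM('a) * k (r *\<^sub>R (x - y))))" for x
    by (rule Bochner_Integration.integrable_bound[where f = "\<lambda>y. r ^ DIM('a) * B * \<bar>f y\<bar>"])
       (use f b1 in \<open>auto intro!: AE_I2 order_trans[OF b1]\<close>)
  have int2: "integrable lborel (\<lambda>y. f y * (r ^ DIM('a) * (r * ?\<delta> (r *\<^sub>R (x - y)))))" for x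
    by (rule Bochner_Integration.integrable_bound[where f = "\<lambda>y. r ^ DIM('a) * r * B' * \<bar>f y\<bar>"])
       (use f b2 in \<open>auto intro!: AE_I2 order_trans[OF b2]\<close>)
  have d0: "((\<lambda>s. mollify k r f (x + s *\<^sub>R i)) has_real_derivative V x) (at 0)" for x
  proof -
    have "((\<lambda>s. LINT y|lborel. f y * (r ^ DIM('a) * k (r *\<^sub>R (x + s *\<^sub>R i - y)))) has_real_derivative
      (LINT y|lborel. f y * (r ^ DIM('a) * (r * ?\<delta> (r *\<^sub>R (x + 0 *\<^sub>R i - y)))))) (at 0)"
    proof (rule has_real_derivative_LINT[OF int1 _ b2])
      fix s y
      have "((\<lambda>s. k (r *\<^sub>R (x - y) + s *\<^sub>R i)) has_real_derivative
          ?\<delta> (r *\<^sub>R (x - y) + (r * s) *\<^sub>R i)) (at (r * s))"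
        by (rule Cc_infty_directional[OF k])
      moreover have "((\<lambda>s. r * s) has_real_derivative r) (at s)"
        by (auto intro!: derivative_eq_intros)
      ultimately have "((\<lambda>s. k (r *\<^sub>R (x - y) + (r * s) *\<^sub>R i)) has_real_derivative
          ?\<delta> (r *\<^sub>R (x - y) + (r * s) *\<^sub>R i) * r) (at s)"
        by (rule DERIV_chain2)
      moreover have "r *\<^sub>R (x - y) + (r * s) *\<^sub>R i = r *\<^sub>R (x + s *\<^sub>R i - y)" for s
        by (simp add: algebra_simps)
      ultimately have "((\<lambda>s. k (r *\<^sub>R (x + s *\<^sub>R i - y))) has_real_derivative
          ?\<delta> (r *\<^sub>R (x + s *\<^sub>R i - y)) * r) (at s)" by simp
      from DERIV_cmult[OF this, of "f y * r ^ DIM('a)"]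
      show "((\<lambda>s. f y * (r ^ DIM('a) * k (r *\<^sub>R (x + s *\<^sub>R i - y)))) has_real_derivative
          f y * (r ^ DIM('a) * (r * ?\<delta> (r *\<^sub>R (x + s *\<^sub>R i - y))))) (at s)"
        by (simp add: ac_simps)
    qed (use f in auto)
    then show ?thesis by (simp add: mollify_def V_def)
  qed
  show "((\<lambda>s. mollify k r f (x + s *\<^sub>R i)) has_real_derivative V (x + s *\<^sub>R i)) (at s)"
  proof -
    have "((\<lambda>h. mollify k r f (x + (h + s) *\<^sub>R i)) has_real_derivative V (x + s *\<^sub>R i)) (at 0)"
      using d0[of "x + s *\<^sub>R i"] by (simp add: algebra_simps)
    then show ?thesis
      using DERIV_shift[of "\<lambda>s. mollify k r f (x + s *\<^sub>R i)" "V (x + s *\<^sub>R i)" 0 s] by simp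
  qed
  have "\<bar>mollify k r f x\<bar> \<le> (LINT y|lborel. r ^ DIM('a) * B * \<bar>f y\<bar>)" for x
  proof -
    have "\<bar>mollify k r f x\<bar> \<le> (LINT y|lborel. \<bar>f y * (r ^ DIM('a) * k (r *\<^sub>R (x - y)))\<bar>)"
      unfolding mollify_def by (rule integral_abs_bound)
    also have "\<dots> \<le> (LINT y|lborel. r ^ DIM('a) * B * \<bar>f y\<bar>)"
      using int1 f by (intro integral_mono b1 integrable_abs) auto
    finally show ?thesis .
  qed
  then show "\<exists>C. \<forall>x. \<bar>mollify k r f x\<bar> \<le> C" by blast
  have "\<bar>V x\<bar> \<le> (LINT y|lborel. r ^ DIM('a) * r * B' * \<bar>f y\<bar>)" for x
  proof -
    have "\<bar>V x\<bar> \<le> (LINT y|lborel. \<bar>f y * (r ^ DIM('a) * (r * ?\<delta> (r *\<^sub>R (x - y))))\<bar>)"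
      unfolding V_def by (rule integral_abs_bound)
    also have "\<dots> \<le> (LINT y|lborel. r ^ DIM('a) * r * B' * \<bar>f y\<bar>)"
      using int2 f by (intro integral_mono b2 integrable_abs) auto
    finally show ?thesis .
  qed
  then show "\<exists>C. \<forall>x. \<bar>V x\<bar> \<le> C" by blast
qed

text \<open>
  On the support of \<open>\<phi>\<close>, the directional derivative of a fine mollification of \<open>W\<close> is the mollification of \<open>P\<close>; there the
  classical chain rule and integration by parts apply. In the limit the terms with \<open>F'\<close> are
  controlled along a subsequence on which the mollifications of \<open>W\<close> converge almost everywhere.
\<close>

lemma mollified_chain_rule:
  fixes W P :: "'a::euclidean_space \<Rightarrow> real"
  assumes W: "integrable lborel W" and P: "integrable lborel P"
    and k: "k \<in> Cc_infty \<Omega>'" "(LINT z|lborel. k z) = 1"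
    and \<phi>: "\<phi> \<in> Cc_infty \<Omega>" and i: "i \<in> Basis"
    and wd: "\<And>r x. r \<ge> r0 \<Longrightarrow> x \<in> closure {x. \<phi> x \<noteq> 0} \<Longrightarrow>
      (LINT y|lborel. W y * (r ^ DIM('a) * (r * frechet_derivative k (at (r *\<^sub>R (x - y))) i))) = mollify k r P x"
    and F: "\<And>s. (F has_real_derivative F' s) (at s)" "continuous_on UNIV F'" "\<And>s. \<bar>F' s\<bar> \<le> B"
  shows "(LINT x|lborel. F (W x) * frechet_derivative \<phi> (at x) i) = - (LINT x|lborel. F' (W x) * P x * \<phi> x)"
proof -
  let ?\<delta> = "\<lambda>x. frechet_derivative \<phi> (at x) i"
  let ?K = "closure {x. \<phi> x \<noteq> 0}"
  have Wm[measurable]: "W \<in> borel_measurable borel" using borel_measurable_integrable[OF W] by simp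
  have Pm[measurable]: "P \<in> borel_measurable borel" using borel_measurable_integrable[OF P] by simp
  have F_cont: "continuous_on UNIV F"
    using F(1) by (meson DERIV_continuous_on has_field_derivative_at_within)
  have [measurable]: "F \<in> borel_measurable borel" "F' \<in> borel_measurable borel"
    using F_cont F(2) by (auto intro: borel_measurable_continuous_onI)
  have \<phi>c: "continuous_on UNIV \<phi>" and \<phi>'c: "continuous_on UNIV ?\<delta>"
    using Cc_infty_continuous[OF \<phi>] Cc_infty_continuous_deriv[OF \<phi> i] by auto
  have [measurable]: "\<phi> \<in> borel_measurable borel" "?\<delta> \<in> borel_measurable borel"
    using \<phi>c \<phi>'c by (auto intro: borel_measurable_continuous_onI)
  have \<phi>i: "integrable lborel \<phi>" "integrable lborel ?\<delta>"
    by (rule compact_support_integrable[OF \<phi>c Cc_infty_compact[OF \<phi>] Cc_infty_outside[OF \<phi>]]; assumption)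
       (rule compact_support_integrable[OF \<phi>'c Cc_infty_compact[OF \<phi>] Cc_infty_deriv_outside[OF \<phi>]]; assumption)
  obtain C where C: "C > 0" "\<And>x. \<bar>\<phi> x\<bar> \<le> C"
    using compact_support_bounded[OF \<phi>c Cc_infty_compact[OF \<phi>] Cc_infty_outside[OF \<phi>]] by blast
  obtain C' where C': "C' > 0" "\<And>x. \<bar>?\<delta> x\<bar> \<le> C'"
    using compact_support_bounded[OF \<phi>'c Cc_infty_compact[OF \<phi>] Cc_infty_deriv_outside[OF \<phi>]] by blast
  have lip: "\<bar>F a - F b\<bar> \<le> B * \<bar>a - b\<bar>" for a b
    using F(1,3) by (rule bounded_derivative_Lipschitz)
  have B0: "B \<ge> 0" using F(3)[of 0] by (meson abs_ge_zero order_trans)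
  have kc: "continuous_on UNIV k" "compact (closure {x. k x \<noteq> 0})" "\<And>x. x \<notin> closure {x. k x \<noteq> 0} \<Longrightarrow> k x = 0"
    by (rule Cc_infty_continuous[OF k(1)] Cc_infty_compact[OF k(1)] Cc_infty_outside[OF k(1)]; assumption?)+
  let ?r = "\<lambda>n. real (Suc n)"
  define Wn where "Wn n = mollify k (?r n) W" for n
  define Pn where "Pn n = mollify k (?r n) P" for n
  have Wni: "integrable lborel (Wn n)" and Pni: "integrable lborel (Pn n)" for n
    unfolding Wn_def Pn_def by (intro integrable_mollify[OF _ kc k(2)] W P; simp)+
  have [measurable]: "Wn n \<in> borel_measurable borel" "Pn n \<in> borel_measurable borel" for n
    using borel_measurable_integrable[OF Wni] borel_measurable_integrable[OF Pni] by simp_all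
  have limW: "(\<lambda>n. LINT x|lborel. \<bar>Wn n x - W x\<bar>) \<longlonglongrightarrow> 0"
    and limP: "(\<lambda>n. LINT x|lborel. \<bar>Pn n x - P x\<bar>) \<longlonglongrightarrow> 0"
    unfolding Wn_def Pn_def using mollify_tendsto_L1(2)[OF _ kc k(2)] W P by blast+
  have FP: "integrable lborel (\<lambda>x. F' (S x) * Q x * \<phi> x)"
    if [measurable]: "S \<in> borel_measurable borel" and Q: "integrable lborel Q" for S Q
  proof (rule Bochner_Integration.integrable_bound[where f = "\<lambda>x. B * C * Q x"])
    have [measurable]: "Q \<in> borel_measurable borel" using borel_measurable_integrable[OF Q] by simp
    show "(\<lambda>x. F' (S x) * Q x * \<phi> x) \<in> borel_measurable lborel" by measurable
    show "AE x in lborel. norm (F' (S x) * Q x * \<phi> x) \<le> norm (B * C * Q x)"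
    proof (rule AE_I2)
      fix x
      have "\<bar>F' (S x)\<bar> * \<bar>\<phi> x\<bar> \<le> B * C" using F(3) C B0 by (intro mult_mono) auto
      then have "\<bar>F' (S x)\<bar> * \<bar>\<phi> x\<bar> * \<bar>Q x\<bar> \<le> B * C * \<bar>Q x\<bar>" by (rule mult_right_mono) simp
      then show "norm (F' (S x) * Q x * \<phi> x) \<le> norm (B * C * Q x)"
        using B0 C by (simp add: abs_mult ac_simps)
    qed
  qed (use Q in simp)
  have parts: "(LINT x|lborel. F (Wn n x) * ?\<delta> x) = - (LINT x|lborel. F' (Wn n x) * Pn n x * \<phi> x) \<and>
      integrable lborel (\<lambda>x. F (Wn n x) * ?\<delta> x)"
    if n: "?r n \<ge> r0" for n
  proof -
    define V where "V x = (LINT y|lborel. W y * (?r n ^ DIM('a) * (?r n * frechet_derivative k (at (?r n *\<^sub>R (x - y))) i)))" for x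
    have rpos: "?r n > 0" by simp
    note mdd = mollify_directional_derivative[OF W k(1) i rpos, folded Wn_def, folded V_def]
    obtain M1 where M1: "\<And>x. \<bar>Wn n x\<bar> \<le> M1" using mdd(2) by blast
    obtain M2 where M2: "\<And>x. \<bar>V x\<bar> \<le> M2" using mdd(3) by blast
    have Fb: "\<bar>F (Wn n x)\<bar> \<le> \<bar>F 0\<bar> + B * M1" for x
      using lip[of "Wn n x" 0] mult_left_mono[OF M1[of x] B0] unfolding diff_0_right by linarith
    have Fb0: "0 \<le> \<bar>F 0\<bar> + B * M1" using Fb[of 0] by linarith
    have iG: "integrable lborel (\<lambda>x. F (Wn n x) * q x)" if q: "integrable lborel q" for q
    proof (rule Bochner_Integration.integrable_bound[where f = "\<lambda>x. (\<bar>F 0\<bar> + B * M1) * q x"])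
      have [measurable]: "q \<in> borel_measurable borel" using borel_measurable_integrable[OF q] by simp
      show "(\<lambda>x. F (Wn n x) * q x) \<in> borel_measurable lborel" by measurable
      show "AE x in lborel. norm (F (Wn n x) * q x) \<le> norm ((\<bar>F 0\<bar> + B * M1) * q x)"
        using Fb Fb0 by (auto simp: abs_mult intro!: mult_right_mono)
    qed (use q in simp)
    obtain R where R: "\<And>x. x \<in> ?K \<Longrightarrow> norm x \<le> R"
      using compact_imp_bounded[OF Cc_infty_compact[OF \<phi>]] by (auto simp: bounded_iff)
    let ?D = "\<lambda>x. F' (Wn n x) * V x * \<phi> x + ?\<delta> x * F (Wn n x)"
    have "(LINT x|lborel. ?D x) = 0"
    proof (rule integral_directional_derivative_zero[where G = "\<lambda>x. F (Wn n x) * \<phi> x" and i = i and R = R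
          and B = "B * M2 * C + C' * (\<bar>F 0\<bar> + B * M1)"])
      show "integrable lborel (\<lambda>x. F (Wn n x) * \<phi> x)" by (rule iG[OF \<phi>i(1)])
      show "norm i = 1" using i by simp
      show "?D x = 0" if "norm x > R" for x
      proof -
        have "x \<notin> ?K" using R[of x] that by auto
        then show ?thesis
          using Cc_infty_outside[OF \<phi> \<open>x \<notin> ?K\<close>] Cc_infty_deriv_outside[OF \<phi> \<open>x \<notin> ?K\<close>, of i] by simp
      qed
      show "((\<lambda>s. F (Wn n (x + s *\<^sub>R i)) * \<phi> (x + s *\<^sub>R i)) has_real_derivative ?D (x + s *\<^sub>R i)) (at s)" for x s
        by (rule DERIV_mult[OF DERIV_chain2[OF F(1) mdd(1)] Cc_infty_directional[OF \<phi>]])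
      show "\<bar>?D x\<bar> \<le> B * M2 * C + C' * (\<bar>F 0\<bar> + B * M1)" for x
      proof -
        have "M2 \<ge> 0" using M2[of 0] by linarith
        then have "\<bar>F' (Wn n x)\<bar> * \<bar>V x\<bar> * \<bar>\<phi> x\<bar> \<le> B * M2 * C"
          using F(3) M2 C B0 by (intro mult_mono) auto
        moreover have "\<bar>?\<delta> x\<bar> * \<bar>F (Wn n x)\<bar> \<le> C' * (\<bar>F 0\<bar> + B * M1)"
          using Fb C' by (intro mult_mono) auto
        ultimately show ?thesis
          using abs_triangle_ineq[of "F' (Wn n x) * V x * \<phi> x" "?\<delta> x * F (Wn n x)"]
          by (simp add: abs_mult)
      qed
    qed
    moreover have "?D x = F' (Wn n x) * Pn n x * \<phi> x + F (Wn n x) * ?\<delta> x" for x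
    proof (cases "x \<in> ?K")
      case True
      then show ?thesis using wd[OF n True] by (simp add: V_def Pn_def)
    next
      case False
      then have "\<phi> x = 0" by (rule Cc_infty_outside[OF \<phi>])
      then show ?thesis by simp
    qed
    ultimately have "(LINT x|lborel. F' (Wn n x) * Pn n x * \<phi> x + F (Wn n x) * ?\<delta> x) = 0" by simp
    then have "(LINT x|lborel. F' (Wn n x) * Pn n x * \<phi> x) + (LINT x|lborel. F (Wn n x) * ?\<delta> x) = 0"
      using FP[OF _ Pni, of "Wn n" n] iG[OF \<phi>i(2)] by simp
    with iG[OF \<phi>i(2)] show ?thesis by simp
  qed
  obtain N :: nat where "r0 \<le> real N" using real_arch_simple by blast
  then have N: "\<And>n. n \<ge> N \<Longrightarrow> ?r n \<ge> r0" by simp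
  have FW: "integrable lborel (\<lambda>x. F (W x) * ?\<delta> x)"
  proof -
    have "integrable lborel (\<lambda>x. \<bar>F 0\<bar> * \<bar>?\<delta> x\<bar> + B * C' * \<bar>W x\<bar>)" using \<phi>i W by simp
    then show ?thesis
    proof (rule Bochner_Integration.integrable_bound)
      show "AE x in lborel. norm (F (W x) * ?\<delta> x) \<le> norm (\<bar>F 0\<bar> * \<bar>?\<delta> x\<bar> + B * C' * \<bar>W x\<bar>)"
      proof (rule AE_I2)
        fix x
        have "\<bar>F (W x)\<bar> \<le> \<bar>F 0\<bar> + B * \<bar>W x\<bar>" using lip[of "W x" 0] by auto
        then have "\<bar>F (W x)\<bar> * \<bar>?\<delta> x\<bar> \<le> (\<bar>F 0\<bar> + B * \<bar>W x\<bar>) * \<bar>?\<delta> x\<bar>" by (rule mult_right_mono) simp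
        also have "\<dots> \<le> \<bar>F 0\<bar> * \<bar>?\<delta> x\<bar> + B * \<bar>W x\<bar> * C'"
          using mult_left_mono[OF C'(2)[of x], of "B * \<bar>W x\<bar>"] B0 by (simp add: algebra_simps)
        finally show "norm (F (W x) * ?\<delta> x) \<le> norm (\<bar>F 0\<bar> * \<bar>?\<delta> x\<bar> + B * C' * \<bar>W x\<bar>)"
          unfolding real_norm_def by (intro order_trans[OF _ abs_ge_self]) (simp add: abs_mult ac_simps)
      qed
    qed measurable
  qed
  have lim1: "(\<lambda>n. LINT x|lborel. F (Wn n x) * ?\<delta> x) \<longlonglongrightarrow> (LINT x|lborel. F (W x) * ?\<delta> x)"
  proof (rule LIM_zero_cancel, rule Lim_null_comparison)
    show "\<forall>\<^sub>F n in sequentially. norm ((LINT x|lborel. F (Wn n x) * ?\<delta> x) - (LINT x|lborel. F (W x) * ?\<delta> x))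
        \<le> B * C' * (LINT x|lborel. \<bar>Wn n x - W x\<bar>)"
    proof (rule eventually_sequentiallyI[of N])
      fix n assume "N \<le> n"
      have ii: "integrable lborel (\<lambda>x. F (Wn n x) * ?\<delta> x)" using parts[OF N[OF \<open>N \<le> n\<close>]] by simp
      have "(LINT x|lborel. F (Wn n x) * ?\<delta> x) - (LINT x|lborel. F (W x) * ?\<delta> x) =
          (LINT x|lborel. F (Wn n x) * ?\<delta> x - F (W x) * ?\<delta> x)" using ii FW by simp
      also have "\<bar>\<dots>\<bar> \<le> (LINT x|lborel. \<bar>F (Wn n x) * ?\<delta> x - F (W x) * ?\<delta> x\<bar>)" by (rule integral_abs_bound)
      also have "\<dots> \<le> (LINT x|lborel. B * C' * \<bar>Wn n x - W x\<bar>)"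
      proof (rule integral_mono)
        show "\<bar>F (Wn n x) * ?\<delta> x - F (W x) * ?\<delta> x\<bar> \<le> B * C' * \<bar>Wn n x - W x\<bar>" for x
        proof -
          have "\<bar>F (Wn n x) - F (W x)\<bar> * \<bar>?\<delta> x\<bar> \<le> (B * \<bar>Wn n x - W x\<bar>) * C'"
            using lip C' B0 by (intro mult_mono) auto
          then show ?thesis by (simp add: abs_mult[symmetric] algebra_simps)
        qed
      qed (use ii FW Wni W in auto)
      finally show "norm ((LINT x|lborel. F (Wn n x) * ?\<delta> x) - (LINT x|lborel. F (W x) * ?\<delta> x))
        \<le> B * C' * (LINT x|lborel. \<bar>Wn n x - W x\<bar>)" by simp
    qed
    show "(\<lambda>n. B * C' * (LINT x|lborel. \<bar>Wn n x - W x\<bar>)) \<longlonglongrightarrow> 0"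
      by (rule tendsto_mult_right_zero[OF limW])
  qed
  have lim2: "(\<lambda>n. LINT x|lborel. F' (Wn n x) * (Pn n x - P x) * \<phi> x) \<longlonglongrightarrow> 0"
  proof (rule Lim_null_comparison[OF always_eventually], rule allI)
    show "(\<lambda>n. B * C * (LINT x|lborel. \<bar>Pn n x - P x\<bar>)) \<longlonglongrightarrow> 0"
      by (rule tendsto_mult_right_zero[OF limP])
    show "norm (LINT x|lborel. F' (Wn n x) * (Pn n x - P x) * \<phi> x) \<le> B * C * (LINT x|lborel. \<bar>Pn n x - P x\<bar>)" for n
    proof -
      have ii: "integrable lborel (\<lambda>x. F' (Wn n x) * (Pn n x - P x) * \<phi> x)"
        by (rule FP) (use Pni P in auto)
      have "\<bar>LINT x|lborel. F' (Wn n x) * (Pn n x - P x) * \<phi> x\<bar> \<le> (LINT x|lborel. \<bar>F' (Wn n x) * (Pn n x - P x) * \<phi> x\<bar>)"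
        by (rule integral_abs_bound)
      also have "\<dots> \<le> (LINT x|lborel. B * C * \<bar>Pn n x - P x\<bar>)"
      proof (rule integral_mono)
        show "\<bar>F' (Wn n x) * (Pn n x - P x) * \<phi> x\<bar> \<le> B * C * \<bar>Pn n x - P x\<bar>" for x
        proof -
          have "\<bar>F' (Wn n x)\<bar> * \<bar>\<phi> x\<bar> \<le> B * C" using F(3) C B0 by (intro mult_mono) auto
          from mult_right_mono[OF this, of "\<bar>Pn n x - P x\<bar>"] show ?thesis by (simp add: abs_mult ac_simps)
        qed
      qed (use ii Pni P in auto)
      finally show ?thesis by simp
    qed
  qed
  \<comment> \<open>\<open>F'\<close> is merely continuous, so passing to the limit inside it takes almost everywhere convergence\<close>
  have "\<exists>s::nat \<Rightarrow> nat. strict_mono s \<and> (AE x in lborel. (\<lambda>n. Wn (s n) x - W x) \<longlonglongrightarrow> 0)"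
    by (rule tendsto_L1_AE_subseq) (use Wni W limW in auto)
  then obtain s :: "nat \<Rightarrow> nat" where s: "strict_mono s" and aes: "AE x in lborel. (\<lambda>n. Wn (s n) x - W x) \<longlonglongrightarrow> 0"
    by blast
  have lim3: "(\<lambda>n. LINT x|lborel. F' (Wn (s n) x) * P x * \<phi> x) \<longlonglongrightarrow> (LINT x|lborel. F' (W x) * P x * \<phi> x)"
  proof (rule integral_dominated_convergence[where w = "\<lambda>x. B * C * \<bar>P x\<bar>"])
    show "AE x in lborel. (\<lambda>n. F' (Wn (s n) x) * P x * \<phi> x) \<longlonglongrightarrow> F' (W x) * P x * \<phi> x"
      using aes
    proof eventually_elim
      case (elim x)
      then have "(\<lambda>n. Wn (s n) x) \<longlonglongrightarrow> W x" by (rule LIM_zero_cancel)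
      then have "(\<lambda>n. F' (Wn (s n) x)) \<longlonglongrightarrow> F' (W x)"
        by (intro continuous_on_tendsto_compose[OF F(2)]) auto
      then show ?case by (intro tendsto_intros)
    qed
    show "AE x in lborel. norm (F' (Wn (s n) x) * P x * \<phi> x) \<le> B * C * \<bar>P x\<bar>" for n
    proof (rule AE_I2)
      fix x
      have "\<bar>F' (Wn (s n) x)\<bar> * \<bar>\<phi> x\<bar> \<le> B * C" using F(3) C B0 by (intro mult_mono) auto
      from mult_right_mono[OF this, of "\<bar>P x\<bar>"]
      show "norm (F' (Wn (s n) x) * P x * \<phi> x) \<le> B * C * \<bar>P x\<bar>" by (simp add: abs_mult ac_simps)
    qed
  qed (use P in auto)
  have sN: "n \<le> s n" for n using s by (rule seq_suble)
  have "(\<lambda>n. - ((LINT x|lborel. F' (Wn (s n) x) * (Pn (s n) x - P x) * \<phi> x) +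
      (LINT x|lborel. F' (Wn (s n) x) * P x * \<phi> x))) \<longlonglongrightarrow> - (0 + (LINT x|lborel. F' (W x) * P x * \<phi> x))"
    using LIMSEQ_subseq_LIMSEQ[OF lim2 s] by (intro tendsto_intros lim3) (simp add: o_def)
  moreover have "eventually (\<lambda>n. - ((LINT x|lborel. F' (Wn (s n) x) * (Pn (s n) x - P x) * \<phi> x) +
      (LINT x|lborel. F' (Wn (s n) x) * P x * \<phi> x)) = (LINT x|lborel. F (Wn (s n) x) * ?\<delta> x)) sequentially"
  proof (rule eventually_sequentiallyI[of N])
    fix n assume "N \<le> n"
    then have "N \<le> s n" using sN[of n] by simp
    have "(LINT x|lborel. F' (Wn (s n) x) * (Pn (s n) x - P x) * \<phi> x) + (LINT x|lborel. F' (Wn (s n) x) * P x * \<phi> x)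
      = (LINT x|lborel. F' (Wn (s n) x) * (Pn (s n) x - P x) * \<phi> x + F' (Wn (s n) x) * P x * \<phi> x)"
      using FP[of "Wn (s n)" "\<lambda>x. Pn (s n) x - P x"] FP[of "Wn (s n)" P] Pni P by simp
    also have "\<dots> = (LINT x|lborel. F' (Wn (s n) x) * Pn (s n) x * \<phi> x)"
      by (simp add: algebra_simps)
    finally show "- ((LINT x|lborel. F' (Wn (s n) x) * (Pn (s n) x - P x) * \<phi> x) +
      (LINT x|lborel. F' (Wn (s n) x) * P x * \<phi> x)) = (LINT x|lborel. F (Wn (s n) x) * ?\<delta> x)"
      using parts[OF N[OF \<open>N \<le> s n\<close>]] by simp
  qed
  ultimately have "(\<lambda>n. LINT x|lborel. F (Wn (s n) x) * ?\<delta> x) \<longlonglongrightarrow> - (0 + (LINT x|lborel. F' (W x) * P x * \<phi> x))"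
    by (rule Lim_transform_eventually)
  moreover have "(\<lambda>n. LINT x|lborel. F (Wn (s n) x) * ?\<delta> x) \<longlonglongrightarrow> (LINT x|lborel. F (W x) * ?\<delta> x)"
    using LIMSEQ_subseq_LIMSEQ[OF lim1 s] by (simp add: o_def)
  ultimately show ?thesis using LIMSEQ_unique by fastforce
qed

text \<open>
  This transfers integrals against a test function from \<open>\<Omega>\<close> to the whole space with the Borel measure,
  where convolution and translation are available.
\<close>

lemma integral_localize:
  fixes f fb \<psi> :: "'a::euclidean_space \<Rightarrow> real"
  assumes \<Omega>: "\<Omega> \<in> sets lebesgue" "K \<subseteq> \<Omega>" and ae: "AE x in lebesgue. x \<in> K \<longrightarrow> fb x = f x"
    and \<psi>: "\<And>x. x \<notin> K \<Longrightarrow> \<psi> x = 0"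
    and m: "fb \<in> borel_measurable borel" "\<psi> \<in> borel_measurable borel"
  shows "(LINT x|lebesgue_on \<Omega>. f x * \<psi> x) = (LINT x|lborel. fb x * \<psi> x)"
proof -
  have eq: "AE x in lebesgue. fb x * \<psi> x = indicator \<Omega> x *\<^sub>R (f x * \<psi> x)"
    using ae
  proof eventually_elim
    case (elim x)
    then show ?case
      using \<psi>[of x] \<Omega>(2) by (cases "x \<in> K") (auto simp: subset_iff)
  qed
  have mb: "(\<lambda>x. fb x * \<psi> x) \<in> borel_measurable lborel" using m by simp
  then have ml: "(\<lambda>x. fb x * \<psi> x) \<in> borel_measurable lebesgue" by (rule measurable_completion)
  have mf: "(\<lambda>x. indicator \<Omega> x *\<^sub>R (f x * \<psi> x)) \<in> borel_measurable lebesgue"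
    by (rule borel_measurable_AE[OF ml eq])
  have "(LINT x|lebesgue_on \<Omega>. f x * \<psi> x) = (LINT x|lebesgue. indicator \<Omega> x *\<^sub>R (f x * \<psi> x))"
    using \<Omega>(1) by (subst integral_restrict_space) auto
  also have "\<dots> = (LINT x|lebesgue. fb x * \<psi> x)"
    by (rule integral_cong_AE[OF mf ml]) (use eq in \<open>auto elim: eventually_mono\<close>)
  also have "\<dots> = (LINT x|lborel. fb x * \<psi> x)"
    by (rule integral_completion[OF mb])
  finally show ?thesis .
qed

lemma ex_borel_localization:
  fixes w :: "'a::euclidean_space \<Rightarrow> real"
  assumes w: "integrable (lebesgue_on K) w" and K: "K \<in> sets lebesgue"
  obtains W where "integrable lborel W" "AE x in lebesgue. x \<in> K \<longrightarrow> W x = w x"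
proof -
  have i: "integrable lebesgue (\<lambda>x. indicator K x *\<^sub>R w x)"
    using w K by (subst (asm) integrable_restrict_space) auto
  then obtain W where W: "W \<in> borel_measurable lborel" "AE x in lborel. indicator K x *\<^sub>R w x = W x"
    using completion_ex_borel_measurable_real[OF borel_measurable_integrable[OF i]] by blast
  have ae: "AE x in lebesgue. indicator K x *\<^sub>R w x = W x"
    using W(2) by (simp add: AE_completion_iff)
  have "integrable lebesgue W"
    using i by (rule integrable_cong_AE_imp) (use W(1) ae in \<open>auto intro: measurable_completion elim: eventually_mono\<close>)
  then have "integrable lborel W" using integrable_completion[OF W(1)] by simp
  moreover have "AE x in lebesgue. x \<in> K \<longrightarrow> W x = w x"
    using ae by eventually_elim auto
  ultimately show ?thesis by (rule that)
qed

lemma integrable_lebesgue_on_Lipschitz: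
  fixes w :: "'a::euclidean_space \<Rightarrow> real"
  assumes w: "integrable (lebesgue_on K) w" and K: "compact K"
    and F: "\<And>s. (F has_real_derivative F' s) (at s)" "\<And>s. \<bar>F' s\<bar> \<le> B"
  shows "integrable (lebesgue_on K) (\<lambda>x. F (w x))"
proof (rule Bochner_Integration.integrable_bound[where f = "\<lambda>x. \<bar>F 0\<bar> + B * \<bar>w x\<bar>"])
  interpret finite_measure "lebesgue_on K"
    using K by (intro finite_measure_lebesgue_on lmeasurable_compact)
  have wm[measurable]: "w \<in> borel_measurable (lebesgue_on K)" using w by auto
  have "continuous_on UNIV F"
    using F(1) by (meson DERIV_continuous_on has_field_derivative_at_within)
  then have [measurable]: "F \<in> borel_measurable borel" by (rule borel_measurable_continuous_onI)
  show "integrable (lebesgue_on K) (\<lambda>x. \<bar>F 0\<bar> + B * \<bar>w x\<bar>)" using w by auto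
  show "(\<lambda>x. F (w x)) \<in> borel_measurable (lebesgue_on K)" by measurable
  show "AE x in lebesgue_on K. norm (F (w x)) \<le> norm (\<bar>F 0\<bar> + B * \<bar>w x\<bar>)"
  proof (rule AE_I2)
    fix x
    show "norm (F (w x)) \<le> norm (\<bar>F 0\<bar> + B * \<bar>w x\<bar>)"
      using bounded_derivative_Lipschitz[OF F, of "w x" 0] unfolding real_norm_def diff_0_right by linarith
  qed
qed

text \<open>
  Restrict \<open>w\<close> and \<open>g\<close> to a compact neighbourhood \<open>K'\<close> of the support of the test function. As soon
  as the mollification scale is below the width of that neighbourhood, the translated kernels are
  test functions on \<open>\<Omega>\<close>, and the definition of the weak gradient says that differentiating the
  mollification of \<open>w\<close> amounts to mollifying \<open>g\<close>.
\<close>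

lemma weak_gradient_compose:
  fixes w :: "'a::euclidean_space \<Rightarrow> real"
  assumes wg: "weak_gradient \<Omega> w g" and \<Omega>: "open \<Omega>"
    and F: "\<And>s. (F has_real_derivative F' s) (at s)" "continuous_on UNIV F'" "\<And>s. \<bar>F' s\<bar> \<le> B"
  shows "weak_gradient \<Omega> (\<lambda>x. F (w x)) (\<lambda>x. F' (w x) *\<^sub>R g x)"
  unfolding weak_gradient_def
proof (intro conjI ballI)
  have wl: "integrable (lebesgue_on K) w" and gl: "integrable (lebesgue_on K) g"
    if "compact K" "K \<subseteq> \<Omega>" for K
    using wg that by (auto simp: weak_gradient_def loc_integrable_def)
  have [measurable]: "F' \<in> borel_measurable borel" using F(2) by (rule borel_measurable_continuous_onI)
  have F_cont: "continuous_on UNIV F"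
    using F(1) by (meson DERIV_continuous_on has_field_derivative_at_within)
  then have [measurable]: "F \<in> borel_measurable borel" by (rule borel_measurable_continuous_onI)
  show "loc_integrable \<Omega> (\<lambda>x. F (w x))"
    unfolding loc_integrable_def using integrable_lebesgue_on_Lipschitz[OF wl _ F(1,3)] by blast
  show "loc_integrable \<Omega> (\<lambda>x. F' (w x) *\<^sub>R g x)"
    unfolding loc_integrable_def
  proof (intro allI impI)
    fix K assume K: "compact K \<and> K \<subseteq> \<Omega>"
    have [measurable]: "w \<in> borel_measurable (lebesgue_on K)" "g \<in> borel_measurable (lebesgue_on K)"
      using wl gl K by (auto intro: borel_measurable_integrable)
    have "integrable (lebesgue_on K) (\<lambda>x. B *\<^sub>R g x)" using gl K by auto
    then show "integrable (lebesgue_on K) (\<lambda>x. F' (w x) *\<^sub>R g x)"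
    proof (rule Bochner_Integration.integrable_bound)
      show "(\<lambda>x. F' (w x) *\<^sub>R g x) \<in> borel_measurable (lebesgue_on K)" by measurable
      show "AE x in lebesgue_on K. norm (F' (w x) *\<^sub>R g x) \<le> norm (B *\<^sub>R g x)"
        using F(3) by (auto intro!: mult_right_mono order_trans[OF F(3) abs_ge_self])
    qed
  qed
  fix \<phi> i assume \<phi>: "\<phi> \<in> Cc_infty \<Omega>" and i: "i \<in> (Basis :: 'a set)"
  let ?\<delta> = "\<lambda>x. frechet_derivative \<phi> (at x) i"
  let ?K = "closure {x. \<phi> x \<noteq> 0}"
  show "(LINT x|lebesgue_on \<Omega>. F (w x) * ?\<delta> x) = - (LINT x|lebesgue_on \<Omega>. ((F' (w x) *\<^sub>R g x) \<bullet> i) * \<phi> x)"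
  proof (cases "\<exists>x0. \<phi> x0 \<noteq> 0")
    case False
    then have z: "\<phi> x = 0" for x by simp
    have "x \<notin> ?K" for x by (simp add: z)
    then have "?\<delta> x = 0" for x by (rule Cc_infty_deriv_outside[OF \<phi>])
    then show ?thesis by (simp add: z)
  next
    case True
    then obtain x0 where "\<phi> x0 \<noteq> 0" by blast
    from ex_mollifier[OF \<phi> this] obtain k :: "'a \<Rightarrow> real"
      where k: "k \<in> Cc_infty UNIV" "(LINT z|lborel. k z) = 1" by blast
    obtain e where e: "e > 0" "(\<Union>x\<in>?K. ball x e) \<subseteq> \<Omega>"
      using compact_subset_open_imp_ball_epsilon_subset[OF Cc_infty_compact[OF \<phi>] \<Omega> Cc_infty_subset[OF \<phi>]]
      by blast
    define K' where "K' = {x + y |x y. x \<in> ?K \<and> y \<in> cball 0 (e / 2)}"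
    have K'c: "compact K'" unfolding K'_def
      by (rule compact_sums[OF Cc_infty_compact[OF \<phi>] compact_cball])
    have K'I: "y \<in> K'" if "x \<in> ?K" "dist x y \<le> e / 2" for x y
      unfolding K'_def mem_Collect_eq using that
      by (intro exI[of _ x] exI[of _ "y - x"]) (auto simp: dist_norm norm_minus_commute)
    have K'\<Omega>: "K' \<subseteq> \<Omega>"
    proof
      fix z assume "z \<in> K'"
      then obtain x y where "z = x + y" "x \<in> ?K" "norm y \<le> e / 2" by (auto simp: K'_def)
      then have "z \<in> ball x e" using e(1) by (simp add: dist_norm)
      with \<open>x \<in> ?K\<close> show "z \<in> \<Omega>" using e(2) by blast
    qed
    have KK': "?K \<subseteq> K'" using K'I e(1) by auto
    have K'm: "K' \<in> sets lebesgue" using K'c by (simp add: lmeasurable_compact fmeasurableD)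
    have \<Omega>m: "\<Omega> \<in> sets lebesgue" using \<Omega> by simp
    from ex_borel_localization[OF wl[OF K'c K'\<Omega>] K'm] obtain W where W: "integrable lborel W"
      and Wae: "AE x in lebesgue. x \<in> K' \<longrightarrow> W x = w x" by blast
    have "integrable (lebesgue_on K') (\<lambda>x. g x \<bullet> i)" using gl[OF K'c K'\<Omega>] by simp
    from ex_borel_localization[OF this K'm] obtain P where P: "integrable lborel P"
      and Pae: "AE x in lebesgue. x \<in> K' \<longrightarrow> P x = g x \<bullet> i" by blast
    have Wm[measurable]: "W \<in> borel_measurable borel" and Pm[measurable]: "P \<in> borel_measurable borel"
      using borel_measurable_integrable[OF W] borel_measurable_integrable[OF P] by simp_all
    obtain R where R: "R > 0" "\<And>z. k z \<noteq> 0 \<Longrightarrow> norm z \<le> R"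
    proof -
      have "bounded {z. k z \<noteq> 0}"
        using compact_imp_bounded[OF Cc_infty_compact[OF k(1)]] bounded_subset closure_subset by blast
      then show ?thesis using that by (auto simp: bounded_pos)
    qed
    have kdiff: "\<And>x. k differentiable (at x)" by (rule Cc_infty_differentiable[OF k(1)])
    have km[measurable]: "k \<in> borel_measurable borel" "(\<lambda>z. frechet_derivative k (at z) i) \<in> borel_measurable borel"
      using Cc_infty_continuous[OF k(1)] Cc_infty_continuous_deriv[OF k(1) i]
      by (auto intro: borel_measurable_continuous_onI)
    have wd: "(LINT y|lborel. W y * (r ^ DIM('a) * (r * frechet_derivative k (at (r *\<^sub>R (x - y))) i))) = mollify k r P x"
      if r: "2 * R / e \<le> r" and x: "x \<in> ?K" for r x
    proof -
      let ?q = "\<lambda>y. k (r *\<^sub>R (x - y))"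
      have "2 * R / e > 0" using e(1) R(1) by simp
      with r have rpos: "r > 0" by linarith
      have qsupp: "{y. ?q y \<noteq> 0} \<subseteq> cball x (e / 2)"
      proof
        fix y assume "y \<in> {y. ?q y \<noteq> 0}"
        then have "norm (r *\<^sub>R (x - y)) \<le> R" using R(2) by blast
        then have "r * dist x y \<le> R" using rpos by (simp add: dist_norm)
        also have "R \<le> r * (e / 2)" using r e(1) by (simp add: field_simps)
        finally show "y \<in> cball x (e / 2)" using rpos by simp
      qed
      then have qcl: "closure {y. ?q y \<noteq> 0} \<subseteq> cball x (e / 2)" by (rule closure_minimal) simp
      have ballK': "cball x (e / 2) \<subseteq> K'" using K'I[OF x] by auto
      have q: "?q \<in> Cc_infty \<Omega>"
        unfolding Cc_infty_def
      proof (intro CollectI conjI allI)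
        show "Ck n ?q" for n by (rule Ck_scaled_reflection) (use k(1) in \<open>simp add: Cc_infty_def\<close>)
        show "compact (closure {y. ?q y \<noteq> 0})"
          using qcl bounded_subset[OF bounded_cball qcl] by (simp add: compact_eq_bounded_closed)
        show "closure {y. ?q y \<noteq> 0} \<subseteq> \<Omega>" using qcl ballK' K'\<Omega> by blast
      qed
      have fq: "frechet_derivative ?q (at y) i = - r * frechet_derivative k (at (r *\<^sub>R (x - y))) i" for y
        using frechet_derivative_at[OF has_derivative_scaled_reflection[OF kdiff, of r x y]] by metis
      have q0: "?q y = 0" if "y \<notin> K'" for y using that qsupp ballK' by blast
      have q0': "frechet_derivative ?q (at y) i = 0" if "y \<notin> K'" for y
        by (rule Cc_infty_deriv_outside[OF q]) (use that qcl ballK' in blast)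
      have "(LINT y|lebesgue_on \<Omega>. w y * frechet_derivative ?q (at y) i) = - (LINT y|lebesgue_on \<Omega>. (g y \<bullet> i) * ?q y)"
        using wg q i by (auto simp: weak_gradient_def)
      moreover have "(LINT y|lebesgue_on \<Omega>. w y * frechet_derivative ?q (at y) i) =
          (LINT y|lborel. W y * frechet_derivative ?q (at y) i)"
        by (rule integral_localize[OF \<Omega>m K'\<Omega> Wae q0' Wm]) (simp_all add: fq)
      moreover have "(LINT y|lebesgue_on \<Omega>. (g y \<bullet> i) * ?q y) = (LINT y|lborel. P y * ?q y)"
        by (rule integral_localize[OF \<Omega>m K'\<Omega> Pae q0 Pm]) simp_all
      \<comment> \<open>the minus sign from differentiating \<open>x - y\<close> in \<open>y\<close> cancels the one from integrating by parts\<close>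
      ultimately have eq: "(LINT y|lborel. W y * (- r * frechet_derivative k (at (r *\<^sub>R (x - y))) i)) = - (LINT y|lborel. P y * ?q y)"
        by (simp add: fq)
      have "(LINT y|lborel. W y * (r ^ DIM('a) * (r * frechet_derivative k (at (r *\<^sub>R (x - y))) i))) =
          (LINT y|lborel. - (r ^ DIM('a)) * (W y * (- r * frechet_derivative k (at (r *\<^sub>R (x - y))) i)))"
        by (rule Bochner_Integration.integral_cong) (simp_all add: ac_simps)
      also have "\<dots> = - (r ^ DIM('a)) * (LINT y|lborel. W y * (- r * frechet_derivative k (at (r *\<^sub>R (x - y))) i))"
        by (rule integral_mult_right_zero)
      also have "\<dots> = (LINT y|lborel. r ^ DIM('a) * (P y * ?q y))"
        unfolding eq by simp
      also have "\<dots> = mollify k r P x"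
        unfolding mollify_def by (rule Bochner_Integration.integral_cong) (simp_all add: ac_simps)
      finally show ?thesis .
    qed
    have core: "(LINT x|lborel. F (W x) * ?\<delta> x) = - (LINT x|lborel. F' (W x) * P x * \<phi> x)"
      by (rule mollified_chain_rule[OF W P k \<phi> i wd F])
    have [measurable]: "\<phi> \<in> borel_measurable borel" "?\<delta> \<in> borel_measurable borel"
      using Cc_infty_continuous[OF \<phi>] Cc_infty_continuous_deriv[OF \<phi> i]
      by (auto intro: borel_measurable_continuous_onI)
    have "(LINT x|lebesgue_on \<Omega>. F (w x) * ?\<delta> x) = (LINT x|lborel. F (W x) * ?\<delta> x)"
    proof (rule integral_localize[OF \<Omega>m K'\<Omega>])
      show "AE x in lebesgue. x \<in> K' \<longrightarrow> F (W x) = F (w x)" using Wae by eventually_elim auto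
      show "?\<delta> x = 0" if "x \<notin> K'" for x
        by (rule Cc_infty_deriv_outside[OF \<phi>]) (use that KK' in blast)
    qed simp_all
    moreover have "(LINT x|lebesgue_on \<Omega>. (F' (w x) * (g x \<bullet> i)) * \<phi> x) = (LINT x|lborel. F' (W x) * P x * \<phi> x)"
    proof (rule integral_localize[OF \<Omega>m K'\<Omega>])
      show "AE x in lebesgue. x \<in> K' \<longrightarrow> F' (W x) * P x = F' (w x) * (g x \<bullet> i)"
        using Wae Pae by eventually_elim auto
      show "\<phi> x = 0" if "x \<notin> K'" for x
        by (rule Cc_infty_outside[OF \<phi>]) (use that KK' in blast)
    qed simp_all
    ultimately show ?thesis using core by simp
  qed
qed

section \<open>Tail integrals in time\<close>

lemma loc_integrable_mult_test:
  fixes f \<psi> :: "'a::euclidean_space \<Rightarrow> real"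
  assumes f: "loc_integrable \<Omega> f" and \<Omega>: "\<Omega> \<in> sets lebesgue"
    and \<psi>: "continuous_on UNIV \<psi>" "compact K" "K \<subseteq> \<Omega>" "\<And>x. x \<notin> K \<Longrightarrow> \<psi> x = 0"
  shows "integrable (lebesgue_on \<Omega>) (\<lambda>x. f x * \<psi> x)"
proof -
  obtain B where B: "B > 0" "\<And>x. \<bar>\<psi> x\<bar> \<le> B" using compact_support_bounded[OF \<psi>(1,2,4)] by blast
  have fK: "integrable (lebesgue_on K) f" using f \<psi> by (auto simp: loc_integrable_def)
  have Km: "K \<in> sets lebesgue" using \<psi>(2) by (simp add: lmeasurable_compact fmeasurableD)
  have [measurable]: "\<psi> \<in> borel_measurable lebesgue"
    using \<psi>(1) by (intro measurable_completion) (simp add: borel_measurable_continuous_onI)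
  have i: "integrable lebesgue (\<lambda>x. indicator K x *\<^sub>R f x)"
    using fK Km by (subst (asm) integrable_restrict_space) auto
  have "integrable lebesgue (\<lambda>x. (indicator K x *\<^sub>R f x) * \<psi> x)"
  proof (rule Bochner_Integration.integrable_bound[where f = "\<lambda>x. B * (indicator K x *\<^sub>R f x)"])
    have [measurable]: "(\<lambda>x. indicator K x *\<^sub>R f x) \<in> borel_measurable lebesgue" using i by auto
    show "(\<lambda>x. (indicator K x *\<^sub>R f x) * \<psi> x) \<in> borel_measurable lebesgue" by measurable
    show "AE x in lebesgue. norm ((indicator K x *\<^sub>R f x) * \<psi> x) \<le> norm (B * (indicator K x *\<^sub>R f x))"
    proof (rule AE_I2)
      fix x
      show "norm ((indicator K x *\<^sub>R f x) * \<psi> x) \<le> norm (B * (indicator K x *\<^sub>R f x))"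
        using mult_left_mono[OF B(2)[of x], of "\<bar>indicator K x *\<^sub>R f x\<bar>"] B(1)
        by (simp add: abs_mult mult.commute[of B])
    qed
  qed (use i in auto)
  also have "(\<lambda>x. (indicator K x *\<^sub>R f x) * \<psi> x) = (\<lambda>x. indicator \<Omega> x *\<^sub>R (f x * \<psi> x))"
  proof
    fix x
    show "(indicator K x *\<^sub>R f x) * \<psi> x = indicator \<Omega> x *\<^sub>R (f x * \<psi> x)"
      using \<psi>(3) \<psi>(4)[of x] by (cases "x \<in> K") auto
  qed
  finally show ?thesis using \<Omega> by (subst integrable_restrict_space) auto
qed

lemma weak_gradient_diff:
  fixes f1 f2 :: "'a::euclidean_space \<Rightarrow> real"
  assumes w1: "weak_gradient \<Omega> f1 g1" and w2: "weak_gradient \<Omega> f2 g2" and \<Omega>: "\<Omega> \<in> sets lebesgue"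
  shows "weak_gradient \<Omega> (\<lambda>x. f1 x - f2 x) (\<lambda>x. g1 x - g2 x)"
  unfolding weak_gradient_def
proof (intro conjI ballI)
  have l: "loc_integrable \<Omega> f1" "loc_integrable \<Omega> f2" "loc_integrable \<Omega> g1" "loc_integrable \<Omega> g2"
    using w1 w2 by (auto simp: weak_gradient_def)
  show "loc_integrable \<Omega> (\<lambda>x. f1 x - f2 x)" "loc_integrable \<Omega> (\<lambda>x. g1 x - g2 x)"
    using l by (auto simp: loc_integrable_def)
  fix \<phi> i assume \<phi>: "\<phi> \<in> Cc_infty \<Omega>" and i: "i \<in> (Basis :: 'a set)"
  have li: "loc_integrable \<Omega> (\<lambda>x. g1 x \<bullet> i)" "loc_integrable \<Omega> (\<lambda>x. g2 x \<bullet> i)"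
    using l by (auto simp: loc_integrable_def)
  note t1 = loc_integrable_mult_test[OF _ \<Omega> Cc_infty_continuous_deriv[OF \<phi> i] Cc_infty_compact[OF \<phi>]
      Cc_infty_subset[OF \<phi>] Cc_infty_deriv_outside[OF \<phi>]]
  note t2 = loc_integrable_mult_test[OF _ \<Omega> Cc_infty_continuous[OF \<phi>] Cc_infty_compact[OF \<phi>]
      Cc_infty_subset[OF \<phi>] Cc_infty_outside[OF \<phi>]]
  have "(LINT x|lebesgue_on \<Omega>. f1 x * frechet_derivative \<phi> (at x) i) = - (LINT x|lebesgue_on \<Omega>. (g1 x \<bullet> i) * \<phi> x)"
    "(LINT x|lebesgue_on \<Omega>. f2 x * frechet_derivative \<phi> (at x) i) = - (LINT x|lebesgue_on \<Omega>. (g2 x \<bullet> i) * \<phi> x)"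
    using w1 w2 \<phi> i by (auto simp: weak_gradient_def)
  then show "(LINT x|lebesgue_on \<Omega>. (f1 x - f2 x) * frechet_derivative \<phi> (at x) i) =
      - (LINT x|lebesgue_on \<Omega>. ((g1 x - g2 x) \<bullet> i) * \<phi> x)"
    using t1[OF l(1)] t1[OF l(2)] t2[OF li(1)] t2[OF li(2)]
    by (simp add: left_diff_distrib inner_diff_left)
qed

text \<open>
  Integrating \<open>(norm (a x) - d)\<^sup>2 \<ge> 0\<close> over \<open>A\<close> and optimising \<open>d\<close>.
\<close>

lemma Cauchy_Schwarz_indicator:
  fixes a :: "'b \<Rightarrow> 'c::euclidean_space"
  assumes a: "integrable M a" and a2: "integrable M (\<lambda>x. (norm (a x))\<^sup>2)"
    and A: "A \<in> sets M" "emeasure M A < \<infinity>" "measure M A \<le> c"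
  shows "(norm (LINT x|M. indicator A x *\<^sub>R a x))\<^sup>2 \<le> c * (LINT x|M. (norm (a x))\<^sup>2)"
proof -
  define q where "q = (LINT x|M. indicator A x * norm (a x))"
  define E where "E = (LINT x|M. (norm (a x))\<^sup>2)"
  have c0: "c \<ge> 0" using A(3) measure_nonneg[of M A] by linarith
  have iA: "integrable M (\<lambda>x. indicator A x * norm (a x))"
    using integrable_mult_indicator[OF A(1) integrable_norm[OF a]] by simp
  have "norm (LINT x|M. indicator A x *\<^sub>R a x) \<le> (LINT x|M. norm (indicator A x *\<^sub>R a x))"
    by (rule integral_norm_bound)
  then have nq: "norm (LINT x|M. indicator A x *\<^sub>R a x) \<le> q" by (simp add: q_def)
  have q0: "q \<ge> 0" unfolding q_def by simp
  have E0: "E \<ge> 0" unfolding E_def by simp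
  have key: "2 * d * q \<le> E + d\<^sup>2 * c" if "d \<ge> 0" for d
  proof -
    have "2 * d * q = (LINT x|M. 2 * d * (indicator A x * norm (a x)))" by (simp add: q_def)
    also have "\<dots> \<le> (LINT x|M. (norm (a x))\<^sup>2 + d\<^sup>2 * indicator A x)"
    proof (rule integral_mono)
      show "integrable M (\<lambda>x. 2 * d * (indicator A x * norm (a x)))" using iA by simp
      show "integrable M (\<lambda>x. (norm (a x))\<^sup>2 + d\<^sup>2 * indicator A x)"
        using a2 A by (intro Bochner_Integration.integrable_add integrable_mult_right integrable_real_indicator) auto
      show "2 * d * (indicator A x * norm (a x)) \<le> (norm (a x))\<^sup>2 + d\<^sup>2 * indicator A x" for x
        using zero_le_power2[of "norm (a x) - d"]
        by (auto simp: indicator_def power2_diff algebra_simps)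
    qed
    also have "\<dots> = E + d\<^sup>2 * measure M A"
      using a2 A by (subst Bochner_Integration.integral_add) (auto simp: E_def)
    also have "\<dots> \<le> E + d\<^sup>2 * c" using A(3) by (intro add_left_mono mult_left_mono) auto
    finally show ?thesis .
  qed
  have "q\<^sup>2 \<le> c * E"
  proof (cases "c = 0")
    case True
    have "q = 0"
    proof (rule ccontr)
      assume "q \<noteq> 0"
      with q0 have "q > 0" by simp
      with key[of "(E + 1) / q"] E0 True show False by simp
    qed
    then show ?thesis using True by simp
  next
    case False
    with c0 have "c > 0" by simp
    \<comment> \<open>the quadratic bound is sharpest at \<open>d = q / c\<close>\<close>
    from key[of "q / c"] q0 this have "2 * (q / c) * q \<le> E + (q / c)\<^sup>2 * c" by simp
    with \<open>c > 0\<close> show ?thesis by (simp add: power2_eq_square field_simps)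
  qed
  moreover have "(norm (LINT x|M. indicator A x *\<^sub>R a x))\<^sup>2 \<le> q\<^sup>2"
    using nq by (intro power_mono) auto
  ultimately show ?thesis by (simp add: E_def)
qed

lemma finite_measure_time: "finite_measure (lebesgue_on {0<..<T::real})"
  by (intro finite_measure_lebesgue_on) simp

lemma time_borel[measurable]: "(\<lambda>t::real. t) \<in> borel_measurable (lebesgue_on S)"
  by (intro measurable_restrict_space1 measurable_completion) simp

text \<open>
  For \<open>t \<in> [0, T]\<close> this is \<open>\<integral>\<^sub>t\<^sup>T f(s, x) ds\<close>. It is written as an integral over the fixed set \<open>(0, T)\<close> so
  that its joint measurability in \<open>(t, x)\<close> follows from the product structure.
\<close>

definition tail :: "real \<Rightarrow> (real \<Rightarrow> 'a \<Rightarrow> 'c::euclidean_space) \<Rightarrow> real \<Rightarrow> 'a \<Rightarrow> 'c" where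
  "tail T f t x = (LINT s|lebesgue_on {0<..<T}. (if t < s then f s x else 0))"

lemma tail_at_end: "tail T f T x = 0"
proof -
  have "tail T f T x = (LINT s|lebesgue_on {0<..<T}. 0)"
    unfolding tail_def by (rule Bochner_Integration.integral_cong) auto
  then show ?thesis by simp
qed

lemma tail_measurable_pair:
  fixes f :: "real \<Rightarrow> 'a \<Rightarrow> 'c::euclidean_space"
  assumes [measurable]: "(\<lambda>(t, x). f t x) \<in> borel_measurable (lebesgue_on {0<..<T} \<Otimes>\<^sub>M M)"
  shows "(\<lambda>(t, x). tail T f t x) \<in> borel_measurable (lebesgue_on {0<..<T} \<Otimes>\<^sub>M M)"
proof -
  interpret L: finite_measure "lebesgue_on {0<..<T}" by (rule finite_measure_time)
  have "(\<lambda>(p, s). if fst p < s then f s (snd p) else 0) \<in>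
      borel_measurable ((lebesgue_on {0<..<T} \<Otimes>\<^sub>M M) \<Otimes>\<^sub>M lebesgue_on {0<..<T})"
    by measurable
  then have "(\<lambda>p. LINT s|lebesgue_on {0<..<T}. (if fst p < s then f s (snd p) else 0)) \<in>
      borel_measurable (lebesgue_on {0<..<T} \<Otimes>\<^sub>M M)"
    by (rule L.borel_measurable_lebesgue_integral)
  then show ?thesis by (simp add: tail_def case_prod_unfold)
qed

lemma tail_measurable:
  fixes f :: "real \<Rightarrow> 'a \<Rightarrow> 'c::euclidean_space"
  assumes [measurable]: "(\<lambda>(t, x). f t x) \<in> borel_measurable (lebesgue_on {0<..<T} \<Otimes>\<^sub>M M)"
  shows "(\<lambda>x. tail T f t x) \<in> borel_measurable M"
proof -
  interpret L: finite_measure "lebesgue_on {0<..<T}" by (rule finite_measure_time)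
  have "(\<lambda>(x, s). if t < s then f s x else 0) \<in> borel_measurable (M \<Otimes>\<^sub>M lebesgue_on {0<..<T})"
    by measurable
  then show ?thesis unfolding tail_def by (rule L.borel_measurable_lebesgue_integral)
qed

text \<open>
  The difference is the integral over a time interval of length \<open>\<bar>s - t\<bar>\<close>. Integrated over \<open>x\<close>, this
  one estimate yields both the square integrability of the tail (take \<open>s = T\<close>, where it vanishes)
  and its continuity in time with values in \<open>L\<^sup>2\<close>.
\<close>

lemma tail_diff_bound:
  fixes f :: "real \<Rightarrow> 'a \<Rightarrow> 'c::euclidean_space"
  assumes a: "integrable (lebesgue_on {0<..<T}) (\<lambda>s. f s x)"
    and a2: "integrable (lebesgue_on {0<..<T}) (\<lambda>s. (norm (f s x))\<^sup>2)"
  shows "(norm (tail T f s x - tail T f t x))\<^sup>2 \<le> \<bar>s - t\<bar> * (LINT r|lebesgue_on {0<..<T}. (norm (f r x))\<^sup>2)"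
proof -
  let ?L = "lebesgue_on {0<..<T}"
  have *: "(norm (tail T f s x - tail T f t x))\<^sup>2 \<le> \<bar>s - t\<bar> * (LINT r|?L. (norm (f r x))\<^sup>2)"
    if st: "s \<le> t" for s t
  proof -
    let ?A = "{s<..t} \<inter> {0<..<T}"
    have ia: "integrable ?L (\<lambda>r. if t < r then f r x else 0)" for t
    proof -
      have "{t<..} \<inter> {0<..<T} \<in> sets ?L" by (auto simp: sets_restrict_space)
      from integrable_mult_indicator[OF this a] show ?thesis
        by (rule Bochner_Integration.integrable_cong[THEN iffD1, rotated 2]) auto
    qed
    have "tail T f s x - tail T f t x = (LINT r|?L. (if s < r then f r x else 0) - (if t < r then f r x else 0))"
      unfolding tail_def using ia by simp
    also have "\<dots> = (LINT r|?L. indicator ?A r *\<^sub>R f r x)"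
      using st by (intro Bochner_Integration.integral_cong) (auto simp: indicator_def)
    finally have eq: "tail T f s x - tail T f t x = (LINT r|?L. indicator ?A r *\<^sub>R f r x)" .
    have A: "?A \<in> sets ?L" by (auto simp: sets_restrict_space)
    have "emeasure ?L ?A = emeasure lebesgue ?A" by (rule emeasure_restrict_space) auto
    also have "\<dots> \<le> emeasure lebesgue {s<..t}" by (rule emeasure_mono) auto
    also have "\<dots> = ennreal (t - s)" using st by simp
    finally have e: "emeasure ?L ?A \<le> ennreal (t - s)" .
    then have "emeasure ?L ?A < \<infinity>" by (rule le_less_trans) simp
    moreover have "measure ?L ?A \<le> \<bar>s - t\<bar>"
      using e st unfolding measure_def by (intro enn2real_leI) auto
    ultimately show ?thesis unfolding eq by (intro Cauchy_Schwarz_indicator[OF a a2 A])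
  qed
  show ?thesis
  proof (cases "s \<le> t")
    case True
    then show ?thesis by (rule *)
  next
    case False
    then show ?thesis using *[of t s] by (simp add: norm_minus_commute abs_minus_commute)
  qed
qed

lemma in_LpLp_2_iff:
  fixes f :: "real \<Rightarrow> 'a \<Rightarrow> 'c::euclidean_space"
  shows "in_LpLp 2 T M f \<longleftrightarrow> (\<lambda>(t, x). f t x) \<in> borel_measurable (lebesgue_on {0<..<T} \<Otimes>\<^sub>M M) \<and>
     integrable (lebesgue_on {0<..<T} \<Otimes>\<^sub>M M) (\<lambda>(t, x). (norm (f t x))\<^sup>2)"
  by (simp add: in_LpLp_def in_Lp_def case_prod_unfold)

lemma L2_slices:
  fixes f :: "real \<Rightarrow> 'a \<Rightarrow> 'c::euclidean_space"
  assumes f: "in_LpLp 2 T M f" and M: "sigma_finite_measure M"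
  shows AE_slice_integrable: "AE x in M. integrable (lebesgue_on {0<..<T}) (\<lambda>s. f s x) \<and>
      integrable (lebesgue_on {0<..<T}) (\<lambda>s. (norm (f s x))\<^sup>2)"
    and integrable_slice_energy: "integrable M (\<lambda>x. LINT s|lebesgue_on {0<..<T}. (norm (f s x))\<^sup>2)"
proof -
  let ?L = "lebesgue_on {0<..<T}"
  interpret L: finite_measure ?L by (rule finite_measure_time)
  interpret M: sigma_finite_measure M by (rule M)
  interpret P: pair_sigma_finite ?L M ..
  have fm[measurable]: "(\<lambda>(t, x). f t x) \<in> borel_measurable (?L \<Otimes>\<^sub>M M)"
    and i: "integrable (?L \<Otimes>\<^sub>M M) (\<lambda>(t, x). (norm (f t x))\<^sup>2)"
    using f by (auto simp: in_LpLp_2_iff)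
  show "integrable M (\<lambda>x. LINT s|?L. (norm (f s x))\<^sup>2)"
    by (rule P.integrable_snd[OF i])
  have "AE x in M. integrable ?L (\<lambda>s. (norm (f s x))\<^sup>2)"
    by (rule P.AE_integrable_snd[OF i])
  then show "AE x in M. integrable ?L (\<lambda>s. f s x) \<and> integrable ?L (\<lambda>s. (norm (f s x))\<^sup>2)"
    using AE_space
  proof eventually_elim
    case (elim x)
    have [measurable]: "(\<lambda>s. f s x) \<in> borel_measurable ?L"
      using measurable_compose[OF measurable_Pair2'[OF elim(2)] fm] by simp
    have "integrable ?L (\<lambda>s. f s x)"
    proof (rule Bochner_Integration.integrable_bound[where f = "\<lambda>s. 1 + (norm (f s x))\<^sup>2"])
      show "integrable ?L (\<lambda>s. 1 + (norm (f s x))\<^sup>2)" using elim by simp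
      show "AE s in ?L. norm (f s x) \<le> norm (1 + (norm (f s x))\<^sup>2)"
      proof (rule AE_I2)
        fix s
        have "2 * norm (f s x) \<le> 1 + (norm (f s x))\<^sup>2"
          using zero_le_power2[of "norm (f s x) - 1"] by (simp add: power2_diff)
        then show "norm (f s x) \<le> norm (1 + (norm (f s x))\<^sup>2)"
          using norm_ge_zero[of "f s x"] unfolding real_norm_def by linarith
      qed
    qed simp
    with elim show ?case by simp
  qed
qed

lemma tail_slice_L2:
  fixes f :: "real \<Rightarrow> 'a \<Rightarrow> 'c::euclidean_space"
  assumes f: "in_LpLp 2 T M f" and M: "sigma_finite_measure M"
  defines "E \<equiv> \<lambda>x. LINT s|lebesgue_on {0<..<T}. (norm (f s x))\<^sup>2"
  shows "integrable M (\<lambda>x. (norm (tail T f s x - tail T f t x))\<^sup>2)"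
    and "(LINT x|M. (norm (tail T f s x - tail T f t x))\<^sup>2) \<le> \<bar>s - t\<bar> * (LINT x|M. E x)"
proof -
  have fm: "(\<lambda>(t, x). f t x) \<in> borel_measurable (lebesgue_on {0<..<T} \<Otimes>\<^sub>M M)"
    using f by (auto simp: in_LpLp_2_iff)
  note [measurable] = tail_measurable[OF fm]
  have E: "integrable M E" unfolding E_def by (rule integrable_slice_energy[OF f M])
  have bd: "AE x in M. (norm (tail T f s x - tail T f t x))\<^sup>2 \<le> \<bar>s - t\<bar> * E x"
    using AE_slice_integrable[OF f M] unfolding E_def by eventually_elim (auto intro: tail_diff_bound)
  have "integrable M (\<lambda>x. \<bar>s - t\<bar> * E x)" using E by simp
  then show i: "integrable M (\<lambda>x. (norm (tail T f s x - tail T f t x))\<^sup>2)"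
  proof (rule Bochner_Integration.integrable_bound)
    show "AE x in M. norm ((norm (tail T f s x - tail T f t x))\<^sup>2) \<le> norm (\<bar>s - t\<bar> * E x)"
      using bd by eventually_elim auto
  qed measurable
  have "(LINT x|M. (norm (tail T f s x - tail T f t x))\<^sup>2) \<le> (LINT x|M. \<bar>s - t\<bar> * E x)"
    using i E bd by (intro integral_mono_AE) auto
  then show "(LINT x|M. (norm (tail T f s x - tail T f t x))\<^sup>2) \<le> \<bar>s - t\<bar> * (LINT x|M. E x)" by simp
qed

lemma tail_in_LpLp:
  fixes f :: "real \<Rightarrow> 'a \<Rightarrow> 'c::euclidean_space"
  assumes f: "in_LpLp 2 T M f" and M: "sigma_finite_measure M"
  shows "in_LpLp 2 T M (tail T f)"
proof -
  let ?L = "lebesgue_on {0<..<T}"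
  interpret L: finite_measure ?L by (rule finite_measure_time)
  interpret M: sigma_finite_measure M by (rule M)
  interpret P: pair_sigma_finite ?L M ..
  have fm: "(\<lambda>(t, x). f t x) \<in> borel_measurable (?L \<Otimes>\<^sub>M M)"
    using f by (auto simp: in_LpLp_2_iff)
  note tm[measurable] = tail_measurable_pair[OF fm]
  define E where "E = (LINT x|M. LINT s|?L. (norm (f s x))\<^sup>2)"
  have b: "integrable M (\<lambda>x. (norm (tail T f t x))\<^sup>2)" "(LINT x|M. (norm (tail T f t x))\<^sup>2) \<le> \<bar>t - T\<bar> * E" for t
    using tail_slice_L2[OF f M, of t T] by (simp_all add: tail_at_end E_def)
  have E0: "E \<ge> 0" unfolding E_def by simp
  have "integrable (?L \<Otimes>\<^sub>M M) (\<lambda>(t, x). (norm (tail T f t x))\<^sup>2)"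
  proof (rule P.Fubini_integrable)
    show "integrable ?L (\<lambda>t. LINT x|M. norm (case (t, x) of (t, x) \<Rightarrow> (norm (tail T f t x))\<^sup>2))"
    proof (rule L.integrable_const_bound[where B = "\<bar>T\<bar> * E"])
      show "(\<lambda>t. LINT x|M. norm (case (t, x) of (t, x) \<Rightarrow> (norm (tail T f t x))\<^sup>2)) \<in> borel_measurable ?L"
        by measurable
      show "AE t in ?L. norm (LINT x|M. norm (case (t, x) of (t, x) \<Rightarrow> (norm (tail T f t x))\<^sup>2)) \<le> \<bar>T\<bar> * E"
      proof (rule AE_I2)
        fix t assume "t \<in> space ?L"
        then have "\<bar>t - T\<bar> * E \<le> \<bar>T\<bar> * E" using E0 by (intro mult_right_mono) auto
        with b(2)[of t] show "norm (LINT x|M. norm (case (t, x) of (t, x) \<Rightarrow> (norm (tail T f t x))\<^sup>2)) \<le> \<bar>T\<bar> * E"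
          by simp
      qed
    qed
    show "AE t in ?L. integrable M (\<lambda>x. case (t, x) of (t, x) \<Rightarrow> (norm (tail T f t x))\<^sup>2)"
      using b(1) by simp
  qed measurable
  with tm show ?thesis by (simp add: in_LpLp_2_iff)
qed

lemma tail_L2_continuous:
  fixes f :: "real \<Rightarrow> 'a \<Rightarrow> real"
  assumes f: "in_LpLp 2 T M f" and M: "sigma_finite_measure M"
  shows "L2_continuous T M (tail T f)"
  unfolding L2_continuous_def
proof (intro ballI conjI)
  have fm: "(\<lambda>(t, x). f t x) \<in> borel_measurable (lebesgue_on {0<..<T} \<Otimes>\<^sub>M M)"
    using f by (auto simp: in_LpLp_2_iff)
  fix t
  show "in_Lp 2 M (tail T f t)"
    using tail_slice_L2(1)[OF f M, of t T] tail_measurable[OF fm, of t] by (simp add: in_Lp_def tail_at_end)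
  define E where "E = (LINT x|M. LINT s|lebesgue_on {0<..<T}. (norm (f s x))\<^sup>2)"
  show "((\<lambda>s. LINT x|M. (tail T f s x - tail T f t x)\<^sup>2) \<longlongrightarrow> 0) (at t within {0..T})"
  proof (rule Lim_null_comparison)
    show "\<forall>\<^sub>F s in at t within {0..T}. norm (LINT x|M. (tail T f s x - tail T f t x)\<^sup>2) \<le> \<bar>s - t\<bar> * E"
      using tail_slice_L2(2)[OF f M, of _ t] by (intro always_eventually) (simp add: E_def)
    have "((\<lambda>s. \<bar>s - t\<bar> * E) \<longlongrightarrow> \<bar>t - t\<bar> * E) (at t within {0..T})"
      by (intro tendsto_intros)
    then show "((\<lambda>s. \<bar>s - t\<bar> * E) \<longlongrightarrow> 0) (at t within {0..T})" by simp
  qed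
qed

section \<open>Tail integrals: derivative, energy and gradient\<close>

lemma sigma_finite_completion:
  assumes "sigma_finite_measure M"
  shows "sigma_finite_measure (completion M)"
proof -
  interpret sigma_finite_measure M by fact
  obtain A where A: "countable A" "A \<subseteq> sets M" "\<Union> A = space M" "\<And>a. a \<in> A \<Longrightarrow> emeasure M a \<noteq> \<infinity>"
    using sigma_finite_countable by blast
  show ?thesis
  proof (rule sigma_finite_measure.intro, intro exI conjI)
    show "A \<subseteq> sets (completion M)" using A(2) by auto
    show "\<forall>a\<in>A. emeasure (completion M) a \<noteq> \<infinity>" using A(2,4) by auto
  qed (use A in simp_all)
qed

lemma sigma_finite_lebesgue_on:
  "\<Omega> \<in> sets lebesgue \<Longrightarrow> sigma_finite_measure (lebesgue_on \<Omega>)"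
  by (intro sigma_finite_measure_restrict_space sigma_finite_completion sigma_finite_lborel)

lemma integrable_pair_snd:
  fixes a :: "'b \<Rightarrow> 'c::euclidean_space"
  assumes L: "finite_measure L" and M: "sigma_finite_measure M" and a: "integrable M a"
  shows "integrable (L \<Otimes>\<^sub>M M) (\<lambda>(t, x). a x)"
proof -
  interpret L: finite_measure L by fact
  interpret M: sigma_finite_measure M by fact
  interpret P: pair_sigma_finite L M ..
  have [measurable]: "a \<in> borel_measurable M" using a by auto
  show ?thesis by (rule P.Fubini_integrable) (use a in auto)
qed

lemma integral_test_deriv:
  fixes \<psi> :: "real \<Rightarrow> real"
  assumes \<psi>: "\<psi> \<in> Cc_infty {0<..<T}" and s: "0 < s" "s < T"
  shows "(LINT t|lebesgue_on {0<..<T}. (if t < s then deriv \<psi> t else 0)) = \<psi> s"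
    and "continuous_on UNIV (deriv \<psi>)" and "\<exists>B. \<forall>t. \<bar>deriv \<psi> t\<bar> \<le> B"
proof -
  note time_borel[measurable del]
  have d: "(\<psi> has_real_derivative frechet_derivative \<psi> (at t) 1) (at t)" for t
    using Cc_infty_directional[OF \<psi>, of 0 1 t] by simp
  have eq: "deriv \<psi> = (\<lambda>t. frechet_derivative \<psi> (at t) 1)"
    using DERIV_imp_deriv[OF d] by auto
  have one: "(1::real) \<in> Basis" by simp
  show c: "continuous_on UNIV (deriv \<psi>)"
    unfolding eq by (rule Cc_infty_continuous_deriv[OF \<psi> one])
  show "\<exists>B. \<forall>t. \<bar>deriv \<psi> t\<bar> \<le> B"
    unfolding eq using compact_support_bounded[OF Cc_infty_continuous_deriv[OF \<psi> one] Cc_infty_compact[OF \<psi>]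
        Cc_infty_deriv_outside[OF \<psi>]] by blast
  have z: "0 \<notin> closure {x. \<psi> x \<noteq> 0}" using Cc_infty_subset[OF \<psi>] by auto
  have \<psi>0: "\<psi> 0 = 0" by (rule Cc_infty_outside[OF \<psi> z])
  have \<psi>'0: "deriv \<psi> 0 = 0" unfolding eq by (rule Cc_infty_deriv_outside[OF \<psi> z])
  have [measurable]: "deriv \<psi> \<in> borel_measurable borel" using c by (rule borel_measurable_continuous_onI)
  have "(LINT t|lebesgue_on {0<..<T}. (if t < s then deriv \<psi> t else 0)) =
      (LINT t|lebesgue. indicator {0<..<T} t *\<^sub>R (if t < s then deriv \<psi> t else 0))"
    by (subst integral_restrict_space) auto
  also have "\<dots> = (LINT t|lborel. indicator {0<..<T} t *\<^sub>R (if t < s then deriv \<psi> t else 0))"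
    by (rule integral_completion) measurable
  also have "\<dots> = (LINT t|lborel. deriv \<psi> t * indicator {0..s} t)"
  proof (rule integral_cong_AE)
    show "AE t in lborel. indicator {0<..<T} t *\<^sub>R (if t < s then deriv \<psi> t else 0) = deriv \<psi> t * indicator {0..s} t"
      using AE_lborel_singleton[of s]
    proof eventually_elim
      case (elim t)
      then show ?case using s \<psi>'0 by (cases "t = 0") (auto simp: indicator_def)
    qed
  qed measurable
  also have "\<dots> = \<psi> s - \<psi> 0"
  proof (rule integral_FTC_Icc_real)
    show "(\<psi> has_real_derivative deriv \<psi> x) (at x)" for x
      using d[of x] by (simp add: eq)
    show "isCont (deriv \<psi>) x" for x
      using c by (simp add: continuous_on_eq_continuous_at)
  qed (use s in simp)
  finally show "(LINT t|lebesgue_on {0<..<T}. (if t < s then deriv \<psi> t else 0)) = \<psi> s"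
    using \<psi>0 by simp
qed

lemma measurable_time_if:
  fixes h :: "real \<Rightarrow> 'c::euclidean_space"
  assumes "h \<in> borel_measurable (lebesgue_on S)"
  shows "(\<lambda>s. if t < s then h s else 0) \<in> borel_measurable (lebesgue_on S)"
proof (rule measurable_If[OF assms])
  show "{s \<in> space (lebesgue_on S). t < s} \<in> sets (lebesgue_on S)"
    by (rule borel_measurable_less[OF _ time_borel]) simp
qed simp

lemma integrable_time_if:
  fixes a :: "real \<Rightarrow> 'c::euclidean_space"
  assumes a: "integrable (lebesgue_on {0<..<T}) a"
  shows "integrable (lebesgue_on {0<..<T}) (\<lambda>s. if t < s then a s else 0)"
proof -
  have [measurable]: "a \<in> borel_measurable (lebesgue_on {0<..<T})" using a by auto
  have "(\<lambda>s. if t < s then a s else 0) \<in> borel_measurable (lebesgue_on {0<..<T})"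
    by (rule measurable_time_if[OF borel_measurable_integrable[OF a]])
  then show ?thesis by (rule Bochner_Integration.integrable_bound[OF a]) auto
qed

text \<open>
  By Fubini, \<open>\<integral>\<^sub>0\<^sup>T (\<integral>\<^sub>t\<^sup>T a(s) ds) \<psi>'(t) dt = \<integral>\<^sub>0\<^sup>T a(s) (\<integral>\<^sub>0\<^sup>s \<psi>'(t) dt) ds\<close>, and \<open>\<psi>\<close> vanishes at \<open>0\<close>.
\<close>

lemma tail_by_parts:
  fixes a \<psi> :: "real \<Rightarrow> real"
  assumes a: "integrable (lebesgue_on {0<..<T}) a" and \<psi>: "\<psi> \<in> Cc_infty {0<..<T}" and T: "T > 0"
  shows "(LINT t|lebesgue_on {0<..<T}. (LINT s|lebesgue_on {0<..<T}. (if t < s then a s else 0)) * deriv \<psi> t) =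
      (LINT s|lebesgue_on {0<..<T}. a s * \<psi> s)"
proof -
  let ?L = "lebesgue_on {0<..<T}"
  interpret L: finite_measure ?L by (rule finite_measure_time)
  interpret P: pair_sigma_finite ?L ?L ..
  have T2: "0 < T / 2" "T / 2 < T" using T by auto
  note td = integral_test_deriv[OF \<psi>]
  obtain B where B: "\<And>t. \<bar>deriv \<psi> t\<bar> \<le> B" using td(3)[OF T2] by blast
  have [measurable]: "deriv \<psi> \<in> borel_measurable borel"
    using td(2)[OF T2] by (rule borel_measurable_continuous_onI)
  have am[measurable]: "a \<in> borel_measurable ?L" using a by auto
  have "integrable (?L \<Otimes>\<^sub>M ?L) (\<lambda>(t, s). B * a s)"
    by (rule integrable_pair_snd[OF finite_measure_time]) (use a in \<open>auto intro: L.sigma_finite_measure_axioms\<close>)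
  then have i: "integrable (?L \<Otimes>\<^sub>M ?L) (\<lambda>(t, s). (if t < s then a s else 0) * deriv \<psi> t)"
  proof (rule Bochner_Integration.integrable_bound)
    show "AE p in ?L \<Otimes>\<^sub>M ?L. norm (case p of (t, s) \<Rightarrow> (if t < s then a s else 0) * deriv \<psi> t)
        \<le> norm (case p of (t, s) \<Rightarrow> B * a s)"
    proof (rule AE_I2, clarify)
      fix t s
      have "\<bar>a s\<bar> * \<bar>deriv \<psi> t\<bar> \<le> \<bar>a s\<bar> * \<bar>B\<bar>"
        using B[of t] by (intro mult_left_mono) auto
      then show "norm ((if t < s then a s else 0) * deriv \<psi> t) \<le> norm (B * a s)"
        by (auto simp: abs_mult mult.commute)
    qed
  qed measurable
  have "(LINT t|?L. (LINT s|?L. (if t < s then a s else 0)) * deriv \<psi> t) =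
      (LINT t|?L. LINT s|?L. (if t < s then a s else 0) * deriv \<psi> t)"
    by simp
  also have "\<dots> = (LINT s|?L. LINT t|?L. (if t < s then a s else 0) * deriv \<psi> t)"
    by (rule P.Fubini_integral[OF i, symmetric])
  also have "\<dots> = (LINT s|?L. a s * \<psi> s)"
  proof (rule Bochner_Integration.integral_cong[OF refl])
    fix s assume "s \<in> space ?L"
    then have s: "0 < s" "s < T" by auto
    have "(LINT t|?L. (if t < s then a s else 0) * deriv \<psi> t) = (LINT t|?L. a s * (if t < s then deriv \<psi> t else 0))"
      by (rule Bochner_Integration.integral_cong) auto
    also have "\<dots> = a s * \<psi> s" using td(1)[OF s] by simp
    finally show "(LINT t|?L. (if t < s then a s else 0) * deriv \<psi> t) = a s * \<psi> s" .
  qed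
  finally show ?thesis .
qed

lemma tail_W12_time:
  fixes f :: "real \<Rightarrow> 'a \<Rightarrow> real"
  assumes f: "in_LpLp 2 T M f" and M: "sigma_finite_measure M" and T: "T > 0"
  shows "W12_time T M (tail T f) (\<lambda>t x. - f t x)"
  unfolding W12_time_def
proof (intro conjI ballI)
  show "in_LpLp 2 T M (tail T f)" by (rule tail_in_LpLp[OF f M])
  have [measurable]: "(\<lambda>(t, x). f t x) \<in> borel_measurable (lebesgue_on {0<..<T} \<Otimes>\<^sub>M M)"
    using f by (auto simp: in_LpLp_2_iff)
  have "(\<lambda>(t, x). - f t x) \<in> borel_measurable (lebesgue_on {0<..<T} \<Otimes>\<^sub>M M)" by measurable
  then show "in_LpLp 2 T M (\<lambda>t x. - f t x)" using f by (simp add: in_LpLp_2_iff)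
  fix \<psi> :: "real \<Rightarrow> real" assume \<psi>: "\<psi> \<in> Cc_infty {0<..<T}"
  show "AE x in M. (LINT t|lebesgue_on {0<..<T}. tail T f t x * deriv \<psi> t) =
      - (LINT t|lebesgue_on {0<..<T}. - f t x * \<psi> t)"
    using AE_slice_integrable[OF f M]
  proof eventually_elim
    case (elim x)
    then show ?case using tail_by_parts[OF _ \<psi> T, of "\<lambda>s. f s x"] by (simp add: tail_def)
  qed
qed

text \<open>
  Adding the integrals of \<open>a t \<bullet> a s\<close> over the two triangles \<open>t < s\<close> and \<open>s < t\<close>, which are equal by
  symmetry, gives the integral over the square.
\<close>

lemma integral_inner_tail:
  fixes a :: "real \<Rightarrow> 'c::euclidean_space"
  assumes a: "integrable (lebesgue_on {0<..<T}) a"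
  defines "A \<equiv> LINT s|lebesgue_on {0<..<T}. a s"
  shows "2 * (LINT t|lebesgue_on {0<..<T}. a t \<bullet> (LINT s|lebesgue_on {0<..<T}. (if t < s then a s else 0))) = A \<bullet> A"
proof -
  let ?L = "lebesgue_on {0<..<T}"
  interpret L: finite_measure ?L by (rule finite_measure_time)
  interpret P: pair_sigma_finite ?L ?L ..
  have [measurable]: "a \<in> borel_measurable ?L" using a by auto
  let ?k = "\<lambda>t s. if t < s then a t \<bullet> a s else 0"
  have "integrable (?L \<Otimes>\<^sub>M ?L) (\<lambda>(t, s). norm (a t) * norm (a s))"
    by (rule P.Fubini_integrable) (use a in auto)
  then have i: "integrable (?L \<Otimes>\<^sub>M ?L) (\<lambda>(t, s). ?k t s)"
  proof (rule Bochner_Integration.integrable_bound)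
    show "AE p in ?L \<Otimes>\<^sub>M ?L. norm (case p of (t, s) \<Rightarrow> ?k t s) \<le> norm (case p of (t, s) \<Rightarrow> norm (a t) * norm (a s))"
      by (rule AE_I2) (auto simp: Cauchy_Schwarz_ineq2)
  qed measurable
  have 1: "(LINT t|?L. a t \<bullet> (LINT s|?L. (if t < s then a s else 0))) = (LINT t|?L. LINT s|?L. ?k t s)"
  proof (rule Bochner_Integration.integral_cong[OF refl])
    fix t
    have "(LINT s|?L. ?k t s) = (LINT s|?L. a t \<bullet> (if t < s then a s else 0))"
      by (rule Bochner_Integration.integral_cong) auto
    also have "\<dots> = a t \<bullet> (LINT s|?L. (if t < s then a s else 0))"
      by (rule integral_inner_right) (rule integrable_time_if[OF a])
    finally show "a t \<bullet> (LINT s|?L. (if t < s then a s else 0)) = (LINT s|?L. ?k t s)" by simp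
  qed
  have 2: "(LINT t|?L. LINT s|?L. ?k t s) = (LINT t|?L. LINT s|?L. ?k s t)"
    by (rule P.Fubini_integral[OF i, symmetric])
  have s1: "integrable ?L (\<lambda>t. LINT s|?L. ?k t s)" by (rule P.integrable_fst[OF i])
  have s2: "integrable ?L (\<lambda>t. LINT s|?L. ?k s t)" by (rule P.integrable_snd[OF i])
  have sl1: "integrable ?L (\<lambda>s. ?k t s)" for t
  proof (rule Bochner_Integration.integrable_bound[where f = "\<lambda>s. norm (a t) * norm (a s)"])
    show "AE s in ?L. norm (?k t s) \<le> norm (norm (a t) * norm (a s))"
      by (rule AE_I2) (auto simp: Cauchy_Schwarz_ineq2)
  qed (use a in auto)
  have sl2: "integrable ?L (\<lambda>s. ?k s t)" for t
  proof (rule Bochner_Integration.integrable_bound[where f = "\<lambda>s. norm (a t) * norm (a s)"])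
    show "AE s in ?L. norm (?k s t) \<le> norm (norm (a t) * norm (a s))"
      by (rule AE_I2) (auto simp: Cauchy_Schwarz_ineq2 inner_commute[of _ "a t"])
  qed (use a in auto)
  have "2 * (LINT t|?L. LINT s|?L. ?k t s) = (LINT t|?L. LINT s|?L. ?k t s) + (LINT t|?L. LINT s|?L. ?k s t)"
    using 2 by simp
  also have "\<dots> = (LINT t|?L. (LINT s|?L. ?k t s) + (LINT s|?L. ?k s t))"
    by (rule Bochner_Integration.integral_add[OF s1 s2, symmetric])
  also have "\<dots> = (LINT t|?L. a t \<bullet> A)"
  proof (rule Bochner_Integration.integral_cong[OF refl])
    fix t
    have "(LINT s|?L. ?k t s) + (LINT s|?L. ?k s t) = (LINT s|?L. ?k t s + ?k s t)"
      by (rule Bochner_Integration.integral_add[OF sl1 sl2, symmetric])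
    also have "\<dots> = (LINT s|?L. a t \<bullet> a s)"
    proof (rule integral_cong_AE)
      have "AE s in lebesgue. s \<noteq> t"
        using AE_lborel_singleton[of t] by (simp add: AE_completion_iff)
      then have "AE s in ?L. s \<noteq> t" by (subst AE_restrict_space_iff) auto
      then show "AE s in ?L. ?k t s + ?k s t = a t \<bullet> a s"
        by eventually_elim (auto simp: inner_commute)
    qed measurable
    also have "\<dots> = a t \<bullet> A" unfolding A_def by (rule integral_inner_right) (rule a)
    finally show "(LINT s|?L. ?k t s) + (LINT s|?L. ?k s t) = a t \<bullet> A" .
  qed
  also have "\<dots> = A \<bullet> A" using a by (simp add: A_def)
  finally show ?thesis by (simp only: 1)
qed

text \<open>
  The weak gradient commutes with integration in time, by Fubini. Integrability on
  \<open>(0, T) \<times> K\<close> serves both the interchange of integrals, with \<open>K\<close> the support of a test function, and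
  the local integrability of the tails.
\<close>

lemma weak_gradient_tail:
  fixes f :: "real \<Rightarrow> 'a::euclidean_space \<Rightarrow> real" and G :: "real \<Rightarrow> 'a \<Rightarrow> 'a"
  assumes \<Omega>: "\<Omega> \<in> sets lebesgue"
    and fm[measurable]: "(\<lambda>(t, x). f t x) \<in> borel_measurable (lebesgue_on {0<..<T} \<Otimes>\<^sub>M lebesgue_on \<Omega>)"
    and Gm[measurable]: "(\<lambda>(t, x). G t x) \<in> borel_measurable (lebesgue_on {0<..<T} \<Otimes>\<^sub>M lebesgue_on \<Omega>)"
    and fi: "\<And>K. compact K \<Longrightarrow> K \<subseteq> \<Omega> \<Longrightarrow>
      integrable (lebesgue_on {0<..<T} \<Otimes>\<^sub>M lebesgue_on \<Omega>) (\<lambda>(t, x). indicator K x *\<^sub>R f t x)"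
    and Gi: "\<And>K. compact K \<Longrightarrow> K \<subseteq> \<Omega> \<Longrightarrow>
      integrable (lebesgue_on {0<..<T} \<Otimes>\<^sub>M lebesgue_on \<Omega>) (\<lambda>(t, x). indicator K x *\<^sub>R G t x)"
    and wg: "AE t in lebesgue_on {0<..<T}. weak_gradient \<Omega> (f t) (G t)"
  shows "weak_gradient \<Omega> (tail T f t) (tail T G t)"
  unfolding weak_gradient_def
proof (intro conjI ballI)
  let ?L = "lebesgue_on {0<..<T}" and ?N = "lebesgue_on \<Omega>"
  interpret L: finite_measure ?L by (rule finite_measure_time)
  interpret N: sigma_finite_measure ?N
    using \<Omega> by (rule sigma_finite_lebesgue_on)
  interpret P: pair_sigma_finite ?L ?N ..
  have loc: "loc_integrable \<Omega> (tail T h t)"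
    if hm[measurable]: "(\<lambda>(t, x). h t x) \<in> borel_measurable (?L \<Otimes>\<^sub>M ?N)"
      and hi: "\<And>K. compact K \<Longrightarrow> K \<subseteq> \<Omega> \<Longrightarrow> integrable (?L \<Otimes>\<^sub>M ?N) (\<lambda>(t, x). indicator K x *\<^sub>R h t x)"
    for h :: "real \<Rightarrow> 'a \<Rightarrow> 'c::euclidean_space"
    unfolding loc_integrable_def
  proof (intro allI impI)
    fix K assume K: "compact K \<and> K \<subseteq> \<Omega>"
    then have Km: "K \<in> sets lebesgue" by (simp add: lmeasurable_compact fmeasurableD)
    have [measurable]: "K \<in> sets ?N" using Km K by (simp add: sets_restrict_space_iff \<Omega>)
    have eq: "(if t < s then indicator K x *\<^sub>R h s x else 0) = indicator K x *\<^sub>R (if t < s then h s x else 0)" for s x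
      by simp
    have "integrable (?L \<Otimes>\<^sub>M ?N) (\<lambda>(s, x). if t < s then indicator K x *\<^sub>R h s x else 0)"
      by (rule Bochner_Integration.integrable_bound[OF hi]) (use K in auto)
    then have "integrable ?N (\<lambda>x. LINT s|?L. (if t < s then indicator K x *\<^sub>R h s x else 0))"
      by (rule P.integrable_snd)
    also have "(\<lambda>x. LINT s|?L. (if t < s then indicator K x *\<^sub>R h s x else 0)) = (\<lambda>x. indicator K x *\<^sub>R tail T h t x)"
      unfolding tail_def by (simp add: eq)
    finally have "integrable lebesgue (\<lambda>x. indicator \<Omega> x *\<^sub>R indicator K x *\<^sub>R tail T h t x)"
      using \<Omega> by (subst (asm) integrable_restrict_space) auto
    also have "(\<lambda>x. indicator \<Omega> x *\<^sub>R indicator K x *\<^sub>R tail T h t x) = (\<lambda>x. indicator K x *\<^sub>R tail T h t x)"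
      using K by (auto simp: indicator_def fun_eq_iff)
    finally show "integrable (lebesgue_on K) (tail T h t)"
      using Km by (subst integrable_restrict_space) auto
  qed
  show "loc_integrable \<Omega> (tail T f t)" by (rule loc[OF fm fi])
  show "loc_integrable \<Omega> (tail T G t)" by (rule loc[OF Gm Gi])
  fix \<phi> i assume \<phi>: "\<phi> \<in> Cc_infty \<Omega>" and i: "i \<in> (Basis :: 'a set)"
  let ?K = "closure {x. \<phi> x \<noteq> 0}"
  have swap: "(LINT x|?N. tail T h t x * \<psi> x) = (LINT s|?L. (if t < s then (LINT x|?N. h s x * \<psi> x) else 0))"
    if hm[measurable]: "(\<lambda>(t, x). h t x) \<in> borel_measurable (?L \<Otimes>\<^sub>M ?N)"
      and hi: "integrable (?L \<Otimes>\<^sub>M ?N) (\<lambda>(t, x). indicator ?K x *\<^sub>R h t x)"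
      and \<psi>: "continuous_on UNIV \<psi>" "\<And>x. x \<notin> ?K \<Longrightarrow> \<psi> x = 0"
    for h :: "real \<Rightarrow> 'a \<Rightarrow> real" and \<psi>
  proof -
    obtain B where B: "B > 0" "\<And>x. \<bar>\<psi> x\<bar> \<le> B"
      using compact_support_bounded[OF \<psi>(1) Cc_infty_compact[OF \<phi>] \<psi>(2)] by blast
    have [measurable]: "\<psi> \<in> borel_measurable ?N"
      using \<psi>(1) by (intro measurable_restrict_space1 measurable_completion) (simp add: borel_measurable_continuous_onI)
    have "integrable (?L \<Otimes>\<^sub>M ?N) (\<lambda>p. B * (case p of (t, x) \<Rightarrow> indicator ?K x *\<^sub>R h t x))"
      using hi by simp
    then have int: "integrable (?L \<Otimes>\<^sub>M ?N) (\<lambda>(s, x). if t < s then h s x * \<psi> x else 0)"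
    proof (rule Bochner_Integration.integrable_bound)
      show "AE p in ?L \<Otimes>\<^sub>M ?N. norm (case p of (s, x) \<Rightarrow> if t < s then h s x * \<psi> x else 0)
          \<le> norm (B * (case p of (t, x) \<Rightarrow> indicator ?K x *\<^sub>R h t x))"
      proof (rule AE_I2, clarify)
        fix s x
        show "norm (if t < s then h s x * \<psi> x else 0) \<le> norm (B * (indicator ?K x *\<^sub>R h s x))"
        proof (cases "x \<in> ?K")
          case True
          then show ?thesis using mult_left_mono[OF B(2)[of x], of "\<bar>h s x\<bar>"] B(1)
            by (simp add: abs_mult mult.commute[of B])
        next
          case False
          then show ?thesis using \<psi>(2) by simp
        qed
      qed
    qed measurable
    have "(LINT x|?N. tail T h t x * \<psi> x) = (LINT x|?N. LINT s|?L. (if t < s then h s x else 0) * \<psi> x)"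
      unfolding tail_def by simp
    also have "\<dots> = (LINT x|?N. LINT s|?L. (if t < s then h s x * \<psi> x else 0))"
      by (intro Bochner_Integration.integral_cong) auto
    also have "\<dots> = (LINT s|?L. LINT x|?N. (if t < s then h s x * \<psi> x else 0))"
      by (rule P.Fubini_integral[OF int])
    also have "\<dots> = (LINT s|?L. (if t < s then (LINT x|?N. h s x * \<psi> x) else 0))"
      by (intro Bochner_Integration.integral_cong) auto
    finally show ?thesis .
  qed
  have 1: "(LINT x|?N. tail T f t x * frechet_derivative \<phi> (at x) i) =
     (LINT s|?L. (if t < s then (LINT x|?N. f s x * frechet_derivative \<phi> (at x) i) else 0))"
    by (rule swap[OF fm fi[OF Cc_infty_compact[OF \<phi>] Cc_infty_subset[OF \<phi>]]
          Cc_infty_continuous_deriv[OF \<phi> i] Cc_infty_deriv_outside[OF \<phi>]])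
  have Gim: "(\<lambda>(t, x). G t x \<bullet> i) \<in> borel_measurable (?L \<Otimes>\<^sub>M ?N)" by measurable
  have Gii: "integrable (?L \<Otimes>\<^sub>M ?N) (\<lambda>(t, x). indicator ?K x *\<^sub>R (G t x \<bullet> i))"
    using integrable_inner_left[OF Gi[OF Cc_infty_compact[OF \<phi>] Cc_infty_subset[OF \<phi>]], of i]
    by (simp add: case_prod_unfold)
  have 2: "(LINT x|?N. tail T (\<lambda>s x. G s x \<bullet> i) t x * \<phi> x) =
     (LINT s|?L. (if t < s then (LINT x|?N. (G s x \<bullet> i) * \<phi> x) else 0))"
    by (rule swap[OF Gim Gii Cc_infty_continuous[OF \<phi>] Cc_infty_outside[OF \<phi>]])
  have Gslice: "AE x in ?N. x \<in> ?K \<longrightarrow> tail T G t x \<bullet> i = tail T (\<lambda>s x. G s x \<bullet> i) t x"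
    using P.AE_integrable_snd[OF Gi[OF Cc_infty_compact[OF \<phi>] Cc_infty_subset[OF \<phi>]]]
  proof eventually_elim
    case (elim x)
    show ?case
    proof
      assume "x \<in> ?K"
      with elim have "integrable ?L (\<lambda>s. G s x)" by simp
      from integral_inner_left[OF integrable_time_if[OF this, of t], of i]
      have "(LINT s|?L. (if t < s then G s x else 0) \<bullet> i) = tail T G t x \<bullet> i"
        by (simp add: tail_def)
      then show "tail T G t x \<bullet> i = tail T (\<lambda>s x. G s x \<bullet> i) t x"
        unfolding tail_def by (simp add: if_distrib[of "\<lambda>v. v \<bullet> i"] cong: if_cong)
    qed
  qed
  have [measurable]: "\<phi> \<in> borel_measurable ?N"
    using Cc_infty_continuous[OF \<phi>]
    by (intro measurable_restrict_space1 measurable_completion) (simp add: borel_measurable_continuous_onI)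
  note tail_measurable[OF Gm, measurable] tail_measurable[OF Gim, measurable]
  have 3: "(LINT x|?N. (tail T G t x \<bullet> i) * \<phi> x) = (LINT x|?N. tail T (\<lambda>s x. G s x \<bullet> i) t x * \<phi> x)"
  proof (rule integral_cong_AE)
    show "AE x in ?N. (tail T G t x \<bullet> i) * \<phi> x = tail T (\<lambda>s x. G s x \<bullet> i) t x * \<phi> x"
      using Gslice
    proof eventually_elim
      case (elim x)
      show ?case
      proof (cases "x \<in> ?K")
        case True
        with elim show ?thesis by simp
      next
        case False
        from Cc_infty_outside[OF \<phi> this] show ?thesis by simp
      qed
    qed
  qed measurable
  have 4: "(LINT s|?L. (if t < s then (LINT x|?N. f s x * frechet_derivative \<phi> (at x) i) else 0)) =
      (LINT s|?L. - (if t < s then (LINT x|?N. (G s x \<bullet> i) * \<phi> x) else 0))"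
  proof (rule integral_cong_AE)
    have [measurable]: "(\<lambda>x. frechet_derivative \<phi> (at x) i) \<in> borel_measurable ?N"
      using Cc_infty_continuous_deriv[OF \<phi> i]
      by (intro measurable_restrict_space1 measurable_completion) (simp add: borel_measurable_continuous_onI)
    have "(\<lambda>s. LINT x|?N. f s x * frechet_derivative \<phi> (at x) i) \<in> borel_measurable ?L"
      by measurable
    then show "(\<lambda>s. if t < s then (LINT x|?N. f s x * frechet_derivative \<phi> (at x) i) else 0) \<in> borel_measurable ?L"
      by (rule measurable_time_if)
    have "(\<lambda>s. LINT x|?N. (G s x \<bullet> i) * \<phi> x) \<in> borel_measurable ?L"
      by measurable
    then have "(\<lambda>s. if t < s then (LINT x|?N. (G s x \<bullet> i) * \<phi> x) else 0) \<in> borel_measurable ?L"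
      by (rule measurable_time_if)
    then show "(\<lambda>s. - (if t < s then (LINT x|?N. (G s x \<bullet> i) * \<phi> x) else 0)) \<in> borel_measurable ?L"
      by (rule borel_measurable_uminus)
    show "AE s in ?L. (if t < s then (LINT x|?N. f s x * frechet_derivative \<phi> (at x) i) else 0) =
        - (if t < s then (LINT x|?N. (G s x \<bullet> i) * \<phi> x) else 0)"
      using wg
    proof eventually_elim
      case (elim s)
      then show ?case using \<phi> i by (simp add: weak_gradient_def)
    qed
  qed
  show "(LINT x|?N. tail T f t x * frechet_derivative \<phi> (at x) i) = - (LINT x|?N. (tail T G t x \<bullet> i) * \<phi> x)"
    unfolding 1 3 2 4 by simp
qed

section \<open>Weighted spaces and admissibility of tail integrals\<close>

lemma sets_weighted[measurable_cong]: "sets (weighted \<Omega> \<rho>) = sets (lebesgue_on \<Omega>)"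
  by (simp add: weighted_def)

lemma sigma_finite_weighted:
  assumes "\<Omega> \<in> sets lebesgue" "\<rho> \<in> borel_measurable (lebesgue_on \<Omega>)"
  shows "sigma_finite_measure (weighted \<Omega> \<rho>)"
proof -
  interpret sigma_finite_measure "lebesgue_on \<Omega>" by (rule sigma_finite_lebesgue_on[OF assms(1)])
  show ?thesis
    unfolding weighted_def using assms(2) by (subst sigma_finite_iff_density_finite) auto
qed

lemma borel_measurable_pair_weighted:
  "borel_measurable (L \<Otimes>\<^sub>M weighted \<Omega> \<rho>) = borel_measurable (L \<Otimes>\<^sub>M lebesgue_on \<Omega>)"
  by (intro measurable_cong_sets sets_pair_measure_cong sets_weighted refl)

lemma pair_weighted:
  assumes "\<Omega> \<in> sets lebesgue" "\<rho> \<in> borel_measurable (lebesgue_on \<Omega>)"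
  shows "L \<Otimes>\<^sub>M weighted \<Omega> \<rho> = density (L \<Otimes>\<^sub>M lebesgue_on \<Omega>) (\<lambda>(t, x). ennreal (\<rho> x))"
proof -
  have "density L (\<lambda>_. 1) \<Otimes>\<^sub>M density (lebesgue_on \<Omega>) (\<lambda>x. ennreal (\<rho> x)) =
      density (L \<Otimes>\<^sub>M lebesgue_on \<Omega>) (\<lambda>(t, x). 1 * ennreal (\<rho> x))"
    by (rule pair_measure_density)
       (use assms(2) sigma_finite_lebesgue_on[OF assms(1)] sigma_finite_weighted[OF assms] in \<open>auto simp: weighted_def\<close>)
  then show ?thesis by (simp add: density_1 weighted_def)
qed

lemma AE_pair_snd:
  assumes "sigma_finite_measure L" "sigma_finite_measure M" and P: "AE x in M. P x"
  shows "AE p in L \<Otimes>\<^sub>M M. P (snd p)"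
proof -
  interpret L: sigma_finite_measure L by fact
  interpret M: sigma_finite_measure M by fact
  interpret pair_sigma_finite L M ..
  from P obtain N where N: "N \<in> null_sets M" "{x \<in> space M. \<not> P x} \<subseteq> N" by (auto simp: eventually_ae_filter)
  have "AE p in L \<Otimes>\<^sub>M M. snd p \<notin> N"
  proof (rule AE_pair_measure)
    have "{p \<in> space (L \<Otimes>\<^sub>M M). snd p \<notin> N} = space L \<times> (space M - N)" by (auto simp: space_pair_measure)
    then show "{p \<in> space (L \<Otimes>\<^sub>M M). snd p \<notin> N} \<in> sets (L \<Otimes>\<^sub>M M)" using N(1) by auto
    show "AE t in L. AE x in M. snd (t, x) \<notin> N" using AE_not_in[OF N(1)] by simp
  qed
  then show ?thesis using AE_space
    by eventually_elim (use N(2) in \<open>auto simp: space_pair_measure\<close>)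
qed

lemma integrable_indicator_compact:
  assumes "compact K" "K \<subseteq> \<Omega>" "\<Omega> \<in> sets lebesgue"
  shows "integrable (lebesgue_on \<Omega>) (\<lambda>x. c * indicator K x :: real)"
proof -
  have Km: "K \<in> lmeasurable" using assms by (simp add: lmeasurable_compact)
  have "emeasure (lebesgue_on \<Omega>) K = emeasure lebesgue K"
    using assms by (intro emeasure_restrict_space) auto
  also have "\<dots> < \<infinity>" using Km by (auto simp: fmeasurable_def)
  finally have "emeasure (lebesgue_on \<Omega>) K < \<infinity>" .
  moreover have "K \<in> sets (lebesgue_on \<Omega>)"
    using Km assms by (simp add: sets_restrict_space_iff fmeasurableD)
  ultimately show ?thesis by (intro integrable_mult_right integrable_real_indicator)
qed

lemma bounded_loc_integrable_pair:
  fixes f :: "real \<Rightarrow> 'a::euclidean_space \<Rightarrow> real"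
  assumes \<Omega>: "\<Omega> \<in> sets lebesgue" and K: "compact K" "K \<subseteq> \<Omega>"
    and fm[measurable]: "(\<lambda>(t, x). f t x) \<in> borel_measurable (lebesgue_on {0<..<T} \<Otimes>\<^sub>M lebesgue_on \<Omega>)"
    and b: "\<And>t x. \<bar>f t x\<bar> \<le> C"
  shows "integrable (lebesgue_on {0<..<T} \<Otimes>\<^sub>M lebesgue_on \<Omega>) (\<lambda>(t, x). indicator K x *\<^sub>R f t x)"
proof -
  have [measurable]: "K \<in> sets (lebesgue_on \<Omega>)"
    using K \<Omega> by (simp add: sets_restrict_space_iff lmeasurable_compact fmeasurableD)
  have "integrable (lebesgue_on {0<..<T} \<Otimes>\<^sub>M lebesgue_on \<Omega>) (\<lambda>(t, x). C * indicator K x :: real)"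
    by (rule integrable_pair_snd[OF finite_measure_time sigma_finite_lebesgue_on[OF \<Omega>]
          integrable_indicator_compact[OF K \<Omega>]])
  then show ?thesis
    by (rule Bochner_Integration.integrable_bound)
       (use order_trans[OF b abs_ge_self] in \<open>auto simp: indicator_def\<close>)
qed

text \<open>
  Local integrability of \<open>1/\<rho>\<close> makes the weighted \<open>L\<^sup>2\<close> space embed into \<open>L\<^sup>1\<^sub>l\<^sub>o\<^sub>c\<close>, because
  \<open>\<bar>G\<bar> \<le> \<bar>G\<bar>\<^sup>2 \<rho> + 1/\<rho>\<close>.
\<close>

lemma weighted_L2_loc_integrable_pair:
  fixes G :: "real \<Rightarrow> 'a::euclidean_space \<Rightarrow> 'c::euclidean_space"
  assumes \<Omega>: "\<Omega> \<in> sets lebesgue" and K: "compact K" "K \<subseteq> \<Omega>"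
    and \<rho>[measurable]: "\<rho> \<in> borel_measurable (lebesgue_on \<Omega>)" and pos: "AE x in lebesgue_on \<Omega>. \<rho> x > 0"
    and inv: "loc_integrable \<Omega> (\<lambda>x. inverse (\<rho> x))"
    and G: "in_LpLp 2 T (weighted \<Omega> \<rho>) G"
  shows "integrable (lebesgue_on {0<..<T} \<Otimes>\<^sub>M lebesgue_on \<Omega>) (\<lambda>(t, x). indicator K x *\<^sub>R G t x)"
proof -
  let ?L = "lebesgue_on {0<..<T}" and ?N = "lebesgue_on \<Omega>"
  have sfL: "sigma_finite_measure ?L" by (rule sigma_finite_lebesgue_on) simp
  have sfN: "sigma_finite_measure ?N" by (rule sigma_finite_lebesgue_on[OF \<Omega>])
  have Gm[measurable]: "(\<lambda>(t, x). G t x) \<in> borel_measurable (?L \<Otimes>\<^sub>M ?N)"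
    using G by (simp add: in_LpLp_2_iff borel_measurable_pair_weighted)
  have Km: "K \<in> sets lebesgue" using K(1) by (simp add: lmeasurable_compact fmeasurableD)
  have [measurable]: "K \<in> sets ?N" using Km K \<Omega> by (simp add: sets_restrict_space_iff)
  have posP: "AE p in ?L \<Otimes>\<^sub>M ?N. \<rho> (snd p) > 0" by (rule AE_pair_snd[OF sfL sfN pos])
  have "integrable (density (?L \<Otimes>\<^sub>M ?N) (\<lambda>p. ennreal (\<rho> (snd p)))) (\<lambda>(t, x). (norm (G t x))\<^sup>2)"
    using G by (simp add: in_LpLp_2_iff pair_weighted[OF \<Omega> \<rho>] case_prod_unfold)
  then have i1: "integrable (?L \<Otimes>\<^sub>M ?N) (\<lambda>p. \<rho> (snd p) *\<^sub>R (case p of (t, x) \<Rightarrow> (norm (G t x))\<^sup>2))"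
    by (rule integrable_density[THEN iffD1, rotated 3]) (use posP in \<open>auto elim: eventually_mono\<close>)
  have "integrable lebesgue (\<lambda>x. indicator K x *\<^sub>R inverse (\<rho> x))"
    using inv K Km by (subst integrable_restrict_space[symmetric]) (auto simp: loc_integrable_def)
  also have "(\<lambda>x. indicator K x *\<^sub>R inverse (\<rho> x)) = (\<lambda>x. indicator \<Omega> x *\<^sub>R (indicator K x * inverse (\<rho> x)))"
    using K(2) by (auto simp: indicator_def fun_eq_iff)
  finally have "integrable ?N (\<lambda>x. indicator K x * inverse (\<rho> x))"
    using \<Omega> by (subst integrable_restrict_space) auto
  then have i2: "integrable (?L \<Otimes>\<^sub>M ?N) (\<lambda>(t, x). indicator K x * inverse (\<rho> x))"
    by (rule integrable_pair_snd[OF finite_measure_time sfN])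
  have "integrable (?L \<Otimes>\<^sub>M ?N) (\<lambda>p. \<rho> (snd p) *\<^sub>R (case p of (t, x) \<Rightarrow> (norm (G t x))\<^sup>2) +
      (case p of (t, x) \<Rightarrow> indicator K x * inverse (\<rho> x)))"
    using i1 i2 by (rule Bochner_Integration.integrable_add)
  then show ?thesis
  proof (rule Bochner_Integration.integrable_bound)
    show "AE p in ?L \<Otimes>\<^sub>M ?N. norm (case p of (t, x) \<Rightarrow> indicator K x *\<^sub>R G t x) \<le>
        norm (\<rho> (snd p) *\<^sub>R (case p of (t, x) \<Rightarrow> (norm (G t x))\<^sup>2) + (case p of (t, x) \<Rightarrow> indicator K x * inverse (\<rho> x)))"
      using posP
    proof eventually_elim
      case (elim p)
      obtain t x where p: "p = (t, x)" by (cases p)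
      have r: "\<rho> x > 0" using elim p by simp
      have "2 * norm (G t x) \<le> \<rho> x * (norm (G t x))\<^sup>2 + inverse (\<rho> x)"
      proof -
        have "0 \<le> (\<rho> x * norm (G t x) - 1)\<^sup>2 / \<rho> x" using r by simp
        also have "\<dots> = \<rho> x * (norm (G t x))\<^sup>2 + inverse (\<rho> x) - 2 * norm (G t x)"
          using r by (simp add: power2_eq_square field_simps)
        finally show ?thesis by simp
      qed
      then have "norm (G t x) \<le> \<rho> x * (norm (G t x))\<^sup>2 + inverse (\<rho> x)"
        using norm_ge_zero[of "G t x"] by linarith
      then show ?case using r by (auto simp: p indicator_def)
    qed
  qed measurable
qed

text \<open>
  The time derivative of the tail integral of \<open>f\<close> is \<open>-f\<close>, its gradient is the tail integral of the
  gradient of \<open>f\<close>, and it vanishes at \<open>T\<close>.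
  Boundedness of \<open>f\<close> and integrability of \<open>1/\<rho>\<mu>\<close> on compact sets provide the local integrability that the weak
  gradient presupposes.
\<close>

lemma test_function_tail:
  fixes f :: "real \<Rightarrow> 'a::euclidean_space \<Rightarrow> real"
  assumes \<Omega>: "\<Omega> \<in> sets lebesgue" and T: "T > 0"
    and \<rho>: "\<rho>\<nu> \<in> borel_measurable (lebesgue_on \<Omega>)" "\<rho>\<mu> \<in> borel_measurable (lebesgue_on \<Omega>)"
    and pos: "AE x in lebesgue_on \<Omega>. \<rho>\<mu> x > 0" and inv: "loc_integrable \<Omega> (\<lambda>x. inverse (\<rho>\<mu> x))"
    and f: "in_LpLp 2 T (weighted \<Omega> \<rho>\<nu>) f" "\<And>t x. \<bar>f t x\<bar> \<le> C"
    and G: "in_LpLp 2 T (weighted \<Omega> \<rho>\<mu>) G"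
    and wg: "AE t in lebesgue_on {0<..<T}. weak_gradient \<Omega> (f t) (G t)"
  shows "test_function \<Omega> \<rho>\<nu> \<rho>\<mu> T (tail T f) (\<lambda>t x. - f t x) (tail T G)"
  unfolding test_function_def
proof (intro conjI)
  note sf = sigma_finite_weighted[OF \<Omega> \<rho>(1)] sigma_finite_weighted[OF \<Omega> \<rho>(2)]
  show "W12_time T (weighted \<Omega> \<rho>\<nu>) (tail T f) (\<lambda>t x. - f t x)" by (rule tail_W12_time[OF f(1) sf(1) T])
  show "L2_continuous T (weighted \<Omega> \<rho>\<nu>) (tail T f)" by (rule tail_L2_continuous[OF f(1) sf(1)])
  show "in_LpLp 2 T (weighted \<Omega> \<rho>\<mu>) (tail T G)" by (rule tail_in_LpLp[OF G sf(2)])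
  show "AE x in weighted \<Omega> \<rho>\<nu>. tail T f T x = 0" by (simp add: tail_at_end)
  have fm: "(\<lambda>(t, x). f t x) \<in> borel_measurable (lebesgue_on {0<..<T} \<Otimes>\<^sub>M lebesgue_on \<Omega>)"
    and Gm: "(\<lambda>(t, x). G t x) \<in> borel_measurable (lebesgue_on {0<..<T} \<Otimes>\<^sub>M lebesgue_on \<Omega>)"
    using f(1) G by (simp_all add: in_LpLp_2_iff borel_measurable_pair_weighted)
  have "weak_gradient \<Omega> (tail T f t) (tail T G t)" for t
    by (rule weak_gradient_tail[OF \<Omega> fm Gm bounded_loc_integrable_pair[OF \<Omega> _ _ fm f(2)]
          weighted_L2_loc_integrable_pair[OF \<Omega> _ _ \<rho>(2) pos inv G] wg])
  then show "AE t in lebesgue_on {0<..<T}. weak_gradient \<Omega> (tail T f t) (tail T G t)" by simp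
qed

section \<open>Truncation and signed powers\<close>

text \<open>
  A smooth bounded substitute for the truncation of \<open>s\<close> at height \<open>sqrt n\<close>. Besides boundedness it
  has the two properties that the limit \<open>n \<rightarrow> \<infinity>\<close> relies on: \<open>\<bar>trunc n s\<bar>\<close> increases
  with \<open>n\<close>, and the derivative \<open>trunc' n s\<close> tends to \<open>1\<close> with values in \<open>(0, 1]\<close>.
\<close>

definition trunc :: "real \<Rightarrow> real \<Rightarrow> real" where
  "trunc n s = s / sqrt (1 + s\<^sup>2 / n)"

definition trunc' :: "real \<Rightarrow> real \<Rightarrow> real" where
  "trunc' n s = 1 / ((1 + s\<^sup>2 / n) * sqrt (1 + s\<^sup>2 / n))"

lemma trunc_denominator:
  fixes n s :: real
  assumes "n > 0" shows "1 + s\<^sup>2 / n \<ge> 1" "1 + s\<^sup>2 / n > 0" "sqrt (1 + s\<^sup>2 / n) \<ge> 1"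
proof -
  show 1: "1 + s\<^sup>2 / n \<ge> 1" using assms by simp
  then show "1 + s\<^sup>2 / n > 0" by linarith
  show "sqrt (1 + s\<^sup>2 / n) \<ge> 1" using 1 by simp
qed

lemma trunc_has_derivative:
  assumes n: "n > 0"
  shows "(trunc n has_real_derivative trunc' n s) (at s)"
proof -
  let ?q = "1 + s\<^sup>2 / n"
  have q: "?q > 0" by (rule trunc_denominator(2)[OF n])
  have "((\<lambda>s. s / sqrt (1 + s\<^sup>2 / n)) has_real_derivative
      (1 * sqrt ?q - s * (inverse (sqrt ?q) / 2 * (0 + (2 * s) / n))) / (sqrt ?q * sqrt ?q)) (at s)"
    using q n by (auto intro!: derivative_eq_intros)
  also have "(1 * sqrt ?q - s * (inverse (sqrt ?q) / 2 * (0 + (2 * s) / n))) / (sqrt ?q * sqrt ?q) = trunc' n s"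
  proof -
    have eq: "1 * r - s * (inverse r / 2 * (0 + (2 * s) / n)) = (r * r - s\<^sup>2 / n) / r" if "r > 0" for r
      using that n by (simp add: field_simps power2_eq_square)
    have "1 * sqrt ?q - s * (inverse (sqrt ?q) / 2 * (0 + (2 * s) / n)) = (sqrt ?q * sqrt ?q - s\<^sup>2 / n) / sqrt ?q"
      using q by (intro eq) simp
    also have "\<dots> = 1 / sqrt ?q" using q by simp
    finally show ?thesis unfolding trunc'_def using q by simp
  qed
  finally show ?thesis by (simp add: trunc_def[abs_def])
qed

lemma trunc'_bounds: "n > 0 \<Longrightarrow> 0 < trunc' n s \<and> trunc' n s \<le> 1"
  unfolding trunc'_def using trunc_denominator[of n s]
  by (auto intro!: divide_pos_pos mult_pos_pos simp: divide_le_eq_1 mult_le_one)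
     (use mult_mono[of 1 "1 + s\<^sup>2 / n" 1 "sqrt (1 + s\<^sup>2 / n)"] in simp)

lemma trunc'_continuous:
  assumes "n > 0" shows "continuous_on UNIV (trunc' n)"
proof -
  have "(1 + s\<^sup>2 / n) * sqrt (1 + s\<^sup>2 / n) \<noteq> 0" for s
    using trunc_denominator[OF assms, of s] by auto
  then show ?thesis
    unfolding trunc'_def[abs_def] using assms by (intro continuous_intros) auto
qed

lemma trunc_bounds:
  assumes "n > 0"
  shows trunc_le_self: "\<bar>trunc n s\<bar> \<le> \<bar>s\<bar>" and trunc_le_sqrt: "\<bar>trunc n s\<bar> \<le> sqrt n"
proof -
  note q = trunc_denominator[OF assms, of s]
  have "\<bar>trunc n s\<bar> = \<bar>s\<bar> / sqrt (1 + s\<^sup>2 / n)" using q by (simp add: trunc_def)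
  also have "\<dots> \<le> \<bar>s\<bar> / 1" using q(3) by (intro divide_left_mono) auto
  finally show "\<bar>trunc n s\<bar> \<le> \<bar>s\<bar>" by simp
  have "(trunc n s)\<^sup>2 = s\<^sup>2 / (1 + s\<^sup>2 / n)" using q by (simp add: trunc_def power_divide)
  also have "\<dots> \<le> n" using q assms by (simp add: divide_le_eq distrib_left)
  finally have "sqrt ((trunc n s)\<^sup>2) \<le> sqrt n" by (rule real_sqrt_le_mono)
  then show "\<bar>trunc n s\<bar> \<le> sqrt n" by simp
qed

text \<open>
  For \<open>\<bar>s\<bar> \<le> 1\<close> the bound by \<open>s\<^sup>2\<close> is used, for \<open>\<bar>s\<bar> > 1\<close> the bound by \<open>n\<close>. This is what turns the
  integrability of \<open>\<bar>w\<bar>\<^sup>p\<close> with some \<open>p < 2\<close> into the square integrability that a test function needs.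
\<close>

lemma trunc_square_le:
  assumes n: "n \<ge> 1" and p: "0 < p" "p \<le> 2"
  shows "(trunc n s)\<^sup>2 \<le> n * \<bar>s\<bar> powr p"
proof (cases "\<bar>s\<bar> \<le> 1")
  case True
  have "(trunc n s)\<^sup>2 \<le> s\<^sup>2" using trunc_le_self[of n s] n by (simp add: abs_le_square_iff)
  also have "s\<^sup>2 \<le> \<bar>s\<bar> powr p"
  proof (cases "s = 0")
    case False
    then have "\<bar>s\<bar> powr 2 \<le> \<bar>s\<bar> powr p" using True p by (intro powr_mono') auto
    then show ?thesis by simp
  qed simp
  also have "\<dots> \<le> n * \<bar>s\<bar> powr p" using n by (simp add: mult_le_cancel_right1)
  finally show ?thesis .
next
  case False
  have "(trunc n s)\<^sup>2 \<le> (sqrt n)\<^sup>2"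
    using trunc_le_sqrt[of n s] n by (subst abs_le_square_iff[symmetric]) simp
  also have "\<dots> = n * 1" using n by simp
  also have "\<dots> \<le> n * \<bar>s\<bar> powr p" using False n p by (intro mult_left_mono ge_one_powr_ge_zero) auto
  finally show ?thesis .
qed

lemma trunc_mono_level:
  assumes n: "n \<ge> 1" and ds: "0 \<le> d * s"
  shows "0 \<le> d * trunc 1 s" "d * trunc 1 s \<le> d * trunc n s"
proof -
  have n0: "n > 0" using n by simp
  have "s\<^sup>2 / n \<le> s\<^sup>2 / 1" using n by (intro divide_left_mono) auto
  then have "sqrt (1 + s\<^sup>2 / n) \<le> sqrt (1 + s\<^sup>2 / 1)" by simp
  moreover have "sqrt (1 + s\<^sup>2 / n) > 0" "sqrt (1 + s\<^sup>2 / 1) > 0"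
    using trunc_denominator(3)[OF n0, of s] trunc_denominator(3)[of 1 s] by linarith+
  ultimately show "d * trunc 1 s \<le> d * trunc n s"
    using ds by (simp add: trunc_def divide_left_mono)
  show "0 \<le> d * trunc 1 s" using ds by (simp add: trunc_def)
qed

lemma trunc_eq_0: "n > 0 \<Longrightarrow> trunc n s = 0 \<Longrightarrow> s = 0"
  using trunc_denominator(2)[of n s] by (auto simp: trunc_def)

lemma trunc'_tendsto: "(\<lambda>n. trunc' (real (Suc n)) s) \<longlonglongrightarrow> 1"
proof -
  have "(\<lambda>n. s\<^sup>2 * inverse (real (Suc n))) \<longlonglongrightarrow> s\<^sup>2 * 0"
    by (intro tendsto_intros LIMSEQ_inverse_real_of_nat)
  then have "(\<lambda>n. s\<^sup>2 / real (Suc n)) \<longlonglongrightarrow> 0" by (simp add: divide_inverse)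
  then have "(\<lambda>n. 1 / ((1 + s\<^sup>2 / real (Suc n)) * sqrt (1 + s\<^sup>2 / real (Suc n)))) \<longlonglongrightarrow> 1 / ((1 + 0) * sqrt (1 + 0))"
    by (intro tendsto_intros) auto
  then show ?thesis by (simp add: trunc'_def del: of_nat_Suc)
qed

lemma spow_strict_mono:
  assumes m: "m > 0" and ab: "a < b"
  shows "spow a m < spow b m"
proof -
  consider "0 \<le> a" | "a < 0" "b \<le> 0" | "a < 0" "0 < b" by linarith
  then show ?thesis
  proof cases
    case 1
    then have "a powr m < b powr m" using ab m by (intro powr_less_mono2) auto
    then show ?thesis using 1 ab by (auto simp: spow_def sgn_if)
  next
    case 2
    then have "(- b) powr m < (- a) powr m" using ab m by (intro powr_less_mono2) auto
    then show ?thesis using 2 ab by (auto simp: spow_def sgn_if)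
  next
    case 3
    then have "(- a) powr m > 0" "b powr m > 0" by auto
    then have "- ((- a) powr m) < b powr m" by linarith
    then show ?thesis using 3 by (auto simp: spow_def sgn_if)
  qed
qed

lemma spow_diff_sign:
  assumes m: "m > 0"
  shows "0 \<le> (a - b) * (spow a m - spow b m)" and "spow a m = spow b m \<Longrightarrow> a = b"
proof -
  show "0 \<le> (a - b) * (spow a m - spow b m)"
    using spow_strict_mono[OF m, of a b] spow_strict_mono[OF m, of b a]
    by (cases a b rule: linorder_cases) (auto intro: mult_nonneg_nonneg mult_nonpos_nonpos)
  show "spow a m = spow b m \<Longrightarrow> a = b"
    using spow_strict_mono[OF m, of a b] spow_strict_mono[OF m, of b a]
    by (cases a b rule: linorder_cases) auto
qed

lemma spow_measurable[measurable]: "(\<lambda>x. spow x m) \<in> borel_measurable borel"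
  unfolding spow_def by measurable

text \<open>
  The exponent \<open>(m + 1)/m\<close> is the conjugate of \<open>m + 1\<close>: it is the integrability that \<open>u\<^sup>m - v\<^sup>m\<close> inherits
  from \<open>u, v \<in> L\<^sup>m\<^sup>+\<^sup>1\<close>.
\<close>

lemma spow_diff_powr_le:
  assumes m: "m > 1"
  shows "\<bar>spow a m - spow b m\<bar> powr ((m + 1) / m) \<le> 4 * (\<bar>a\<bar> powr (m + 1) + \<bar>b\<bar> powr (m + 1))"
proof -
  define M where "M = max \<bar>a\<bar> \<bar>b\<bar>"
  have abs_spow: "\<bar>spow c m\<bar> \<le> M powr m" if "\<bar>c\<bar> \<le> M" for c
  proof -
    have "\<bar>spow c m\<bar> \<le> \<bar>c\<bar> powr m" by (auto simp: spow_def abs_mult sgn_if)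
    also have "\<dots> \<le> M powr m" using that m by (intro powr_mono2) auto
    finally show ?thesis .
  qed
  have "\<bar>spow a m - spow b m\<bar> \<le> 2 * M powr m"
    using abs_spow[of a] abs_spow[of b] abs_triangle_ineq4[of "spow a m" "spow b m"]
    by (simp add: M_def)
  then have "\<bar>spow a m - spow b m\<bar> powr ((m + 1) / m) \<le> (2 * M powr m) powr ((m + 1) / m)"
    using m by (intro powr_mono2) auto
  also have "\<dots> = 2 powr ((m + 1) / m) * M powr (m + 1)"
    using m by (simp add: powr_mult powr_powr)
  also have "\<dots> \<le> 4 * M powr (m + 1)"
  proof (rule mult_right_mono)
    have "2 powr ((m + 1) / m) \<le> 2 powr (2::real)" using m by (intro powr_mono) (auto simp: field_simps)
    then show "2 powr ((m + 1) / m) \<le> (4::real)" by simp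
  qed simp
  also have "M powr (m + 1) \<le> \<bar>a\<bar> powr (m + 1) + \<bar>b\<bar> powr (m + 1)"
    by (auto simp: M_def max_def)
  finally show ?thesis by simp
qed

section \<open>The energy term and its limit\<close>

lemma in_LpLp_2_bound:
  fixes f :: "real \<Rightarrow> 'a \<Rightarrow> 'c::euclidean_space" and h :: "real \<Rightarrow> 'a \<Rightarrow> 'd::euclidean_space"
  assumes h: "in_LpLp 2 T M h" and fm[measurable]: "(\<lambda>(t, x). f t x) \<in> borel_measurable (lebesgue_on {0<..<T} \<Otimes>\<^sub>M M)"
    and le: "\<And>t x. norm (f t x) \<le> norm (h t x)"
  shows "in_LpLp 2 T M f"
proof -
  have hi: "integrable (lebesgue_on {0<..<T} \<Otimes>\<^sub>M M) (\<lambda>(t, x). (norm (h t x))\<^sup>2)"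
    using h by (simp add: in_LpLp_2_iff)
  have "integrable (lebesgue_on {0<..<T} \<Otimes>\<^sub>M M) (\<lambda>(t, x). (norm (f t x))\<^sup>2)"
    by (rule Bochner_Integration.integrable_bound[OF hi]) (auto intro!: AE_I2 power_mono le)
  then show ?thesis using fm by (simp add: in_LpLp_2_iff)
qed

lemma in_LpLp_2_diff:
  fixes f h :: "real \<Rightarrow> 'a \<Rightarrow> 'c::euclidean_space"
  assumes f: "in_LpLp 2 T M f" and h: "in_LpLp 2 T M h"
  shows "in_LpLp 2 T M (\<lambda>t x. f t x - h t x)"
proof -
  let ?P = "lebesgue_on {0<..<T} \<Otimes>\<^sub>M M"
  have m[measurable]: "(\<lambda>(t, x). f t x) \<in> borel_measurable ?P" "(\<lambda>(t, x). h t x) \<in> borel_measurable ?P"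
    and i: "integrable ?P (\<lambda>(t, x). (norm (f t x))\<^sup>2)" "integrable ?P (\<lambda>(t, x). (norm (h t x))\<^sup>2)"
    using f h by (auto simp: in_LpLp_2_iff)
  have dm: "(\<lambda>(t, x). f t x - h t x) \<in> borel_measurable ?P" by measurable
  have "integrable ?P (\<lambda>p. 2 * (case p of (t, x) \<Rightarrow> (norm (f t x))\<^sup>2) + 2 * (case p of (t, x) \<Rightarrow> (norm (h t x))\<^sup>2))"
    using i by auto
  then have "integrable ?P (\<lambda>(t, x). (norm (f t x - h t x))\<^sup>2)"
  proof (rule Bochner_Integration.integrable_bound)
    show "AE p in ?P. norm (case p of (t, x) \<Rightarrow> (norm (f t x - h t x))\<^sup>2) \<le>
        norm (2 * (case p of (t, x) \<Rightarrow> (norm (f t x))\<^sup>2) + 2 * (case p of (t, x) \<Rightarrow> (norm (h t x))\<^sup>2))"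
    proof (rule AE_I2, clarify)
      fix t x
      have "(norm (f t x - h t x))\<^sup>2 \<le> (norm (f t x) + norm (h t x))\<^sup>2"
        by (intro power_mono norm_triangle_ineq4) simp
      also have "\<dots> \<le> 2 * (norm (f t x))\<^sup>2 + 2 * (norm (h t x))\<^sup>2"
        using zero_le_power2[of "norm (f t x) - norm (h t x)"] by (simp add: power2_eq_square algebra_simps)
      finally show "norm ((norm (f t x - h t x))\<^sup>2) \<le> norm (2 * (norm (f t x))\<^sup>2 + 2 * (norm (h t x))\<^sup>2)" by simp
    qed
  qed (use dm in measurable)
  then show ?thesis using dm by (simp add: in_LpLp_2_iff)
qed

lemma in_LpLp_2_inner_integrable:
  fixes f h :: "real \<Rightarrow> 'a \<Rightarrow> 'c::euclidean_space"
  assumes f: "in_LpLp 2 T M f" and h: "in_LpLp 2 T M h"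
  shows "integrable (lebesgue_on {0<..<T} \<Otimes>\<^sub>M M) (\<lambda>(t, x). f t x \<bullet> h t x)"
    and "integrable (lebesgue_on {0<..<T} \<Otimes>\<^sub>M M) (\<lambda>(t, x). norm (f t x) * norm (h t x))"
proof -
  let ?P = "lebesgue_on {0<..<T} \<Otimes>\<^sub>M M"
  have m[measurable]: "(\<lambda>(t, x). f t x) \<in> borel_measurable ?P" "(\<lambda>(t, x). h t x) \<in> borel_measurable ?P"
    and i: "integrable ?P (\<lambda>(t, x). (norm (f t x))\<^sup>2)" "integrable ?P (\<lambda>(t, x). (norm (h t x))\<^sup>2)"
    using f h by (auto simp: in_LpLp_2_iff)
  have "integrable ?P (\<lambda>p. (case p of (t, x) \<Rightarrow> (norm (f t x))\<^sup>2) + (case p of (t, x) \<Rightarrow> (norm (h t x))\<^sup>2))"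
    using i by (rule Bochner_Integration.integrable_add)
  then show n: "integrable ?P (\<lambda>(t, x). norm (f t x) * norm (h t x))"
  proof (rule Bochner_Integration.integrable_bound)
    show "AE p in ?P. norm (case p of (t, x) \<Rightarrow> norm (f t x) * norm (h t x)) \<le>
        norm ((case p of (t, x) \<Rightarrow> (norm (f t x))\<^sup>2) + (case p of (t, x) \<Rightarrow> (norm (h t x))\<^sup>2))"
    proof (rule AE_I2, clarify)
      fix t x
      have "2 * (norm (f t x) * norm (h t x)) \<le> (norm (f t x))\<^sup>2 + (norm (h t x))\<^sup>2"
        using zero_le_power2[of "norm (f t x) - norm (h t x)"] by (simp add: power2_eq_square algebra_simps)
      moreover have "0 \<le> norm (f t x) * norm (h t x)" by simp
      ultimately have "norm (f t x) * norm (h t x) \<le> (norm (f t x))\<^sup>2 + (norm (h t x))\<^sup>2" by linarith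
      then show "norm (norm (f t x) * norm (h t x)) \<le> norm ((norm (f t x))\<^sup>2 + (norm (h t x))\<^sup>2)" by simp
    qed
  qed measurable
  show "integrable ?P (\<lambda>(t, x). f t x \<bullet> h t x)"
    by (rule Bochner_Integration.integrable_bound[OF n]) (auto intro!: AE_I2 Cauchy_Schwarz_ineq2)
qed

text \<open>
  For almost every \<open>x\<close>, the time integral is half the square of the norm of \<open>\<integral>\<^sub>0\<^sup>T g(t, x) dt\<close>.
\<close>

lemma integral_pair_inner_tail_nonneg:
  fixes g :: "real \<Rightarrow> 'a \<Rightarrow> 'c::euclidean_space"
  assumes g: "in_LpLp 2 T M g" and M: "sigma_finite_measure M"
  shows "0 \<le> integral\<^sup>L (lebesgue_on {0<..<T} \<Otimes>\<^sub>M M) (\<lambda>(t, x). g t x \<bullet> tail T g t x)"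
proof -
  let ?L = "lebesgue_on {0<..<T}"
  interpret L: finite_measure ?L by (rule finite_measure_time)
  interpret M: sigma_finite_measure M by (rule M)
  interpret P: pair_sigma_finite ?L M ..
  have i: "integrable (?L \<Otimes>\<^sub>M M) (\<lambda>(t, x). g t x \<bullet> tail T g t x)"
    by (rule in_LpLp_2_inner_integrable(1)[OF g tail_in_LpLp[OF g M]])
  have "0 \<le> (LINT x|M. LINT t|?L. g t x \<bullet> tail T g t x)"
  proof (rule integral_nonneg_AE)
    show "AE x in M. 0 \<le> (LINT t|?L. g t x \<bullet> tail T g t x)"
      using AE_slice_integrable[OF g M]
    proof eventually_elim
      case (elim x)
      then have "2 * (LINT t|?L. g t x \<bullet> tail T g t x) = (LINT s|?L. g s x) \<bullet> (LINT s|?L. g s x)"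
        using integral_inner_tail[of T "\<lambda>s. g s x"] by (simp add: tail_def)
      then show ?case using inner_ge_zero[of "LINT s|?L. g s x"] by linarith
    qed
  qed
  also have "\<dots> = integral\<^sup>L (?L \<Otimes>\<^sub>M M) (\<lambda>(t, x). g t x \<bullet> tail T g t x)" by (rule P.integral_snd[OF i])
  finally show ?thesis .
qed

text \<open>
  Dominated convergence twice: in \<open>s\<close>, inside the tail, with the bound \<open>norm (g s x)\<close>, and then in
  \<open>(t, x)\<close>, with the product of \<open>norm (g t x)\<close> and its own tail, both square integrable.
\<close>

lemma tendsto_integral_inner_tail:
  fixes g :: "real \<Rightarrow> 'a \<Rightarrow> 'c::euclidean_space" and D :: "nat \<Rightarrow> real \<Rightarrow> 'a \<Rightarrow> real"
  assumes g: "in_LpLp 2 T M g" and M: "sigma_finite_measure M"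
    and Dm[measurable]: "\<And>n. (\<lambda>(t, x). D n t x) \<in> borel_measurable (lebesgue_on {0<..<T} \<Otimes>\<^sub>M M)"
    and D1: "\<And>n t x. \<bar>D n t x\<bar> \<le> 1" and lim: "\<And>t x. (\<lambda>n. D n t x) \<longlonglongrightarrow> 1"
  shows "(\<lambda>n. integral\<^sup>L (lebesgue_on {0<..<T} \<Otimes>\<^sub>M M) (\<lambda>(t, x). g t x \<bullet> tail T (\<lambda>t x. D n t x *\<^sub>R g t x) t x))
    \<longlonglongrightarrow> integral\<^sup>L (lebesgue_on {0<..<T} \<Otimes>\<^sub>M M) (\<lambda>(t, x). g t x \<bullet> tail T g t x)"
proof -
  let ?L = "lebesgue_on {0<..<T}"
  interpret L: finite_measure ?L by (rule finite_measure_time)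
  have gm[measurable]: "(\<lambda>(t, x). g t x) \<in> borel_measurable (?L \<Otimes>\<^sub>M M)"
    using g by (simp add: in_LpLp_2_iff)
  let ?ng = "\<lambda>t x. norm (g t x)"
  have "(\<lambda>(t, x). norm (g t x)) \<in> borel_measurable (?L \<Otimes>\<^sub>M M)" by measurable
  then have ng: "in_LpLp 2 T M ?ng" by (rule in_LpLp_2_bound[OF g]) simp
  have dom: "integrable (?L \<Otimes>\<^sub>M M) (\<lambda>(t, x). norm (g t x) * norm (tail T ?ng t x))"
    using in_LpLp_2_inner_integrable(2)[OF ng tail_in_LpLp[OF ng M]] by simp
  have Dgm: "(\<lambda>(t, x). D n t x *\<^sub>R g t x) \<in> borel_measurable (?L \<Otimes>\<^sub>M M)" for n by measurable
  note [measurable] = tail_measurable_pair[OF gm] tail_measurable_pair[OF Dgm]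
  have good: "AE p in ?L \<Otimes>\<^sub>M M. integrable ?L (\<lambda>s. g s (snd p)) \<and> snd p \<in> space M"
    using AE_pair_snd[OF L.sigma_finite_measure_axioms M AE_slice_integrable[OF g M]] AE_space
    by eventually_elim (auto simp: space_pair_measure)
  show ?thesis
  proof (rule integral_dominated_convergence[OF _ _ dom])
    have slice: "(\<lambda>s. D n s x) \<in> borel_measurable ?L" if "x \<in> space M" for n x
      using measurable_compose[OF measurable_Pair2'[OF that] Dm] by simp
    show "AE p in ?L \<Otimes>\<^sub>M M. (\<lambda>n. case p of (t, x) \<Rightarrow> g t x \<bullet> tail T (\<lambda>t x. D n t x *\<^sub>R g t x) t x)
        \<longlonglongrightarrow> (case p of (t, x) \<Rightarrow> g t x \<bullet> tail T g t x)"
      using good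
    proof eventually_elim
      case (elim p)
      obtain t x where p: "p = (t, x)" by (cases p)
      have gi: "integrable ?L (\<lambda>s. g s x)" and x: "x \<in> space M" using elim by (auto simp: p)
      have "(\<lambda>n. tail T (\<lambda>t x. D n t x *\<^sub>R g t x) t x) \<longlonglongrightarrow> tail T g t x"
        unfolding tail_def
      proof (rule integral_dominated_convergence[OF _ _ integrable_norm[OF gi]])
        show "(\<lambda>s. if t < s then g s x else 0) \<in> borel_measurable ?L"
          by (rule measurable_time_if) (use gi in auto)
        show "(\<lambda>s. if t < s then D n s x *\<^sub>R g s x else 0) \<in> borel_measurable ?L" for n
          by (rule measurable_time_if, rule borel_measurable_scaleR[OF slice[OF x] borel_measurable_integrable[OF gi]])
        show "AE s in ?L. (\<lambda>n. if t < s then D n s x *\<^sub>R g s x else 0) \<longlonglongrightarrow> (if t < s then g s x else 0)"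
        proof (rule AE_I2)
          fix s
          have "(\<lambda>n. D n s x *\<^sub>R g s x) \<longlonglongrightarrow> 1 *\<^sub>R g s x" by (intro tendsto_intros lim)
          then show "(\<lambda>n. if t < s then D n s x *\<^sub>R g s x else 0) \<longlonglongrightarrow> (if t < s then g s x else 0)" by simp
        qed
        show "AE s in ?L. norm (if t < s then D n s x *\<^sub>R g s x else 0) \<le> norm (g s x)" for n
          using D1 by (auto simp: mult_left_le_one_le)
      qed
      then show ?case unfolding p by (auto intro: tendsto_inner)
    qed
    show "AE p in ?L \<Otimes>\<^sub>M M. norm (case p of (t, x) \<Rightarrow> g t x \<bullet> tail T (\<lambda>t x. D n t x *\<^sub>R g t x) t x)
        \<le> (case p of (t, x) \<Rightarrow> norm (g t x) * norm (tail T ?ng t x))" for n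
      using good
    proof eventually_elim
      case (elim p)
      obtain t x where p: "p = (t, x)" by (cases p)
      have gi: "integrable ?L (\<lambda>s. g s x)" and x: "x \<in> space M" using elim by (auto simp: p)
      have nDg: "norm (D n s x *\<^sub>R g s x) \<le> norm (g s x)" for s
        using D1[of n s x] by (simp add: mult_left_le_one_le)
      have Dgi: "integrable ?L (\<lambda>s. D n s x *\<^sub>R g s x)"
        by (rule Bochner_Integration.integrable_bound[OF gi])
           (use nDg slice[OF x] gi in \<open>auto intro!: borel_measurable_scaleR\<close>)
      have "norm (tail T (\<lambda>t x. D n t x *\<^sub>R g t x) t x) \<le> (LINT s|?L. norm (if t < s then D n s x *\<^sub>R g s x else 0))"
        unfolding tail_def by (rule integral_norm_bound)
      also have "\<dots> \<le> (LINT s|?L. (if t < s then norm (g s x) else 0))"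
      proof (rule integral_mono)
        show "integrable ?L (\<lambda>s. norm (if t < s then D n s x *\<^sub>R g s x else 0))"
          by (rule integrable_norm, rule integrable_time_if[OF Dgi])
        show "integrable ?L (\<lambda>s. if t < s then norm (g s x) else 0)"
          by (rule integrable_time_if, rule integrable_norm[OF gi])
      qed (use nDg in auto)
      also have "\<dots> \<le> norm (tail T ?ng t x)" unfolding tail_def by simp
      finally have "norm (g t x) * norm (tail T (\<lambda>t x. D n t x *\<^sub>R g t x) t x) \<le> norm (g t x) * norm (tail T ?ng t x)"
        by (rule mult_left_mono) simp
      then show ?case unfolding p prod.case using order_trans[OF Cauchy_Schwarz_ineq2] by simp
    qed
  qed measurable
qed

section \<open>Uniqueness\<close>

text \<open>
  The initial data cancel. The iterated integrals of the weak formulation are turned into integrals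
  over the product so that they can be subtracted.
\<close>

lemma weak_form_difference:
  fixes u v \<eta>' :: "real \<Rightarrow> 'a \<Rightarrow> real" and gu gv h :: "real \<Rightarrow> 'b \<Rightarrow> 'c::euclidean_space"
  assumes N: "sigma_finite_measure N" and M: "sigma_finite_measure M"
    and L2: "in_LpLp 2 T N u" "in_LpLp 2 T N v" "in_LpLp 2 T N \<eta>'"
      "in_LpLp 2 T M gu" "in_LpLp 2 T M gv" "in_LpLp 2 T M h"
    and eqs: "(LINT t|lebesgue_on {0<..<T}. LINT x|N. u t x * \<eta>' t x) =
        - c + (LINT t|lebesgue_on {0<..<T}. LINT x|M. gu t x \<bullet> h t x)"
      "(LINT t|lebesgue_on {0<..<T}. LINT x|N. v t x * \<eta>' t x) =
        - c + (LINT t|lebesgue_on {0<..<T}. LINT x|M. gv t x \<bullet> h t x)"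
  shows "integral\<^sup>L (lebesgue_on {0<..<T} \<Otimes>\<^sub>M N) (\<lambda>(t, x). (u t x - v t x) * \<eta>' t x) =
      integral\<^sup>L (lebesgue_on {0<..<T} \<Otimes>\<^sub>M M) (\<lambda>(t, x). (gu t x - gv t x) \<bullet> h t x)"
proof -
  let ?L = "lebesgue_on {0<..<T}"
  interpret L: finite_measure ?L by (rule finite_measure_time)
  interpret N: sigma_finite_measure N by (rule N)
  interpret M: sigma_finite_measure M by (rule M)
  interpret PN: pair_sigma_finite ?L N ..
  interpret PM: pair_sigma_finite ?L M ..
  have i: "integrable (?L \<Otimes>\<^sub>M N) (\<lambda>(t, x). u t x * \<eta>' t x)" "integrable (?L \<Otimes>\<^sub>M N) (\<lambda>(t, x). v t x * \<eta>' t x)"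
    using in_LpLp_2_inner_integrable(1)[OF L2(1,3)] in_LpLp_2_inner_integrable(1)[OF L2(2,3)] by simp_all
  have j: "integrable (?L \<Otimes>\<^sub>M M) (\<lambda>(t, x). gu t x \<bullet> h t x)" "integrable (?L \<Otimes>\<^sub>M M) (\<lambda>(t, x). gv t x \<bullet> h t x)"
    using in_LpLp_2_inner_integrable(1)[OF L2(4,6)] in_LpLp_2_inner_integrable(1)[OF L2(5,6)] by simp_all
  have "integral\<^sup>L (?L \<Otimes>\<^sub>M N) (\<lambda>(t, x). (u t x - v t x) * \<eta>' t x) =
      integral\<^sup>L (?L \<Otimes>\<^sub>M N) (\<lambda>(t, x). u t x * \<eta>' t x) - integral\<^sup>L (?L \<Otimes>\<^sub>M N) (\<lambda>(t, x). v t x * \<eta>' t x)"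
    using Bochner_Integration.integral_diff[OF i] by (simp add: case_prod_unfold left_diff_distrib)
  also have "\<dots> = integral\<^sup>L (?L \<Otimes>\<^sub>M M) (\<lambda>(t, x). gu t x \<bullet> h t x) - integral\<^sup>L (?L \<Otimes>\<^sub>M M) (\<lambda>(t, x). gv t x \<bullet> h t x)"
    using eqs unfolding PN.integral_fst[OF i(1)] PN.integral_fst[OF i(2)] PM.integral_fst[OF j(1)] PM.integral_fst[OF j(2)]
    by simp
  also have "\<dots> = integral\<^sup>L (?L \<Otimes>\<^sub>M M) (\<lambda>(t, x). (gu t x - gv t x) \<bullet> h t x)"
    using Bochner_Integration.integral_diff[OF j] by (simp add: case_prod_unfold inner_diff_left)
  finally show ?thesis .
qed

lemma trunc_spow_diff_in_L2:
  fixes u v :: "real \<Rightarrow> 'a \<Rightarrow> real"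
  assumes m: "m > 1" and n: "n \<ge> 1"
    and u: "in_LpLp (m + 1) T M u" and v: "in_LpLp (m + 1) T M v"
  shows "in_LpLp 2 T M (\<lambda>t x. trunc n (spow (u t x) m - spow (v t x) m))"
proof -
  let ?P = "lebesgue_on {0<..<T} \<Otimes>\<^sub>M M"
  have [measurable]: "(\<lambda>(t, x). u t x) \<in> borel_measurable ?P" "(\<lambda>(t, x). v t x) \<in> borel_measurable ?P"
    and i: "integrable ?P (\<lambda>(t, x). \<bar>u t x\<bar> powr (m + 1))" "integrable ?P (\<lambda>(t, x). \<bar>v t x\<bar> powr (m + 1))"
    using u v by (auto simp: in_LpLp_def in_Lp_def case_prod_unfold)
  have [measurable]: "trunc n \<in> borel_measurable borel"
    unfolding trunc_def[abs_def] by measurable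
  have fm: "(\<lambda>(t, x). trunc n (spow (u t x) m - spow (v t x) m)) \<in> borel_measurable ?P" by measurable
  have "integrable ?P (\<lambda>p. n * (4 * ((case p of (t, x) \<Rightarrow> \<bar>u t x\<bar> powr (m + 1)) + (case p of (t, x) \<Rightarrow> \<bar>v t x\<bar> powr (m + 1)))))"
    using i by (intro integrable_mult_right Bochner_Integration.integrable_add)
  then have "integrable ?P (\<lambda>(t, x). (norm (trunc n (spow (u t x) m - spow (v t x) m)))\<^sup>2)"
  proof (rule Bochner_Integration.integrable_bound)
    show "AE p in ?P. norm (case p of (t, x) \<Rightarrow> (norm (trunc n (spow (u t x) m - spow (v t x) m)))\<^sup>2) \<le>
        norm (n * (4 * ((case p of (t, x) \<Rightarrow> \<bar>u t x\<bar> powr (m + 1)) + (case p of (t, x) \<Rightarrow> \<bar>v t x\<bar> powr (m + 1)))))"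
    proof (rule AE_I2, clarify)
      fix t x
      have "(trunc n (spow (u t x) m - spow (v t x) m))\<^sup>2 \<le> n * \<bar>spow (u t x) m - spow (v t x) m\<bar> powr ((m + 1) / m)"
        using m by (intro trunc_square_le[OF n]) (auto simp: field_simps)
      also have "\<dots> \<le> n * (4 * (\<bar>u t x\<bar> powr (m + 1) + \<bar>v t x\<bar> powr (m + 1)))"
        using n by (intro mult_left_mono spow_diff_powr_le[OF m]) auto
      finally show "norm ((norm (trunc n (spow (u t x) m - spow (v t x) m)))\<^sup>2) \<le>
          norm (n * (4 * (\<bar>u t x\<bar> powr (m + 1) + \<bar>v t x\<bar> powr (m + 1))))"
        using n by simp
    qed
  qed (use fm in measurable)
  then show ?thesis using fm by (simp add: in_LpLp_2_iff)
qed

text \<open>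
  Oleinik's argument, with \<open>w = u\<^sup>m - v\<^sup>m\<close> truncated. In the proof, \<open>A n\<close> is the integral of
  \<open>(u - v) trunc n w\<close> and \<open>J n\<close> the integral of the product of \<open>g\<close> with the gradient of the \<open>n\<close>-th test
  function, so the weak formulation gives \<open>A n = - J n\<close>. The limit is taken in \<open>J n\<close> only: since
  \<open>A n\<close> increases with \<open>n\<close>, the sign of the limit already forces \<open>A 1 \<le> 0\<close>.
\<close>

lemma weak_solutions_agree_until:
  fixes \<Omega> :: "'a::euclidean_space set" and u v :: "real \<Rightarrow> 'a \<Rightarrow> real"
  assumes m: "m > 1" and \<Omega>: "open \<Omega>"
    and \<rho>\<nu>[measurable]: "\<rho>\<nu> \<in> borel_measurable (lebesgue_on \<Omega>)"
    and \<rho>\<mu>: "\<rho>\<mu> \<in> borel_measurable (lebesgue_on \<Omega>)"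
    and pos\<nu>: "AE x in lebesgue_on \<Omega>. \<rho>\<nu> x > 0" and pos\<mu>: "AE x in lebesgue_on \<Omega>. \<rho>\<mu> x > 0"
    and inv: "loc_integrable \<Omega> (\<lambda>x. inverse (\<rho>\<mu> x))"
    and u: "weak_solution_N \<Omega> \<rho>\<nu> \<rho>\<mu> m u0 u" "in_LpLp (m + 1) T (weighted \<Omega> \<rho>\<nu>) u"
    and v: "weak_solution_N \<Omega> \<rho>\<nu> \<rho>\<mu> m u0 v" "in_LpLp (m + 1) T (weighted \<Omega> \<rho>\<nu>) v"
    and T: "T > 0"
  shows "AE (t, x) in lebesgue_on {0<..<T} \<Otimes>\<^sub>M lebesgue_on \<Omega>. u t x = v t x"
proof -
  let ?L = "lebesgue_on {0<..<T}" and ?N = "lebesgue_on \<Omega>"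
  let ?\<nu> = "weighted \<Omega> \<rho>\<nu>" and ?\<mu> = "weighted \<Omega> \<rho>\<mu>"
  have \<Omega>m: "\<Omega> \<in> sets lebesgue" using \<Omega> by simp
  have sfL: "sigma_finite_measure ?L" by (rule sigma_finite_lebesgue_on) simp
  have sfN: "sigma_finite_measure ?N" by (rule sigma_finite_lebesgue_on[OF \<Omega>m])
  have sf\<nu>: "sigma_finite_measure ?\<nu>" and sf\<mu>: "sigma_finite_measure ?\<mu>"
    by (rule sigma_finite_weighted[OF \<Omega>m \<rho>\<nu>], rule sigma_finite_weighted[OF \<Omega>m \<rho>\<mu>])
  obtain gu where gu: "AE t in lebesgue_on {0<..}. weak_gradient \<Omega> (\<lambda>x. spow (u t x) m) (gu t)"
      "in_LpLp 2 T ?\<mu> gu"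
      "\<And>\<eta> \<eta>' h. test_function \<Omega> \<rho>\<nu> \<rho>\<mu> T \<eta> \<eta>' h \<Longrightarrow>
         (LINT t|?L. LINT x|?\<nu>. u t x * \<eta>' t x) = - (LINT x|?\<nu>. u0 x * \<eta> 0 x) + (LINT t|?L. LINT x|?\<mu>. gu t x \<bullet> h t x)"
    using u(1) T unfolding weak_solution_N_def by blast
  obtain gv where gv: "AE t in lebesgue_on {0<..}. weak_gradient \<Omega> (\<lambda>x. spow (v t x) m) (gv t)"
      "in_LpLp 2 T ?\<mu> gv"
      "\<And>\<eta> \<eta>' h. test_function \<Omega> \<rho>\<nu> \<rho>\<mu> T \<eta> \<eta>' h \<Longrightarrow>
         (LINT t|?L. LINT x|?\<nu>. v t x * \<eta>' t x) = - (LINT x|?\<nu>. u0 x * \<eta> 0 x) + (LINT t|?L. LINT x|?\<mu>. gv t x \<bullet> h t x)"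
    using v(1) T unfolding weak_solution_N_def by blast
  have u2: "in_LpLp 2 T ?\<nu> u" and v2: "in_LpLp 2 T ?\<nu> v"
    using u(1) v(1) T by (auto simp: weak_solution_N_def)
  have um[measurable]: "(\<lambda>(t, x). u t x) \<in> borel_measurable (?L \<Otimes>\<^sub>M ?N)"
    and vm[measurable]: "(\<lambda>(t, x). v t x) \<in> borel_measurable (?L \<Otimes>\<^sub>M ?N)"
    using u2 v2 by (simp_all add: in_LpLp_2_iff borel_measurable_pair_weighted)
  define w where "w t x = spow (u t x) m - spow (v t x) m" for t x
  define g where "g t x = gu t x - gv t x" for t x
  have g2: "in_LpLp 2 T ?\<mu> g" unfolding g_def by (rule in_LpLp_2_diff[OF gu(2) gv(2)])
  have gm[measurable]: "(\<lambda>(t, x). g t x) \<in> borel_measurable (?L \<Otimes>\<^sub>M ?\<mu>)"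
    using g2 by (simp add: in_LpLp_2_iff)
  have wm[measurable]: "(\<lambda>(t, x). w t x) \<in> borel_measurable (?L \<Otimes>\<^sub>M ?N)"
    unfolding w_def by measurable
  have wm\<mu>[measurable]: "(\<lambda>(t, x). w t x) \<in> borel_measurable (?L \<Otimes>\<^sub>M ?\<mu>)"
    using wm by (simp add: borel_measurable_pair_weighted)
  have wg: "AE t in ?L. weak_gradient \<Omega> (w t) (g t)"
  proof -
    have "AE t in lebesgue. t \<in> {0<..} \<longrightarrow> weak_gradient \<Omega> (\<lambda>x. spow (u t x) m) (gu t)"
      "AE t in lebesgue. t \<in> {0<..} \<longrightarrow> weak_gradient \<Omega> (\<lambda>x. spow (v t x) m) (gv t)"
      using gu(1) gv(1) by (simp_all add: AE_restrict_space_iff)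
    then have "AE t in lebesgue. t \<in> {0<..<T} \<longrightarrow> weak_gradient \<Omega> (w t) (g t)"
    proof eventually_elim
      case (elim t)
      then show ?case using weak_gradient_diff[OF _ _ \<Omega>m] by (auto simp: w_def[abs_def] g_def[abs_def])
    qed
    then show ?thesis by (simp add: AE_restrict_space_iff)
  qed
  define f where "f n t x = trunc n (w t x)" for n t x
  define G where "G n t x = trunc' n (w t x) *\<^sub>R g t x" for n t x
  define A where "A n = integral\<^sup>L (?L \<Otimes>\<^sub>M ?\<nu>) (\<lambda>(t, x). (u t x - v t x) * f n t x)" for n
  define J where "J n = integral\<^sup>L (?L \<Otimes>\<^sub>M ?\<mu>) (\<lambda>(t, x). g t x \<bullet> tail T (G n) t x)" for n
  have t'm[measurable]: "trunc' n \<in> borel_measurable borel" for n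
    unfolding trunc'_def[abs_def] by measurable
  have f2: "in_LpLp 2 T ?\<nu> (f n)" if "n \<ge> 1" for n
    using trunc_spow_diff_in_L2[OF m that u(2) v(2)] by (simp add: f_def[abs_def] w_def[abs_def])
  have G2: "in_LpLp 2 T ?\<mu> (G n)" if "n \<ge> 1" for n
  proof (rule in_LpLp_2_bound[OF g2])
    show "(\<lambda>(t, x). G n t x) \<in> borel_measurable (?L \<Otimes>\<^sub>M ?\<mu>)"
      unfolding G_def by measurable
    show "norm (G n t x) \<le> norm (g t x)" for t x
      using trunc'_bounds[of n "w t x"] that by (simp add: G_def mult_left_le_one_le)
  qed
  have Ai: "integrable (?L \<Otimes>\<^sub>M ?\<nu>) (\<lambda>(t, x). (u t x - v t x) * f n t x)" if "n \<ge> 1" for n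
    using in_LpLp_2_inner_integrable(1)[OF in_LpLp_2_diff[OF u2 v2] f2[OF that]] by simp
  have AJ: "A n = - J n" if n: "n \<ge> 1" for n
  proof -
    have n0: "n > 0" using n by simp
    have wgn: "AE t in ?L. weak_gradient \<Omega> (f n t) (G n t)"
      using wg
    proof eventually_elim
      case (elim t)
      have "\<bar>trunc' n s\<bar> \<le> 1" for s using trunc'_bounds[OF n0, of s] by simp
      from weak_gradient_compose[OF elim \<Omega> trunc_has_derivative[OF n0] trunc'_continuous[OF n0] this]
      show ?case by (simp add: f_def[abs_def] G_def[abs_def])
    qed
    have fb: "\<bar>f n t x\<bar> \<le> sqrt n" for t x unfolding f_def by (rule trunc_le_sqrt[OF n0])
    have tf: "test_function \<Omega> \<rho>\<nu> \<rho>\<mu> T (tail T (f n)) (\<lambda>t x. - f n t x) (tail T (G n))"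
      by (rule test_function_tail[OF \<Omega>m T \<rho>\<nu> \<rho>\<mu> pos\<mu> inv f2[OF n] fb G2[OF n] wgn])
    then have "in_LpLp 2 T ?\<nu> (\<lambda>t x. - f n t x)" by (simp add: test_function_def W12_time_def)
    from weak_form_difference[OF sf\<nu> sf\<mu> u2 v2 this gu(2) gv(2) tail_in_LpLp[OF G2[OF n] sf\<mu>] gu(3)[OF tf] gv(3)[OF tf]]
    have "integral\<^sup>L (?L \<Otimes>\<^sub>M ?\<nu>) (\<lambda>(t, x). (u t x - v t x) * - f n t x) = J n"
      by (simp add: J_def g_def)
    moreover have "integral\<^sup>L (?L \<Otimes>\<^sub>M ?\<nu>) (\<lambda>(t, x). (u t x - v t x) * - f n t x) = - A n"
      unfolding A_def by (subst Bochner_Integration.integral_minus[symmetric])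
         (simp add: case_prod_unfold)
    ultimately show ?thesis by simp
  qed
  have sgn: "0 \<le> (u t x - v t x) * w t x" for t x
    unfolding w_def using m by (intro spow_diff_sign) simp
  have "(\<lambda>k. J (real (Suc k))) \<longlonglongrightarrow> integral\<^sup>L (?L \<Otimes>\<^sub>M ?\<mu>) (\<lambda>(t, x). g t x \<bullet> tail T g t x)"
    unfolding J_def G_def[abs_def]
  proof (rule tendsto_integral_inner_tail[OF g2 sf\<mu>])
    show "(\<lambda>(t, x). trunc' (real (Suc k)) (w t x)) \<in> borel_measurable (?L \<Otimes>\<^sub>M ?\<mu>)" for k by measurable
    show "\<bar>trunc' (real (Suc k)) (w t x)\<bar> \<le> 1" for k t x
      using trunc'_bounds[of "real (Suc k)" "w t x"] by (simp del: of_nat_Suc)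
  qed (rule trunc'_tendsto)
  then have lim: "(\<lambda>k. - J (real (Suc k))) \<longlonglongrightarrow> - integral\<^sup>L (?L \<Otimes>\<^sub>M ?\<mu>) (\<lambda>(t, x). g t x \<bullet> tail T g t x)"
    by (rule tendsto_minus)
  have "A 1 \<le> - J (real (Suc k))" for k
  proof -
    have n: "real (Suc k) \<ge> 1" by simp
    have "A 1 \<le> A (real (Suc k))"
      unfolding A_def
    proof (rule integral_mono[OF Ai Ai[OF n]])
      show "(case p of (t, x) \<Rightarrow> (u t x - v t x) * f 1 t x) \<le> (case p of (t, x) \<Rightarrow> (u t x - v t x) * f (real (Suc k)) t x)" for p
        unfolding f_def case_prod_unfold by (rule trunc_mono_level(2)[OF n sgn])
    qed simp
    then show ?thesis using AJ[OF n] by simp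
  qed
  then have "A 1 \<le> - integral\<^sup>L (?L \<Otimes>\<^sub>M ?\<mu>) (\<lambda>(t, x). g t x \<bullet> tail T g t x)"
    by (intro LIMSEQ_le_const[OF lim]) blast
  with integral_pair_inner_tail_nonneg[OF g2 sf\<mu>] have A1: "A 1 \<le> 0" by linarith
  have nn: "0 \<le> (u t x - v t x) * f 1 t x" for t x
    unfolding f_def by (rule trunc_mono_level(1)[OF order_refl sgn])
  have "A 1 \<ge> 0" unfolding A_def by (rule integral_nonneg_AE) (use nn in auto)
  with A1 have "A 1 = 0" by simp
  then have "AE p in ?L \<Otimes>\<^sub>M ?\<nu>. (case p of (t, x) \<Rightarrow> (u t x - v t x) * f 1 t x) = 0"
    unfolding A_def using nn by (subst (asm) integral_nonneg_eq_0_iff_AE[OF Ai]) auto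
  then have "AE p in density (?L \<Otimes>\<^sub>M ?N) (\<lambda>(t, x). ennreal (\<rho>\<nu> x)). (case p of (t, x) \<Rightarrow> (u t x - v t x) * f 1 t x) = 0"
    unfolding pair_weighted[OF \<Omega>m \<rho>\<nu>] .
  moreover have "(\<lambda>(t, x). ennreal (\<rho>\<nu> x)) \<in> borel_measurable (?L \<Otimes>\<^sub>M ?N)" by measurable
  ultimately have "AE p in ?L \<Otimes>\<^sub>M ?N. 0 < (case p of (t, x) \<Rightarrow> ennreal (\<rho>\<nu> x)) \<longrightarrow>
      (case p of (t, x) \<Rightarrow> (u t x - v t x) * f 1 t x) = 0"
    by (subst (asm) AE_density) auto
  then show ?thesis
    using AE_pair_snd[OF sfL sfN pos\<nu>]
  proof eventually_elim
    case (elim p)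
    obtain t x where p: "p = (t, x)" by (cases p)
    have "(u t x - v t x) * f 1 t x = 0" using elim by (simp add: p)
    then have "u t x = v t x \<or> w t x = 0" using trunc_eq_0[of 1 "w t x"] by (auto simp: f_def)
    then have "u t x = v t x" using spow_diff_sign(2)[of m "u t x" "v t x"] m by (auto simp: w_def)
    then show ?case by (simp add: p)
  qed
qed

text \<open>
  This serves to show that the set where \<open>u = v\<close>, known to be measurable over each bounded time interval, is
  measurable over all positive times.
\<close>

lemma sets_pair_lebesgue_on_mono:
  assumes S: "S \<in> sets (lebesgue_on A \<Otimes>\<^sub>M N)" and AB: "A \<subseteq> B" "A \<in> sets lebesgue"
  shows "S \<in> sets (lebesgue_on B \<Otimes>\<^sub>M N)"
proof -
  have mono: "a \<in> sets (lebesgue_on B)" if "a \<in> sets (lebesgue_on A)" for a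
  proof -
    have "a \<in> sets lebesgue" "a \<subseteq> A" using that AB(2) by (auto simp: sets_restrict_space_iff)
    then show ?thesis using AB(1) by (auto simp: sets_restrict_space)
  qed
  have "S \<in> sigma_sets (A \<times> space N) {a \<times> b |a b. a \<in> sets (lebesgue_on A) \<and> b \<in> sets N}"
    using S by (simp add: sets_pair_measure)
  then show ?thesis
  proof induction
    case (Basic a)
    then show ?case using mono by auto
  next
    case Empty
    then show ?case by simp
  next
    case (Compl a)
    have "A \<in> sets (lebesgue_on A)" using sets.top[of "lebesgue_on A"] by simp
    then have "A \<times> space N \<in> sets (lebesgue_on B \<Otimes>\<^sub>M N)" by (intro pair_measureI mono) auto
    then show ?case using Compl.IH by (rule sets.Diff)
  next
    case (Union a)
    then show ?case by (intro sets.countable_UN) auto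
  qed
qed

theorem proposition3p10:
  fixes \<Omega> :: "'a::euclidean_space set"
    and \<rho>\<nu> \<rho>\<mu> u0 :: "'a \<Rightarrow> real"
    and m :: real
    and u v :: "real \<Rightarrow> 'a \<Rightarrow> real"
  assumes "m > 1"
    and "open \<Omega>" and "connected \<Omega>" and "\<Omega> \<noteq> {}"
    and "\<rho>\<nu> \<in> borel_measurable (lebesgue_on \<Omega>)"
    and "\<rho>\<mu> \<in> borel_measurable (lebesgue_on \<Omega>)"
    and "AE x in lebesgue_on \<Omega>. \<rho>\<nu> x > 0"
    and "AE x in lebesgue_on \<Omega>. \<rho>\<mu> x > 0"
    and "loc_integrable \<Omega> (\<lambda>x. inverse (\<rho>\<mu> x))"
    and "in_Lp 2 (weighted \<Omega> \<rho>\<nu>) u0"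
    and "weak_solution_N \<Omega> \<rho>\<nu> \<rho>\<mu> m u0 u"
    and "\<forall>T>0. in_LpLp (m + 1) T (weighted \<Omega> \<rho>\<nu>) u"
    and "weak_solution_N \<Omega> \<rho>\<nu> \<rho>\<mu> m u0 v"
    and "\<forall>T>0. in_LpLp (m + 1) T (weighted \<Omega> \<rho>\<nu>) v"
  shows "AE (t, x) in lebesgue_on {0<..} \<Otimes>\<^sub>M lebesgue_on \<Omega>. u t x = v t x"
proof -
  let ?N = "lebesgue_on \<Omega>" and ?L = "\<lambda>n. lebesgue_on {0<..<real (Suc n)}"
  have \<Omega>m: "\<Omega> \<in> sets lebesgue" using assms(2) by simp
  interpret N: sigma_finite_measure ?N by (rule sigma_finite_lebesgue_on[OF \<Omega>m])
  interpret L: sigma_finite_measure "lebesgue_on {0::real<..}" by (rule sigma_finite_lebesgue_on) simp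
  interpret P: pair_sigma_finite "lebesgue_on {0::real<..}" ?N ..
  have agree: "AE (t, x) in ?L n \<Otimes>\<^sub>M ?N. u t x = v t x" for n
    by (rule weak_solutions_agree_until[OF assms(1,2,5-9,11) _ assms(13)]) (use assms(12,14) in auto)
  have "AE t in ?L n. AE x in ?N. u t x = v t x" for n
  proof -
    interpret Ln: finite_measure "?L n" by (rule finite_measure_time)
    interpret Pn: pair_sigma_finite "?L n" ?N ..
    from Pn.AE_pair[OF agree] show ?thesis by simp
  qed
  then have "AE t in lebesgue. t \<in> {0<..<real (Suc n)} \<longrightarrow> (AE x in ?N. u t x = v t x)" for n
    by (simp add: AE_restrict_space_iff del: of_nat_Suc)
  then have "AE t in lebesgue. \<forall>n. t \<in> {0<..<real (Suc n)} \<longrightarrow> (AE x in ?N. u t x = v t x)"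
    unfolding AE_all_countable by blast
  then have "AE t in lebesgue. t \<in> {0<..} \<longrightarrow> (AE x in ?N. u t x = v t x)"
  proof eventually_elim
    case (elim t)
    obtain n where "t < real n" using reals_Archimedean2 by blast
    then show ?case using elim[rule_format, of n] by auto
  qed
  then have "AE t in lebesgue_on {0<..}. AE x in ?N. u t x = v t x"
    by (simp add: AE_restrict_space_iff)
  moreover have "{p \<in> space (lebesgue_on {0<..} \<Otimes>\<^sub>M ?N). case p of (t, x) \<Rightarrow> u t x = v t x} \<in>
      sets (lebesgue_on {0<..} \<Otimes>\<^sub>M ?N)"
  proof -
    have S: "{p \<in> space (?L n \<Otimes>\<^sub>M ?N). case p of (t, x) \<Rightarrow> u t x = v t x} \<in> sets (?L n \<Otimes>\<^sub>M ?N)" for n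
    proof -
      have "in_LpLp 2 (real (Suc n)) (weighted \<Omega> \<rho>\<nu>) u" "in_LpLp 2 (real (Suc n)) (weighted \<Omega> \<rho>\<nu>) v"
        using assms(11,13) by (auto simp: weak_solution_N_def)
      then have [measurable]: "(\<lambda>(t, x). u t x) \<in> borel_measurable (?L n \<Otimes>\<^sub>M ?N)"
        "(\<lambda>(t, x). v t x) \<in> borel_measurable (?L n \<Otimes>\<^sub>M ?N)"
        by (simp_all add: in_LpLp_2_iff borel_measurable_pair_weighted)
      have "{p \<in> space (?L n \<Otimes>\<^sub>M ?N). (\<lambda>(t, x). u t x) p = (\<lambda>(t, x). v t x) p} \<in> sets (?L n \<Otimes>\<^sub>M ?N)"
        by measurable
      then show ?thesis by (simp add: case_prod_unfold)
    qed
    have "{p \<in> space (?L n \<Otimes>\<^sub>M ?N). case p of (t, x) \<Rightarrow> u t x = v t x} \<in> sets (lebesgue_on {0<..} \<Otimes>\<^sub>M ?N)" for n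
      by (rule sets_pair_lebesgue_on_mono[OF S]) auto
    then have "(\<Union>n. {p \<in> space (?L n \<Otimes>\<^sub>M ?N). case p of (t, x) \<Rightarrow> u t x = v t x}) \<in> sets (lebesgue_on {0<..} \<Otimes>\<^sub>M ?N)"
      by (intro sets.countable_UN) auto
    also have "(\<Union>n. {p \<in> space (?L n \<Otimes>\<^sub>M ?N). case p of (t, x) \<Rightarrow> u t x = v t x}) =
        {p \<in> space (lebesgue_on {0<..} \<Otimes>\<^sub>M ?N). case p of (t, x) \<Rightarrow> u t x = v t x}"
    proof (intro equalityI subsetI)
      fix p assume p: "p \<in> {p \<in> space (lebesgue_on {0<..} \<Otimes>\<^sub>M ?N). case p of (t, x) \<Rightarrow> u t x = v t x}"
      obtain n where "fst p < real n" using reals_Archimedean2 by blast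
      then have "fst p < real (Suc n)" by simp
      with p show "p \<in> (\<Union>n. {p \<in> space (?L n \<Otimes>\<^sub>M ?N). case p of (t, x) \<Rightarrow> u t x = v t x})"
        by (intro UN_I[of n]) (auto simp: space_pair_measure simp del: of_nat_Suc)
    qed (auto simp: space_pair_measure)
    finally show ?thesis .
  qed
  ultimately show ?thesis by (intro P.AE_pair_measure) auto
qed

end
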